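(* Let $S_1$ and $S_2$ be numerical semigroups minimally generated by $m_1<\cdots<m_d$ and $n_1<\cdots<n_k$ respectively, and let $S=\langle qm_1,\ldots,qm_d,pn_1,\ldots,pn_k\rangle$ be a nice gluing of $S_1$ and $S_2$. If $G(S_2)$ is Cohen-Macaulay, then $G(S)$ is Cohen-Macaulay if and only if $G(S_1)$ is Cohen-Macaulay.
   Context: A numerical semigroup $T$ is a submonoid of $(\mathbb{Z}_{\ge 0},+)$ with finite complement; $\langle\cdots\rangle$ denotes the semigroup (with $0$) generated by the listed integers. Let $M=T\setminus\{0\}$, $nM=M+\cdots+M$ ($n$ summands), $0M=T$. For $s\in T$, $\mathrm{ord}_T(s)$ is the maximum $n\ge 0$ with $s\in nM$. Fix a field $K$; $R=K[[T]]=K[[t^s : s\in T]]$ is the numerical semigroup ring, with maximal ideal $\mathfrak m=(t^s: s\in M)$, and $G(T)=\bigoplus_{n\ge 0}\mathfrak m^n/\mathfrak m^{n+1}$ is its tangent cone. Gluing: given positive integers $p\in S_1\setminus\{m_1,\ldots,m_d\}$ and $q\in S_2\setminus\{n_1,\ldots,n_k\}$ with $\gcd(p,q)=1$, the numerical semigroup $S=\langle qm_1,\ldots,qm_d,pn_1,\ldots,pn_k\rangle$ is called a gluing of $S_1$ and $S_2$. It is a nice gluing of $S_1$ and $S_2$ if $q=an_1$ for some integer $a$ with $1<a\le \mathrm{ord}_{S_1}(p)$. *)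

theory Defs
  imports
    "HOL-Computational_Algebra.Formal_Power_Series"
    "HOL-Library.Extended_Nat"
    "HOL-Algebra.Ideal_Product"
    "HOL-Algebra.QuotRing"
    "HOL-Algebra.Ring_Divisibility"
begin

section \<open>Numerical semigroups\<close>

definition nat_submonoid :: "nat set \<Rightarrow> bool" where
  "nat_submonoid T \<longleftrightarrow> 0 \<in> T \<and> (\<forall>x\<in>T. \<forall>y\<in>T. x + y \<in> T)"

definition numerical_semigroup :: "nat set \<Rightarrow> bool" where
  "numerical_semigroup T \<longleftrightarrow> nat_submonoid T \<and> finite (- T)"

abbreviation semigroup_generated :: "nat set \<Rightarrow> nat set" where
  "semigroup_generated A \<equiv> nat_submonoid hull A"

definition minimally_generated :: "nat set \<Rightarrow> (nat \<Rightarrow> nat) \<Rightarrow> nat \<Rightarrow> bool" where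
  "minimally_generated T m d \<longleftrightarrow>
     strict_mono_on {1..d} m \<and>
     semigroup_generated (m ` {1..d}) = T \<and>
     (\<forall>B. B \<subset> m ` {1..d} \<longrightarrow> semigroup_generated B \<noteq> T)"

fun fold_sums :: "nat set \<Rightarrow> nat \<Rightarrow> nat set" where
  "fold_sums T 0 = T"
| "fold_sums T (Suc n) = {sum_list xs |xs. length xs = Suc n \<and> set xs \<subseteq> T - {0}}"

definition semigroup_ord :: "nat set \<Rightarrow> nat \<Rightarrow> nat" where
  "semigroup_ord T s = (GREATEST n. s \<in> fold_sums T n)"

definition gluing ::
  "(nat \<Rightarrow> nat) \<Rightarrow> nat \<Rightarrow> (nat \<Rightarrow> nat) \<Rightarrow> nat \<Rightarrow> nat \<Rightarrow> nat \<Rightarrow> nat set \<Rightarrow> bool" where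
  "gluing m d n k p q S \<longleftrightarrow>
     0 < p \<and> 0 < q \<and>
     p \<in> semigroup_generated (m ` {1..d}) - m ` {1..d} \<and>
     q \<in> semigroup_generated (n ` {1..k}) - n ` {1..k} \<and>
     gcd p q = 1 \<and>
     S = semigroup_generated ((\<lambda>i. q * m i) ` {1..d} \<union> (\<lambda>j. p * n j) ` {1..k})"

definition nice_gluing ::
  "(nat \<Rightarrow> nat) \<Rightarrow> nat \<Rightarrow> (nat \<Rightarrow> nat) \<Rightarrow> nat \<Rightarrow> nat \<Rightarrow> nat \<Rightarrow> nat set \<Rightarrow> bool" where
  "nice_gluing m d n k p q S \<longleftrightarrow>
     gluing m d n k p q S \<and>
     (\<exists>a. q = a * n 1 \<and> 1 < a \<and> a \<le> semigroup_ord (semigroup_generated (m ` {1..d})) p)"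


section \<open>Associated graded rings\<close>

abbreviation ideal_power :: "('a, 'b) ring_scheme \<Rightarrow> 'a set \<Rightarrow> nat \<Rightarrow> 'a set" where
  "ideal_power R I n \<equiv> I [^]\<^bsub>ideals_set R\<^esub> n"

text \<open>
  The ring $\bigoplus_{n \ge 0} I^n / I^{n+1}$. The summand $I^n / I^{n+1}$ consists of the cosets
  $a + I^{n+1}$ with $a \in I^n$, and sits inside the quotient ring $R / I^{n+1}$, whose addition
  it inherits. An element is the sequence of its homogeneous components. The product of
  $a + I^{i+1}$ and $b + I^{j+1}$ is $ab + I^{i+j+1}$, that is, \<^const>\<open>rcoset_mult\<close>
  taken modulo $I^{i+j+1}$.
\<close>

definition assoc_graded :: "('a, 'b) ring_scheme \<Rightarrow> 'a set \<Rightarrow> (nat \<Rightarrow> 'a set) ring" where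
  "assoc_graded R I =
     \<lparr>carrier = {g. (\<forall>n. \<exists>a \<in> ideal_power R I n. g n = ideal_power R I (Suc n) +>\<^bsub>R\<^esub> a) \<and>
                    finite {n. g n \<noteq> \<zero>\<^bsub>R Quot ideal_power R I (Suc n)\<^esub>}},
      mult = (\<lambda>g h n. finsum (R Quot ideal_power R I (Suc n))
                (\<lambda>i. rcoset_mult R (ideal_power R I (Suc n)) (g i) (h (n - i))) {..n}),
      one = (\<lambda>n. if n = 0 then \<one>\<^bsub>R Quot ideal_power R I (Suc 0)\<^esub>
                 else \<zero>\<^bsub>R Quot ideal_power R I (Suc n)\<^esub>),
      zero = (\<lambda>n. \<zero>\<^bsub>R Quot ideal_power R I (Suc n)\<^esub>),
      add = (\<lambda>g h n. g n \<oplus>\<^bsub>R Quot ideal_power R I (Suc n)\<^esub> h n)\<rparr>"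


section \<open>Localization and Cohen-Macaulay rings\<close>

definition frac_rel :: "('a, 'b) ring_scheme \<Rightarrow> 'a set \<Rightarrow> (('a \<times> 'a) \<times> ('a \<times> 'a)) set" where
  "frac_rel R U =
     {((r, s), (r', s')). r \<in> carrier R \<and> r' \<in> carrier R \<and> s \<in> U \<and> s' \<in> U \<and>
        (\<exists>t\<in>U. t \<otimes>\<^bsub>R\<^esub> (r \<otimes>\<^bsub>R\<^esub> s') = t \<otimes>\<^bsub>R\<^esub> (r' \<otimes>\<^bsub>R\<^esub> s))}"

definition frac :: "('a, 'b) ring_scheme \<Rightarrow> 'a set \<Rightarrow> 'a \<Rightarrow> 'a \<Rightarrow> ('a \<times> 'a) set" where
  "frac R U r s = frac_rel R U `` {(r, s)}"

definition ring_of_fractions :: "('a, 'b) ring_scheme \<Rightarrow> 'a set \<Rightarrow> ('a \<times> 'a) set ring" where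
  "ring_of_fractions R U =
     \<lparr>carrier = (carrier R \<times> U) // frac_rel R U,
      mult = (\<lambda>X Y. \<Union>(r, s)\<in>X. \<Union>(r', s')\<in>Y. frac R U (r \<otimes>\<^bsub>R\<^esub> r') (s \<otimes>\<^bsub>R\<^esub> s')),
      one = frac R U \<one>\<^bsub>R\<^esub> \<one>\<^bsub>R\<^esub>,
      zero = frac R U \<zero>\<^bsub>R\<^esub> \<one>\<^bsub>R\<^esub>,
      add = (\<lambda>X Y. \<Union>(r, s)\<in>X. \<Union>(r', s')\<in>Y.
               frac R U (r \<otimes>\<^bsub>R\<^esub> s' \<oplus>\<^bsub>R\<^esub> r' \<otimes>\<^bsub>R\<^esub> s) (s \<otimes>\<^bsub>R\<^esub> s'))\<rparr>"

definition localization :: "('a, 'b) ring_scheme \<Rightarrow> 'a set \<Rightarrow> ('a \<times> 'a) set ring" where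
  "localization R P = ring_of_fractions R (carrier R - P)"

definition krull_dim :: "('a, 'b) ring_scheme \<Rightarrow> enat" where
  "krull_dim R = Sup {enat n |n. \<exists>P. (\<forall>i\<le>n. primeideal (P i) R) \<and> (\<forall>i<n. P i \<subset> P (Suc i))}"

definition regular_sequence :: "('a, 'b) ring_scheme \<Rightarrow> 'a list \<Rightarrow> bool" where
  "regular_sequence R xs \<longleftrightarrow>
     set xs \<subseteq> carrier R \<and>
     (\<forall>i<length xs. \<forall>r\<in>carrier R.
        xs ! i \<otimes>\<^bsub>R\<^esub> r \<in> Idl\<^bsub>R\<^esub> (set (take i xs)) \<longrightarrow> r \<in> Idl\<^bsub>R\<^esub> (set (take i xs))) \<and>
     Idl\<^bsub>R\<^esub> (set xs) \<noteq> carrier R"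

definition depth :: "('a, 'b) ring_scheme \<Rightarrow> 'a set \<Rightarrow> enat" where
  "depth R I = Sup {enat (length xs) |xs. regular_sequence R xs \<and> set xs \<subseteq> I}"

definition cohen_macaulay_local :: "('a, 'b) ring_scheme \<Rightarrow> bool" where
  "cohen_macaulay_local R \<longleftrightarrow>
     cring R \<and> noetherian_ring R \<and>
     (\<exists>M. {M'. maximalideal M' R} = {M} \<and> depth R M = krull_dim R)"

definition cohen_macaulay :: "('a, 'b) ring_scheme \<Rightarrow> bool" where
  "cohen_macaulay R \<longleftrightarrow>
     cring R \<and> noetherian_ring R \<and>
     (\<forall>P. maximalideal P R \<longrightarrow> cohen_macaulay_local (localization R P))"


section \<open>Numerical semigroup rings and their tangent cones\<close>

definition semigroup_ring :: "nat set \<Rightarrow> 'k::field fps ring" where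
  "semigroup_ring T =
     \<lparr>carrier = {f. \<forall>s. fps_nth f s \<noteq> 0 \<longrightarrow> s \<in> T},
      mult = (*), one = 1, zero = 0, add = (+)\<rparr>"

definition semigroup_max_ideal :: "nat set \<Rightarrow> 'k::field fps set" where
  "semigroup_max_ideal T = Idl\<^bsub>semigroup_ring T\<^esub> {fps_X ^ s |s. s \<in> T - {0}}"

text \<open>The type argument fixes the coefficient field.\<close>

definition tangent_cone :: "'k::field itself \<Rightarrow> nat set \<Rightarrow> (nat \<Rightarrow> 'k fps set) ring" where
  "tangent_cone _ T = assoc_graded (semigroup_ring T) (semigroup_max_ideal T)"

end

theory Submission
  imports Defs "HOL-Number_Theory.Cong" "HOL-Computational_Algebra.Polynomial"
begin

text \<open>
  For a numerical semigroup $T$ let $e$ be its least positive element. The classes $x_s$ of the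
  monomials $t^s$, $s \in T$, form a $K$-basis of the tangent cone $G(T)$; the element $x_s$ is
  homogeneous of degree $\mathrm{ord}(s)$, and $x_s x_u$ is $x_{s+u}$ if
  $\mathrm{ord}(s+u) = \mathrm{ord}(s) + \mathrm{ord}(u)$ and $0$ otherwise. The theorem rests on
  the criterion \<open>cohen_macaulay_tangent_cone_iff\<close>: $G(T)$ is Cohen-Macaulay if and
  only if $x_e$ is a nonzerodivisor, which says that
  $\mathrm{ord}(s+e) = \mathrm{ord}(s) + 1$ for all $s \in T$ (\<open>ord_shift_additive\<close>).

  The criterion comes from the defect $s - e\,\mathrm{ord}(s) \ge 0$. It is additive on pairs
  $(s,u)$ with $x_s x_u \ne 0$, it is bounded on $T$, and it vanishes exactly on the multiples of
  $e$. Hence the $x_s$ with $e \nmid s$ span a nilpotent ideal $N$, and $G(T)/N$ is the polynomial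
  ring $K[x_e]$. So $N$ is the unique minimal prime, all other primes are maximal, each
  localization at a maximal ideal has dimension $1$, and its depth is $1$ exactly if its
  maximal ideal contains a nonzerodivisor (\<open>one_dimensional_ring.cohen_macaulay_iff\<close>).
  If $x_e$ is a nonzerodivisor, then so is each nonzero polynomial in $x_e$, and each maximal ideal
  contains such a polynomial. Conversely, an element $r$ of the homogeneous maximal ideal is
  $x_e g + \nu$ with $\nu \in N$. If $x_e x_s = 0$, then $r$ kills the last nonzero element among the
  $x_s \nu^k$, so that no such $r$ is a nonzerodivisor.

  For the gluing, each element of $S$ is uniquely $qx + py$ with $x \in S_1$, $y \in S_2$ and
  $y - q \notin S_2$. All other representations arise by trading copies of $p$ in $x$ for copies of
  $q = a n_1$ in $y$. As $G(S_2)$ is Cohen-Macaulay, such a trade raises the order of $y$ by exactly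
  $a$, while it lowers the order of $x$ by at least $\mathrm{ord}(p) \ge a$. Therefore
  $\mathrm{ord}_S(qx + py) = \mathrm{ord}(x) + \mathrm{ord}(y)$ (\<open>ord_S_reduced\<close>).
  The least positive element of $S$ is $q m_1$, and adding it changes $x$ to $x + m_1$ and keeps $y$,
  so the criterion holds for $S$ if and only if it holds for $S_1$.
\<close>

section \<open>The order function of a numerical semigroup\<close>

text \<open>
  The defining equation for \<^term>\<open>fold_sums T (Suc n)\<close> speaks about lists of
  length \<^term>\<open>Suc n\<close>. This recursion, which is valid for \<^term>\<open>n = 0\<close>
  because a submonoid contains \<^term>\<open>0::nat\<close>, replaces it everywhere below.
\<close>

lemma fold_sums_Suc:
  assumes T: "nat_submonoid T"
  shows "fold_sums T (Suc n) = {x + y | x y. x \<in> fold_sums T n \<and> y \<in> T - {0}}"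
proof (cases n)
  case 0
  have "\<exists>xs. x + y = sum_list xs \<and> length xs = Suc 0 \<and> set xs \<subseteq> T - {0}"
    if "x \<in> T" "y \<in> T" "y > 0" for x y
    using that T by (intro exI[of _ "[x + y]"]) (auto simp: nat_submonoid_def)
  moreover have "\<exists>x y. sum_list xs = x + y \<and> x \<in> T \<and> y \<in> T \<and> 0 < y"
    if "length xs = Suc 0" "set xs \<subseteq> T - {0}" for xs
    using that T by (intro exI[of _ "0"] exI[of _ "sum_list xs"])
      (auto simp: nat_submonoid_def length_Suc_conv)
  ultimately show ?thesis
    unfolding 0 by (auto simp: set_eq_iff)
next
  case (Suc l)
  have "\<exists>ys. sum_list xs + y = sum_list ys \<and> length ys = Suc (Suc l) \<and> set ys \<subseteq> T - {0}"
    if "length xs = Suc l" "set xs \<subseteq> T - {0}" "y \<in> T" "y > 0" for xs y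
    using that by (intro exI[of _ "y # xs"]) auto
  moreover have "\<exists>x y. sum_list xs = x + y \<and> (\<exists>ys. x = sum_list ys \<and> length ys = Suc l \<and>
      set ys \<subseteq> T - {0}) \<and> y \<in> T \<and> 0 < y"
    if "length xs = Suc (Suc l)" "set xs \<subseteq> T - {0}" for xs
  proof -
    obtain y ys where xs: "xs = y # ys"
      using \<open>length xs = _\<close> by (cases xs) auto
    show ?thesis
      using that xs by (intro exI[of _ "sum_list ys"] exI[of _ y]) auto
  qed
  ultimately show ?thesis
    unfolding Suc by (fastforce simp: set_eq_iff)
qed

declare fold_sums.simps(2) [simp del]

lemma fold_sums_subset: "nat_submonoid T \<Longrightarrow> fold_sums T n \<subseteq> T"
  by (induction n) (auto simp: fold_sums_Suc nat_submonoid_def)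

lemma fold_sums_Suc_subset:
  assumes "nat_submonoid T"
  shows "fold_sums T (Suc n) \<subseteq> fold_sums T n"
proof (induction n)
  case 0
  show ?case using fold_sums_subset[OF assms, of "Suc 0"] by simp
next
  case (Suc n)
  then show ?case unfolding fold_sums_Suc[OF assms, of "Suc n"] fold_sums_Suc[OF assms, of n]
    by blast
qed

lemma fold_sums_antimono:
  assumes "nat_submonoid T" "n \<le> m"
  shows "fold_sums T m \<subseteq> fold_sums T n"
  using assms(2) fold_sums_Suc_subset[OF assms(1)] by (rule lift_Suc_antimono_le[rotated])

lemma fold_sums_add:
  assumes T: "nat_submonoid T" and "s \<in> fold_sums T n" "t \<in> fold_sums T m"
  shows "s + t \<in> fold_sums T (n + m)"
  using assms(2,3)
proof (induction m arbitrary: t)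
  case 0
  then show ?case
  proof (induction n arbitrary: s)
    case 0
    then show ?case using T by (auto simp: nat_submonoid_def)
  next
    case (Suc n)
    from Suc.prems(1) obtain x y where s: "s = x + y" "x \<in> fold_sums T n" "y \<in> T - {0}"
      unfolding fold_sums_Suc[OF T] by blast
    then have "x + t \<in> fold_sums T (n + 0)" using Suc by blast
    moreover have "s + t = (x + t) + y" using s by simp
    ultimately show ?case using s(3) unfolding add_0_right fold_sums_Suc[OF T] by blast
  qed
next
  case (Suc m)
  from Suc.prems(2) obtain x y where t: "t = x + y" "x \<in> fold_sums T m" "y \<in> T - {0}"
    unfolding fold_sums_Suc[OF T] by blast
  then have "s + x \<in> fold_sums T (n + m)" using Suc by blast
  moreover have "s + t = (s + x) + y" using t by simp
  ultimately show ?case using t(3) unfolding add_Suc_right fold_sums_Suc[OF T] by blast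
qed

lemma fold_sums_lower_bound:
  assumes T: "nat_submonoid T" and e: "\<And>y. y \<in> T - {0} \<Longrightarrow> e \<le> y" and "s \<in> fold_sums T n"
  shows "e * n \<le> s"
  using assms(3)
proof (induction n arbitrary: s)
  case (Suc n)
  then obtain x y where "s = x + y" "x \<in> fold_sums T n" "y \<in> T - {0}"
    unfolding fold_sums_Suc[OF T] by blast
  then show ?case using Suc.IH[of x] e[of y] by simp
qed simp

text \<open>
  The sets \<^term>\<open>fold_sums T n\<close> decrease with \<^term>\<open>n\<close>, and the greatest
  \<^term>\<open>n\<close> in the definition of the order exists because a sum of \<^term>\<open>n\<close>
  positive numbers is at least \<^term>\<open>n\<close>.
\<close>

lemma mem_fold_sums_iff:
  assumes T: "nat_submonoid T" and s: "s \<in> T"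
  shows "s \<in> fold_sums T n \<longleftrightarrow> n \<le> semigroup_ord T s"
proof -
  have bound: "n \<le> s" if "s \<in> fold_sums T n" for n
    using fold_sums_lower_bound[OF T _ that, of 1] by auto
  have "s \<in> fold_sums T (semigroup_ord T s)"
    unfolding semigroup_ord_def
    by (rule GreatestI_nat[where k = 0 and b = s]) (use s bound in auto)
  moreover have "n \<le> semigroup_ord T s" if "s \<in> fold_sums T n"
    unfolding semigroup_ord_def by (rule Greatest_le_nat[where b = s]) (use that bound in auto)
  ultimately show ?thesis
    using fold_sums_antimono[OF T] by blast
qed

lemma semigroup_ord_superadditive:
  assumes T: "nat_submonoid T" and "s \<in> T" "t \<in> T"
  shows "semigroup_ord T s + semigroup_ord T t \<le> semigroup_ord T (s + t)"
proof -
  have "s + t \<in> T" using assms by (auto simp: nat_submonoid_def)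
  then show ?thesis
    using fold_sums_add[OF T, of s "semigroup_ord T s" t "semigroup_ord T t"] assms
    by (simp add: mem_fold_sums_iff)
qed

lemma nat_submonoid_mult:
  assumes "nat_submonoid T" "x \<in> T"
  shows "j * x \<in> T"
  using assms by (induction j) (auto simp: nat_submonoid_def)

lemma semigroup_ord_mult:
  assumes T: "nat_submonoid T" and x: "x \<in> T"
  shows "j * semigroup_ord T x \<le> semigroup_ord T (j * x)"
proof (induction j)
  case (Suc j)
  then show ?case
    using semigroup_ord_superadditive[OF T x nat_submonoid_mult[OF T x, of j]] by simp
qed simp

definition least_pos :: "nat set \<Rightarrow> nat" where
  "least_pos T = (LEAST e. e \<in> T \<and> e \<noteq> 0)"

lemma least_pos_le: "y \<in> T \<Longrightarrow> y \<noteq> 0 \<Longrightarrow> least_pos T \<le> y"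
  unfolding least_pos_def by (rule Least_le) simp

lemma least_pos_mem:
  assumes "numerical_semigroup T"
  shows "least_pos T \<in> T" "least_pos T > 0"
proof -
  have "infinite T"
    using assms by (metis numerical_semigroup_def finite_compl infinite_UNIV_nat)
  then have "\<exists>e. e \<in> T \<and> e \<noteq> 0"
    by (metis finite.simps infinite_imp_nonempty insertI1 rev_finite_subset singleton_iff subsetI)
  then have "least_pos T \<in> T \<and> least_pos T \<noteq> 0"
    unfolding least_pos_def by (rule LeastI_ex)
  then show "least_pos T \<in> T" "least_pos T > 0" by auto
qed

lemma mult_least_pos_ord_le:
  assumes T: "nat_submonoid T" and s: "s \<in> T"
  shows "least_pos T * semigroup_ord T s \<le> s"
  by (rule fold_sums_lower_bound[OF T])
    (use least_pos_le mem_fold_sums_iff[OF T s] in auto)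

lemma semigroup_ord_pos:
  assumes T: "nat_submonoid T" and s: "s \<in> T" "s \<noteq> 0"
  shows "semigroup_ord T s > 0"
proof -
  have "s \<in> fold_sums T (Suc 0)"
    unfolding fold_sums_Suc[OF T] using s T by (force simp: nat_submonoid_def)
  then show ?thesis using mem_fold_sums_iff[OF T s(1)] by auto
qed

lemma semigroup_ord_least_pos:
  assumes T: "numerical_semigroup T"
  shows "semigroup_ord T (least_pos T) = 1"
proof -
  have T': "nat_submonoid T" using T by (simp add: numerical_semigroup_def)
  note e = least_pos_mem[OF T]
  show ?thesis
    using mult_least_pos_ord_le[OF T' e(1)] semigroup_ord_pos[OF T' e(1)] e(2) by auto
qed

text \<open>
  In terms of the tangent cone: multiplication by the class of $t^e$, where $e$ is
  \<^term>\<open>least_pos T\<close>, is injective.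
\<close>

definition ord_shift_additive :: "nat set \<Rightarrow> bool" where
  "ord_shift_additive T \<longleftrightarrow>
     (\<forall>s\<in>T. semigroup_ord T (s + least_pos T) = Suc (semigroup_ord T s))"


section \<open>The order function of a nice gluing\<close>

lemma nat_submonoid_generated: "nat_submonoid (semigroup_generated A)"
  by (rule hull_in) (auto simp: nat_submonoid_def)

lemma nat_submonoid_scaled_sum:
  assumes "nat_submonoid A" "nat_submonoid B"
  shows "nat_submonoid {q * x + p * y | x y. x \<in> A \<and> y \<in> B}" (is "nat_submonoid ?S")
  unfolding nat_submonoid_def
proof (intro conjI ballI)
  show "0 \<in> ?S"
    using assms by (auto simp: nat_submonoid_def intro!: exI[of _ 0])
next
  fix s t assume "s \<in> ?S" "t \<in> ?S"
  then obtain x y x' y' where "s = q * x + p * y" "t = q * x' + p * y'"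
    "x \<in> A" "y \<in> B" "x' \<in> A" "y' \<in> B" by blast
  then have "s + t = q * (x + x') + p * (y + y')" "x + x' \<in> A" "y + y' \<in> B"
    using assms by (auto simp: nat_submonoid_def algebra_simps)
  then show "s + t \<in> ?S" by blast
qed

lemma semigroup_generated_gluing:
  "semigroup_generated ((\<lambda>i. q * m i) ` I \<union> (\<lambda>j. p * n j) ` J) =
     {q * x + p * y | x y. x \<in> semigroup_generated (m ` I) \<and> y \<in> semigroup_generated (n ` J)}"
  (is "?L = ?R")
proof
  have 0: "0 \<in> semigroup_generated (m ` I)" "0 \<in> semigroup_generated (n ` J)"
    using nat_submonoid_generated by (auto simp: nat_submonoid_def)
  show "?L \<subseteq> ?R"
  proof (rule hull_minimal)
    have "q * m i \<in> ?R" if "i \<in> I" for i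
      using 0 that by (intro CollectI exI[of _ "m i"] exI[of _ 0]) (auto intro: hull_inc)
    moreover have "p * n j \<in> ?R" if "j \<in> J" for j
      using 0 that by (intro CollectI exI[of _ "n j"] exI[of _ 0]) (auto intro: hull_inc)
    ultimately show "(\<lambda>i. q * m i) ` I \<union> (\<lambda>j. p * n j) ` J \<subseteq> ?R" by blast
    show "nat_submonoid ?R"
      by (intro nat_submonoid_scaled_sum nat_submonoid_generated)
  qed
next
  have L: "nat_submonoid ?L" by (rule nat_submonoid_generated)
  have 1: "q * x \<in> ?L" if "x \<in> semigroup_generated (m ` I)" for x
    using that
  proof (rule hull_induct)
    show "q * x \<in> ?L" if "x \<in> m ` I" for x using that by (auto intro: hull_inc)
    show "nat_submonoid {x. q * x \<in> ?L}"
      using L by (auto simp: nat_submonoid_def algebra_simps)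
  qed
  have 2: "p * x \<in> ?L" if "x \<in> semigroup_generated (n ` J)" for x
    using that
  proof (rule hull_induct)
    show "p * x \<in> ?L" if "x \<in> n ` J" for x using that by (auto intro: hull_inc)
    show "nat_submonoid {x. p * x \<in> ?L}"
      using L by (auto simp: nat_submonoid_def algebra_simps)
  qed
  show "?R \<subseteq> ?L" using L 1 2 by (auto simp: nat_submonoid_def)
qed

text \<open>
  Minimality of the generating set is what excludes that the first generator is \<open>0\<close>.
\<close>

lemma least_pos_generated:
  assumes T: "numerical_semigroup T" and m: "minimally_generated T m d"
  shows "m 1 = least_pos T"
proof -
  have hull: "semigroup_generated (m ` {1..d}) = T" and sm: "strict_mono_on {1..d} m"
    and min: "\<And>B. B \<subset> m ` {1..d} \<Longrightarrow> semigroup_generated B \<noteq> T"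
    using m by (auto simp: minimally_generated_def)
  have "d \<noteq> 0"
  proof
    assume "d = 0"
    then have "T = semigroup_generated {}" using hull by simp
    also have "\<dots> \<subseteq> {0}" by (rule hull_minimal) (auto simp: nat_submonoid_def)
    finally show False using least_pos_mem[OF T] by auto
  qed
  then have 1: "1 \<in> {1..d}" by simp
  have "m 1 \<noteq> 0"
  proof
    assume 0: "m 1 = 0"
    let ?B = "m ` {1..d} - {0}"
    have "0 \<in> semigroup_generated ?B"
      using nat_submonoid_generated[of ?B] by (simp add: nat_submonoid_def)
    then have "m ` {1..d} \<subseteq> semigroup_generated ?B"
      by (metis DiffI hull_inc singletonD subsetI)
    then have "T \<subseteq> semigroup_generated ?B"
      using hull_minimal[of _ _ nat_submonoid] nat_submonoid_generated hull by blast
    moreover have "semigroup_generated ?B \<subseteq> T"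
      unfolding hull[symmetric] by (rule hull_mono) auto
    moreover have "?B \<subset> m ` {1..d}" using 0 1 by (metis DiffE Diff_subset image_eqI psubsetI singletonI)
    ultimately show False using min by blast
  qed
  moreover have "m 1 \<in> T" unfolding hull[symmetric] using 1 by (auto intro: hull_inc)
  moreover have "y = 0 \<or> m 1 \<le> y" if "y \<in> T" for y
  proof -
    have "y \<in> semigroup_generated (m ` {1..d})" using that hull by simp
    then show ?thesis
    proof (rule hull_induct)
      show "nat_submonoid {y. y = 0 \<or> m 1 \<le> y}" by (auto simp: nat_submonoid_def)
      show "y = 0 \<or> m 1 \<le> y" if "y \<in> m ` {1..d}" for y
        using that strict_mono_onD[OF sm 1] by (force simp: le_less)
    qed
  qed
  ultimately show ?thesis
    using least_pos_mem[OF T] by (metis least_pos_le le_antisym less_numeral_extra(3))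
qed

text \<open>
  A nice gluing of \<^term>\<open>S1\<close> with a semigroup \<^term>\<open>S2\<close> that satisfies the
  criterion, expressed by the semigroups in place of their generators. The glued semigroup is then
  the set of all \<^term>\<open>q * x + p * y\<close>.
\<close>

locale nice_gluing_data =
  fixes S1 S2 :: "nat set" and p q a :: nat
  assumes S1: "numerical_semigroup S1" and S2: "numerical_semigroup S2"
    and p: "p \<in> S1" "0 < p" and coprime: "coprime p q"
    and q: "q = a * least_pos S2" "0 < q" and a: "1 < a" "a \<le> semigroup_ord S1 p"
    and S2_shift: "ord_shift_additive S2"
begin

definition S :: "nat set" where
  "S = {q * x + p * y | x y. x \<in> S1 \<and> y \<in> S2}"

lemma M1: "nat_submonoid S1" and M2: "nat_submonoid S2"
  using S1 S2 by (auto simp: numerical_semigroup_def)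

lemma M: "nat_submonoid S"
  unfolding S_def by (rule nat_submonoid_scaled_sum[OF M1 M2])

lemma S_numerical: "numerical_semigroup S"
proof -
  have "\<exists>c. \<forall>s\<ge>c. s \<in> T" if "numerical_semigroup T" for T
  proof -
    have "finite (- T)" using that by (simp add: numerical_semigroup_def)
    then obtain c where "\<forall>s\<in>-T. s < c" using finite_nat_set_iff_bounded by blast
    then show ?thesis by (intro exI[of _ c]) (auto simp: not_less[symmetric])
  qed
  then obtain c1 c2 where c: "\<And>s. s \<ge> c1 \<Longrightarrow> s \<in> S1" "\<And>s. s \<ge> c2 \<Longrightarrow> s \<in> S2"
    using S1 S2 by metis
  \<comment> \<open>Solve \<open>p * y = s\<close> modulo \<open>q\<close> with \<open>y\<close> beyond the conductor of \<open>S2\<close>; the bound on \<open>s\<close> pushes the quotient \<open>x\<close> beyond that of \<open>S1\<close>.\<close>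
  have "s \<in> S" if s: "s \<ge> p * (q * (c2 + 1)) + p * q + q * c1" for s
  proof -
    obtain b where b: "[p * b = 1] (mod q)"
      using cong_solve_coprime_nat[OF coprime] by auto
    define y where "y = q * c2 + (b * s) mod q"
    have "[p * y = p * (b * s)] (mod q)"
      unfolding y_def by (intro cong_mult cong_refl) (simp add: cong_def)
    also have "p * (b * s) = (p * b) * s" by simp
    also have "[\<dots> = 1 * s] (mod q)" by (intro cong_mult b cong_refl)
    finally have cong: "[p * y = s] (mod q)" by simp
    have ylt: "y < q * (c2 + 1)" unfolding y_def using q by simp
    then have "p * y \<le> p * (q * (c2 + 1))" by simp
    then have le: "p * y + q * c1 \<le> s" using s by linarith
    then have "q dvd s - p * y" using cong by (meson add_leD1 cong_altdef_nat cong_sym)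
    then obtain x where x: "s - p * y = q * x" by blast
    with le have "q * c1 \<le> q * x" by linarith
    then have "c1 \<le> x" using q by simp
    moreover have "y \<ge> c2"
      unfolding y_def using q(2) by (cases q) auto
    moreover have "s = q * x + p * y" using x le by simp
    ultimately show "s \<in> S" unfolding S_def using c by blast
  qed
  then have "- S \<subseteq> {..< p * (q * (c2 + 1)) + p * q + q * c1}" by (auto simp: not_less[symmetric])
  then show ?thesis using M finite_subset unfolding numerical_semigroup_def by blast
qed

lemma q_mem: "q \<in> S2"
  unfolding q by (rule nat_submonoid_mult[OF M2 least_pos_mem(1)[OF S2]])

lemma ord_add_mult_q:
  assumes "y \<in> S2"
  shows "semigroup_ord S2 (y + k * q) = semigroup_ord S2 y + k * a"
proof -
  have "semigroup_ord S2 (y + j * least_pos S2) = semigroup_ord S2 y + j" for j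
  proof (induction j)
    case (Suc j)
    have "y + j * least_pos S2 \<in> S2"
      using M2 assms nat_submonoid_mult[OF M2 least_pos_mem(1)[OF S2]]
      by (auto simp: nat_submonoid_def)
    then have "semigroup_ord S2 (y + j * least_pos S2 + least_pos S2)
        = Suc (semigroup_ord S2 (y + j * least_pos S2))"
      using S2_shift unfolding ord_shift_additive_def by blast
    then show ?case using Suc by (simp add: algebra_simps)
  qed simp
  from this[of "k * a"] show ?thesis unfolding q by (simp add: algebra_simps)
qed

text \<open>
  The Apery set of \<^term>\<open>S2\<close> with respect to \<^term>\<open>q\<close>. Subtraction of natural
  numbers truncates, hence the existential form.
\<close>

definition reduced :: "nat \<Rightarrow> bool" where
  "reduced y \<longleftrightarrow> y \<in> S2 \<and> \<not> (\<exists>z\<in>S2. y = z + q)"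

lemma reduced_0: "reduced 0"
  unfolding reduced_def using M2 q(2) unfolding nat_submonoid_def by auto

lemma fold_sums_S_split:
  assumes "s \<in> fold_sums S n"
  shows "\<exists>x\<in>S1. \<exists>y\<in>S2. s = q * x + p * y \<and> n \<le> semigroup_ord S1 x + semigroup_ord S2 y"
  using assms
proof (induction n arbitrary: s)
  case 0
  then show ?case by (auto simp: S_def)
next
  case (Suc n)
  then obtain s' t where st: "s = s' + t" "s' \<in> fold_sums S n" "t \<in> S" "t \<noteq> 0"
    unfolding fold_sums_Suc[OF M] by blast
  obtain x y where xy: "x \<in> S1" "y \<in> S2" "s' = q * x + p * y"
    "n \<le> semigroup_ord S1 x + semigroup_ord S2 y"
    using Suc.IH[OF st(2)] by blast
  obtain x' y' where xy': "x' \<in> S1" "y' \<in> S2" "t = q * x' + p * y'"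
    using st unfolding S_def by blast
  have "1 \<le> semigroup_ord S1 x' + semigroup_ord S2 y'"
    using xy' st(4) semigroup_ord_pos[OF M1 xy'(1)] semigroup_ord_pos[OF M2 xy'(2)]
    by (cases "x' = 0"; cases "y' = 0") auto
  then have "Suc n \<le> semigroup_ord S1 (x + x') + semigroup_ord S2 (y + y')"
    using xy(4) semigroup_ord_superadditive[OF M1 xy(1) xy'(1)]
      semigroup_ord_superadditive[OF M2 xy(2) xy'(2)] by linarith
  moreover have "x + x' \<in> S1" "y + y' \<in> S2" "s = q * (x + x') + p * (y + y')"
    using M1 M2 xy xy' st by (auto simp: nat_submonoid_def algebra_simps)
  ultimately show ?case by blast
qed

lemma fold_sums_scaled:
  assumes "x \<in> fold_sums A n" "nat_submonoid A" "\<And>x. x \<in> A \<Longrightarrow> r * x \<in> S" "0 < r"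
  shows "r * x \<in> fold_sums S n"
  using assms(1)
proof (induction n arbitrary: x)
  case 0
  then show ?case using assms by simp
next
  case (Suc n)
  then obtain s t where st: "x = s + t" "s \<in> fold_sums A n" "t \<in> A - {0}"
    unfolding fold_sums_Suc[OF assms(2)] by blast
  then have "r * x = r * s + r * t" "r * s \<in> fold_sums S n" "r * t \<in> S - {0}"
    using assms(3,4) Suc.IH by (simp_all add: distrib_left)
  then show ?case unfolding fold_sums_Suc[OF M] by blast
qed

lemma ord_S_ge:
  assumes "x \<in> S1" "y \<in> S2"
  shows "semigroup_ord S1 x + semigroup_ord S2 y \<le> semigroup_ord S (q * x + p * y)"
proof -
  have 1: "q * z \<in> S" if "z \<in> S1" for z
    using that M2 unfolding S_def nat_submonoid_def by force
  have 2: "p * z \<in> S" if "z \<in> S2" for z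
    using that M1 unfolding S_def nat_submonoid_def by force
  have "q * x \<in> fold_sums S (semigroup_ord S1 x)"
    by (rule fold_sums_scaled[OF _ M1 1]) (use mem_fold_sums_iff[OF M1 assms(1)] q in auto)
  moreover have "p * y \<in> fold_sums S (semigroup_ord S2 y)"
    by (rule fold_sums_scaled[OF _ M2 2]) (use mem_fold_sums_iff[OF M2 assms(2)] p in auto)
  ultimately have "q * x + p * y \<in> fold_sums S (semigroup_ord S1 x + semigroup_ord S2 y)"
    by (rule fold_sums_add[OF M])
  moreover have "q * x + p * y \<in> S" using assms by (auto simp: S_def)
  ultimately show ?thesis using mem_fold_sums_iff[OF M] by blast
qed

text \<open>
  Two representations of the same element have second components that are congruent modulo
  \<^term>\<open>q\<close>. A reduced one is the least of its class in \<^term>\<open>S2\<close>, so each other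
  representation is reached from the reduced one by \<^term>\<open>k\<close> trades of \<^term>\<open>p\<close>
  for \<^term>\<open>q\<close>.
\<close>

lemma reduced_representation:
  assumes x: "x \<in> S1" and y: "reduced y" and x': "x' \<in> S1" and y': "y' \<in> S2"
    and eq: "q * x + p * y = q * x' + p * y'"
  obtains k where "y' = y + k * q" "x = x' + k * p"
proof -
  have "[p * y = p * y'] (mod q)"
    using arg_cong[OF eq, of "\<lambda>z. z mod q"] by (simp add: cong_def)
  then have cong: "[y = y'] (mod q)"
    using coprime by (simp add: cong_mult_lcancel_nat coprime_commute)
  have "y \<le> y'"
  proof (rule ccontr)
    assume lt: "\<not> y \<le> y'"
    then obtain k where k: "y = y' + q * k"
      using cong_le_nat[of y' y q] cong by (auto simp: cong_sym_eq mult.commute)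
    then obtain l where "k = Suc l" using lt by (cases k) auto
    then have "y = (y' + l * q) + q" using k by (simp add: algebra_simps)
    moreover have "y' + l * q \<in> S2"
      using y' nat_submonoid_mult[OF M2 q_mem] M2 by (auto simp: nat_submonoid_def)
    ultimately show False using y unfolding reduced_def by blast
  qed
  then have "\<exists>k. y' = y + k * q"
    using cong_le_nat[of y y' q] cong by (auto simp: cong_sym_eq add.commute)
  then obtain k where k: "y' = y + k * q" by blast
  then have "q * x = q * (x' + k * p)" using eq by (simp add: algebra_simps)
  then have "x = x' + k * p" using q by simp
  with k show thesis by (rule that)
qed

text \<open>
  The order of an element of \<^term>\<open>S\<close> is the maximum, over all its representations, of the
  sum of the two orders. Each trade of \<^term>\<open>p\<close> for \<^term>\<open>q\<close> costs at least
  \<^term>\<open>semigroup_ord S1 p\<close> and gains exactly \<^term>\<open>a\<close>, so the inequality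
  \<^term>\<open>a \<le> semigroup_ord S1 p\<close> puts the maximum at the reduced representation.
\<close>

lemma ord_S_reduced:
  assumes x: "x \<in> S1" and y: "reduced y"
  shows "semigroup_ord S (q * x + p * y) = semigroup_ord S1 x + semigroup_ord S2 y"
proof (rule antisym)
  have y2: "y \<in> S2" using y by (simp add: reduced_def)
  let ?s = "q * x + p * y"
  have "?s \<in> S" using x y2 by (auto simp: S_def)
  then have "?s \<in> fold_sums S (semigroup_ord S ?s)" using mem_fold_sums_iff[OF M] by blast
  then obtain x' y' where x': "x' \<in> S1" and y': "y' \<in> S2" and eq: "?s = q * x' + p * y'"
    and le: "semigroup_ord S ?s \<le> semigroup_ord S1 x' + semigroup_ord S2 y'"
    using fold_sums_S_split by blast
  obtain k where k: "y' = y + k * q" "x = x' + k * p"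
    using reduced_representation[OF x y x' y' eq] .
  have "k * a \<le> k * semigroup_ord S1 p" using a by simp
  also have "\<dots> \<le> semigroup_ord S1 (k * p)" by (rule semigroup_ord_mult[OF M1 p(1)])
  finally have "semigroup_ord S1 x' + k * a \<le> semigroup_ord S1 x"
    using semigroup_ord_superadditive[OF M1 x' nat_submonoid_mult[OF M1 p(1)], of k] k by simp
  then show "semigroup_ord S ?s \<le> semigroup_ord S1 x + semigroup_ord S2 y"
    using le ord_add_mult_q[OF y2, of k] k by simp
  show "semigroup_ord S1 x + semigroup_ord S2 y \<le> semigroup_ord S ?s"
    by (rule ord_S_ge[OF x y2])
qed

lemma reduced_representation_exists:
  assumes "s \<in> S"
  obtains x y where "x \<in> S1" "reduced y" "s = q * x + p * y"
proof -
  have "\<exists>x' z. x' \<in> S1 \<and> reduced z \<and> q * x + p * y = q * x' + p * z"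
    if "x \<in> S1" "y \<in> S2" for x y
    using that
  proof (induction y arbitrary: x rule: less_induct)
    case (less y)
    show ?case
    proof (cases "reduced y")
      case True
      then show ?thesis using less by blast
    next
      case False
      then obtain z where z: "z \<in> S2" "y = z + q" using less unfolding reduced_def by blast
      have "x + p \<in> S1" using less p M1 by (auto simp: nat_submonoid_def)
      moreover have "z < y" using z q by simp
      ultimately obtain x' w where "x' \<in> S1" "reduced w" "q * (x + p) + p * z = q * x' + p * w"
        using less.IH[of z "x + p"] z by blast
      moreover have "q * x + p * y = q * (x + p) + p * z" using z by (simp add: algebra_simps)
      ultimately show ?thesis by auto
    qed
  qed
  then show thesis using assms that unfolding S_def by blast
qed

text \<open>
  The competitor is \<^term>\<open>p * least_pos S2\<close>, and
  \<^term>\<open>p \<ge> a * least_pos S1\<close> since \<^term>\<open>p\<close> has order at least \<^term>\<open>a\<close>.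
\<close>

lemma least_pos_S: "least_pos S = q * least_pos S1"
proof -
  note e1 = least_pos_mem[OF S1] and e2 = least_pos_mem[OF S2]
  have "q * least_pos S1 + p * 0 \<in> S" unfolding S_def using e1 M2 unfolding nat_submonoid_def by blast
  then have mem: "q * least_pos S1 \<in> S" by simp
  have "q * least_pos S1 \<le> s" if "s \<in> S" "s \<noteq> 0" for s
  proof -
    obtain x y where xy: "s = q * x + p * y" "x \<in> S1" "y \<in> S2" using \<open>s \<in> S\<close> unfolding S_def by blast
    show ?thesis
    proof (cases "x = 0")
      case False
      then have "q * least_pos S1 \<le> q * x"
        using least_pos_le[OF xy(2)] by (intro mult_le_mono2)
      then show ?thesis unfolding xy(1) by (rule trans_le_add1)
    next
      case True
      then have "y \<noteq> 0" using xy that by auto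
      then have y: "least_pos S2 \<le> y" using least_pos_le[OF xy(3)] by simp
      have "least_pos S1 * a \<le> least_pos S1 * semigroup_ord S1 p" using a by simp
      also have "\<dots> \<le> p" by (rule mult_least_pos_ord_le[OF M1 p(1)])
      finally have "(least_pos S1 * a) * least_pos S2 \<le> p * y" using y by (rule mult_le_mono)
      then show ?thesis using xy True q by (simp add: algebra_simps)
    qed
  qed
  moreover have "q * least_pos S1 \<noteq> 0" using q e1 by simp
  ultimately show ?thesis
    using mem least_pos_mem[OF S_numerical] least_pos_le[OF mem] by (simp add: le_antisym)
qed

theorem ord_shift_additive_gluing_iff: "ord_shift_additive S \<longleftrightarrow> ord_shift_additive S1"
proof -
  have shift: "semigroup_ord S (q * x + p * y + least_pos S) =
      semigroup_ord S1 (x + least_pos S1) + semigroup_ord S2 y" if "x \<in> S1" "reduced y" for x y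
  proof -
    have "x + least_pos S1 \<in> S1"
      using that M1 least_pos_mem(1)[OF S1] by (auto simp: nat_submonoid_def)
    from ord_S_reduced[OF this that(2)] show ?thesis
      unfolding least_pos_S by (simp add: algebra_simps)
  qed
  show ?thesis
  proof
    assume A: "ord_shift_additive S"
    show "ord_shift_additive S1"
      unfolding ord_shift_additive_def
    proof
      fix x assume x: "x \<in> S1"
      have "q * x + p * 0 \<in> S" unfolding S_def using x reduced_0 unfolding reduced_def by blast
      then have "semigroup_ord S (q * x + p * 0 + least_pos S) = Suc (semigroup_ord S (q * x + p * 0))"
        using A unfolding ord_shift_additive_def by blast
      then show "semigroup_ord S1 (x + least_pos S1) = Suc (semigroup_ord S1 x)"
        unfolding shift[OF x reduced_0] ord_S_reduced[OF x reduced_0] by simp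
    qed
  next
    assume A: "ord_shift_additive S1"
    show "ord_shift_additive S"
      unfolding ord_shift_additive_def
    proof
      fix s assume "s \<in> S"
      then obtain x y where "x \<in> S1" "reduced y" "s = q * x + p * y"
        by (rule reduced_representation_exists)
      then show "semigroup_ord S (s + least_pos S) = Suc (semigroup_ord S s)"
        using A shift ord_S_reduced unfolding ord_shift_additive_def by simp
    qed
  qed
qed

end

theorem nice_gluing_ord_shift_additive:
  assumes "numerical_semigroup S1" "numerical_semigroup S2"
    and "minimally_generated S1 m d" "minimally_generated S2 n k"
    and "nice_gluing m d n k p q S" and "ord_shift_additive S2"
  shows "numerical_semigroup S" "ord_shift_additive S \<longleftrightarrow> ord_shift_additive S1"
proof -
  have h: "semigroup_generated (m ` {1..d}) = S1" "semigroup_generated (n ` {1..k}) = S2"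
    using assms(3,4) by (auto simp: minimally_generated_def)
  obtain a where a: "q = a * n 1" "1 < a" "a \<le> semigroup_ord S1 p"
    using assms(5) unfolding nice_gluing_def h by blast
  have g: "0 < p" "0 < q" "p \<in> S1" "gcd p q = 1"
    "S = {q * x + p * y | x y. x \<in> S1 \<and> y \<in> S2}"
    using assms(5) unfolding nice_gluing_def gluing_def semigroup_generated_gluing h by auto
  interpret nice_gluing_data S1 S2 p q a
    by unfold_locales
      (use assms a g least_pos_generated[OF assms(2,4)] in \<open>auto simp: coprime_iff_gcd_eq_1\<close>)
  have "S = nice_gluing_data.S S1 S2 p q" using g S_def by simp
  then show "numerical_semigroup S" "ord_shift_additive S \<longleftrightarrow> ord_shift_additive S1"
    using S_numerical ord_shift_additive_gluing_iff by auto
qed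


section \<open>Rings of fractions\<close>

lemma (in cring) ideal_cringI:
  assumes "I \<subseteq> carrier R" "\<zero> \<in> I"
    and "\<And>a b. a \<in> I \<Longrightarrow> b \<in> I \<Longrightarrow> a \<oplus> b \<in> I"
    and "\<And>x a. x \<in> carrier R \<Longrightarrow> a \<in> I \<Longrightarrow> x \<otimes> a \<in> I"
  shows "ideal I R"
proof (rule idealI[OF ring_axioms])
  show "subgroup I (add_monoid R)"
  proof (rule add.subgroupI)
    fix a assume "a \<in> I"
    then have "(\<ominus> \<one>) \<otimes> a \<in> I" "a \<in> carrier R" using assms by auto
    then show "\<ominus> a \<in> I" by (simp add: l_minus)
  qed (use assms in auto)
  show "x \<otimes> a \<in> I" "a \<otimes> x \<in> I" if "a \<in> I" "x \<in> carrier R" for a x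
    using assms that m_comm[of a x] by auto
qed

locale multiplicative_subset = cring R for R (structure) +
  fixes U :: "'a set"
  assumes U_carrier: "U \<subseteq> carrier R" and U_one: "\<one> \<in> U"
    and U_mult: "s \<in> U \<Longrightarrow> t \<in> U \<Longrightarrow> s \<otimes> t \<in> U"
begin

abbreviation L where "L \<equiv> ring_of_fractions R U"

abbreviation fr where "fr \<equiv> frac R U"

lemma U_closed [simp]: "s \<in> U \<Longrightarrow> s \<in> carrier R"
  using U_carrier by blast

lemma equiv_frac_rel: "equiv (carrier R \<times> U) (frac_rel R U)"
proof (rule equivI)
  show "frac_rel R U \<subseteq> (carrier R \<times> U) \<times> (carrier R \<times> U)"
    by (auto simp: frac_rel_def)
  show "refl_on (carrier R \<times> U) (frac_rel R U)"
    using U_one by (auto simp: refl_on_def frac_rel_def)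
  show "sym (frac_rel R U)"
    by (auto simp: sym_def frac_rel_def) metis
  show "trans (frac_rel R U)"
  proof (rule transI)
    fix x y z assume xy: "(x, y) \<in> frac_rel R U" and yz: "(y, z) \<in> frac_rel R U"
    obtain r s r' s' r'' s'' where eqs: "x = (r, s)" "y = (r', s')" "z = (r'', s'')"
      by (cases x, cases y, cases z) auto
    obtain t t' where c: "r \<in> carrier R" "r' \<in> carrier R" "r'' \<in> carrier R" "s \<in> U" "s' \<in> U" "s'' \<in> U"
      and t: "t \<in> U" "t \<otimes> (r \<otimes> s') = t \<otimes> (r' \<otimes> s)"
      and t': "t' \<in> U" "t' \<otimes> (r' \<otimes> s'') = t' \<otimes> (r'' \<otimes> s')"
      using xy yz unfolding eqs frac_rel_def by blast
    have "(t \<otimes> t' \<otimes> s') \<otimes> (r \<otimes> s'') = (t' \<otimes> s'') \<otimes> (t \<otimes> (r \<otimes> s'))"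
      using c t(1) t'(1) by (simp add: m_ac)
    also have "\<dots> = (t \<otimes> s) \<otimes> (t' \<otimes> (r' \<otimes> s''))"
      unfolding t(2) using c t(1) t'(1) by (simp add: m_ac)
    also have "\<dots> = (t \<otimes> t' \<otimes> s') \<otimes> (r'' \<otimes> s)"
      unfolding t'(2) using c t(1) t'(1) by (simp add: m_ac)
    finally show "(x, z) \<in> frac_rel R U"
      unfolding eqs frac_rel_def using c t(1) t'(1) U_mult by blast
  qed
qed

lemma frac_eq_iff:
  assumes "r \<in> carrier R" "s \<in> U" "r' \<in> carrier R" "s' \<in> U"
  shows "fr r s = fr r' s' \<longleftrightarrow> (\<exists>t\<in>U. t \<otimes> (r \<otimes> s') = t \<otimes> (r' \<otimes> s))"
proof -
  have "fr r s = fr r' s' \<longleftrightarrow> ((r, s), (r', s')) \<in> frac_rel R U"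
    unfolding frac_def by (rule eq_equiv_class_iff[OF equiv_frac_rel]) (use assms in auto)
  then show ?thesis using assms by (auto simp: frac_rel_def)
qed

lemma frac_eqI:
  assumes "r \<in> carrier R" "s \<in> U" "r' \<in> carrier R" "s' \<in> U" "r \<otimes> s' = r' \<otimes> s"
  shows "fr r s = fr r' s'"
  using assms U_one by (auto simp: frac_eq_iff)

lemma mem_frac_iff:
  assumes "r \<in> carrier R" "s \<in> U"
  shows "(r', s') \<in> fr r s \<longleftrightarrow> r' \<in> carrier R \<and> s' \<in> U \<and> fr r' s' = fr r s"
proof
  assume "(r', s') \<in> fr r s"
  then have rel: "((r, s), (r', s')) \<in> frac_rel R U" by (simp add: frac_def)
  then have "fr r s = fr r' s'"
    unfolding frac_def by (rule equiv_class_eq[OF equiv_frac_rel])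
  then show "r' \<in> carrier R \<and> s' \<in> U \<and> fr r' s' = fr r s"
    using rel by (auto simp: frac_rel_def)
next
  assume a: "r' \<in> carrier R \<and> s' \<in> U \<and> fr r' s' = fr r s"
  then have "(r', s') \<in> fr r' s'"
    unfolding frac_def using equiv_class_self[OF equiv_frac_rel] by blast
  then show "(r', s') \<in> fr r s" using a by simp
qed

lemma carrier_L: "carrier L = {fr r s | r s. r \<in> carrier R \<and> s \<in> U}"
  unfolding ring_of_fractions_def quotient_def frac_def by auto

lemma frac_closed [simp]: "r \<in> carrier R \<Longrightarrow> s \<in> U \<Longrightarrow> fr r s \<in> carrier L"
  unfolding carrier_L by blast

lemma carrier_LE:
  assumes "x \<in> carrier L"
  obtains r s where "r \<in> carrier R" "s \<in> U" "x = fr r s"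
  using assms unfolding carrier_L by blast

text \<open>
  The operations of \<^const>\<open>ring_of_fractions\<close> take the union over all pairs of
  representatives; they are well defined as soon as all members of the union agree.
\<close>

lemma UN_frac_pairs:
  assumes "r \<in> carrier R" "s \<in> U" "r' \<in> carrier R" "s' \<in> U"
    and "\<And>r1 s1 r1' s1'. \<lbrakk>r1 \<in> carrier R; s1 \<in> U; fr r1 s1 = fr r s;
      r1' \<in> carrier R; s1' \<in> U; fr r1' s1' = fr r' s'\<rbrakk> \<Longrightarrow> f r1 s1 r1' s1' = c"
  shows "(\<Union>(r1, s1)\<in>fr r s. \<Union>(r1', s1')\<in>fr r' s'. f r1 s1 r1' s1') = c"
proof -
  have "(r, s) \<in> fr r s" "(r', s') \<in> fr r' s'"
    using assms mem_frac_iff by auto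
  moreover have "f r1 s1 r1' s1' = c" if "(r1, s1) \<in> fr r s" "(r1', s1') \<in> fr r' s'" for r1 s1 r1' s1'
    using that assms mem_frac_iff by auto
  ultimately show ?thesis by blast
qed

lemma frac_mult:
  assumes c: "r \<in> carrier R" "s \<in> U" "r' \<in> carrier R" "s' \<in> U"
  shows "fr r s \<otimes>\<^bsub>L\<^esub> fr r' s' = fr (r \<otimes> r') (s \<otimes> s')"
proof -
  have "fr (r1 \<otimes> r1') (s1 \<otimes> s1') = fr (r \<otimes> r') (s \<otimes> s')"
    if c1: "r1 \<in> carrier R" "s1 \<in> U" "r1' \<in> carrier R" "s1' \<in> U"
      and eq: "fr r1 s1 = fr r s" "fr r1' s1' = fr r' s'" for r1 s1 r1' s1'
  proof -
    obtain t where t: "t \<in> U" "t \<otimes> (r1 \<otimes> s) = t \<otimes> (r \<otimes> s1)"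
      using eq(1) c1 c frac_eq_iff by auto
    obtain t' where t': "t' \<in> U" "t' \<otimes> (r1' \<otimes> s') = t' \<otimes> (r' \<otimes> s1')"
      using eq(2) c1 c frac_eq_iff by auto
    have "(t \<otimes> t') \<otimes> ((r1 \<otimes> r1') \<otimes> (s \<otimes> s')) = (t \<otimes> (r1 \<otimes> s)) \<otimes> (t' \<otimes> (r1' \<otimes> s'))"
      using c c1 t(1) t'(1) by (simp add: m_ac)
    also have "\<dots> = (t \<otimes> t') \<otimes> ((r \<otimes> r') \<otimes> (s1 \<otimes> s1'))"
      unfolding t(2) t'(2) using c c1 t(1) t'(1) by (simp add: m_ac)
    finally show ?thesis
      using c c1 t(1) t'(1) U_mult by (subst frac_eq_iff) blast+
  qed
  then show ?thesis
    unfolding ring_of_fractions_def by (simp add: UN_frac_pairs[OF c])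
qed

lemma frac_add:
  assumes c: "r \<in> carrier R" "s \<in> U" "r' \<in> carrier R" "s' \<in> U"
  shows "fr r s \<oplus>\<^bsub>L\<^esub> fr r' s' = fr (r \<otimes> s' \<oplus> r' \<otimes> s) (s \<otimes> s')"
proof -
  have "fr (r1 \<otimes> s1' \<oplus> r1' \<otimes> s1) (s1 \<otimes> s1') = fr (r \<otimes> s' \<oplus> r' \<otimes> s) (s \<otimes> s')"
    if c1: "r1 \<in> carrier R" "s1 \<in> U" "r1' \<in> carrier R" "s1' \<in> U"
      and eq: "fr r1 s1 = fr r s" "fr r1' s1' = fr r' s'" for r1 s1 r1' s1'
  proof -
    obtain t where t: "t \<in> U" "t \<otimes> (r1 \<otimes> s) = t \<otimes> (r \<otimes> s1)"
      using eq(1) c1 c frac_eq_iff by auto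
    obtain t' where t': "t' \<in> U" "t' \<otimes> (r1' \<otimes> s') = t' \<otimes> (r' \<otimes> s1')"
      using eq(2) c1 c frac_eq_iff by auto
    have "(t \<otimes> t') \<otimes> ((r1 \<otimes> s1' \<oplus> r1' \<otimes> s1) \<otimes> (s \<otimes> s'))
        = (t' \<otimes> s1' \<otimes> s') \<otimes> (t \<otimes> (r1 \<otimes> s)) \<oplus> (t \<otimes> s1 \<otimes> s) \<otimes> (t' \<otimes> (r1' \<otimes> s'))"
      using c c1 t(1) t'(1) by (simp add: m_ac l_distr r_distr)
    also have "\<dots> = (t \<otimes> t') \<otimes> ((r \<otimes> s' \<oplus> r' \<otimes> s) \<otimes> (s1 \<otimes> s1'))"
      unfolding t(2) t'(2) using c c1 t(1) t'(1) by (simp add: m_ac l_distr r_distr)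
    finally show ?thesis
      using c c1 t(1) t'(1) U_mult by (subst frac_eq_iff) (blast intro: m_closed a_closed U_closed)+
  qed
  then show ?thesis
    unfolding ring_of_fractions_def by (simp add: UN_frac_pairs[OF c])
qed

lemma one_L: "\<one>\<^bsub>L\<^esub> = fr \<one> \<one>" and zero_L: "\<zero>\<^bsub>L\<^esub> = fr \<zero> \<one>"
  by (auto simp: ring_of_fractions_def)

lemma cring_L: "cring L"
proof (rule cringI)
  note simps = frac_mult frac_add one_L zero_L U_mult U_one m_ac l_distr r_distr a_ac
  show "abelian_group L"
  proof (rule abelian_groupI)
    fix x y assume "x \<in> carrier L" "y \<in> carrier L"
    then show "x \<oplus>\<^bsub>L\<^esub> y \<in> carrier L" "x \<oplus>\<^bsub>L\<^esub> y = y \<oplus>\<^bsub>L\<^esub> x"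
      by (auto elim!: carrier_LE simp: simps)
  next
    show "\<zero>\<^bsub>L\<^esub> \<in> carrier L" using U_one by (simp add: zero_L)
  next
    fix x y z assume "x \<in> carrier L" "y \<in> carrier L" "z \<in> carrier L"
    then show "x \<oplus>\<^bsub>L\<^esub> y \<oplus>\<^bsub>L\<^esub> z = x \<oplus>\<^bsub>L\<^esub> (y \<oplus>\<^bsub>L\<^esub> z)"
      by (auto elim!: carrier_LE simp: simps)
  next
    fix x assume "x \<in> carrier L"
    then show "\<zero>\<^bsub>L\<^esub> \<oplus>\<^bsub>L\<^esub> x = x" by (auto elim!: carrier_LE simp: simps)
  next
    fix x assume "x \<in> carrier L"
    then obtain r s where x: "x = fr r s" "r \<in> carrier R" "s \<in> U" by (rule carrier_LE)
    have "fr (\<ominus> r) s \<oplus>\<^bsub>L\<^esub> x = fr (\<ominus> r \<otimes> s \<oplus> r \<otimes> s) (s \<otimes> s)"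
      using x by (simp add: frac_add)
    also have "\<dots> = \<zero>\<^bsub>L\<^esub>"
      unfolding zero_L using x U_one U_mult by (intro frac_eqI) (auto simp: l_minus l_neg)
    finally show "\<exists>y\<in>carrier L. y \<oplus>\<^bsub>L\<^esub> x = \<zero>\<^bsub>L\<^esub>" using x frac_closed[of "\<ominus> r" s] by auto
  qed
  show "comm_monoid L"
  proof (rule comm_monoidI)
    fix x y assume "x \<in> carrier L" "y \<in> carrier L"
    then show "x \<otimes>\<^bsub>L\<^esub> y \<in> carrier L" "x \<otimes>\<^bsub>L\<^esub> y = y \<otimes>\<^bsub>L\<^esub> x"
      by (auto elim!: carrier_LE simp: simps)
  next
    show "\<one>\<^bsub>L\<^esub> \<in> carrier L" using U_one by (simp add: one_L)
  next
    fix x y z assume "x \<in> carrier L" "y \<in> carrier L" "z \<in> carrier L"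
    then show "x \<otimes>\<^bsub>L\<^esub> y \<otimes>\<^bsub>L\<^esub> z = x \<otimes>\<^bsub>L\<^esub> (y \<otimes>\<^bsub>L\<^esub> z)"
      by (auto elim!: carrier_LE simp: simps)
  next
    fix x assume "x \<in> carrier L"
    then show "\<one>\<^bsub>L\<^esub> \<otimes>\<^bsub>L\<^esub> x = x" by (auto elim!: carrier_LE simp: simps)
  qed
  fix x y z assume "x \<in> carrier L" "y \<in> carrier L" "z \<in> carrier L"
  then obtain r1 s1 r2 s2 r3 s3 where x: "x = fr r1 s1" "y = fr r2 s2" "z = fr r3 s3"
    and c: "r1 \<in> carrier R" "s1 \<in> U" "r2 \<in> carrier R" "s2 \<in> U" "r3 \<in> carrier R" "s3 \<in> U"
    by (metis carrier_LE)
  have "(x \<oplus>\<^bsub>L\<^esub> y) \<otimes>\<^bsub>L\<^esub> z = fr ((r1 \<otimes> s2 \<oplus> r2 \<otimes> s1) \<otimes> r3) (s1 \<otimes> s2 \<otimes> s3)"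
    unfolding x using c by (simp add: frac_mult frac_add U_mult)
  also have "\<dots> = fr (r1 \<otimes> r3 \<otimes> (s2 \<otimes> s3) \<oplus> r2 \<otimes> r3 \<otimes> (s1 \<otimes> s3)) (s1 \<otimes> s3 \<otimes> (s2 \<otimes> s3))"
    by (rule frac_eqI) (use c in \<open>auto simp: U_mult m_ac l_distr r_distr\<close>)
  also have "\<dots> = x \<otimes>\<^bsub>L\<^esub> z \<oplus>\<^bsub>L\<^esub> y \<otimes>\<^bsub>L\<^esub> z"
    unfolding x using c by (simp add: frac_mult frac_add U_mult)
  finally show "(x \<oplus>\<^bsub>L\<^esub> y) \<otimes>\<^bsub>L\<^esub> z = x \<otimes>\<^bsub>L\<^esub> z \<oplus>\<^bsub>L\<^esub> y \<otimes>\<^bsub>L\<^esub> z" .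
qed

sublocale L: cring L by (rule cring_L)

lemma frac_hom: "ring_hom_ring R L (\<lambda>r. fr r \<one>)"
proof (rule ring_hom_ringI2[OF ring_axioms L.ring_axioms])
  show "(\<lambda>r. fr r \<one>) \<in> ring_hom R L"
    using U_one by (intro ring_hom_memI) (auto simp: frac_mult frac_add one_L)
qed

lemma frac_eq_mult: "r \<in> carrier R \<Longrightarrow> s \<in> U \<Longrightarrow> fr r s = fr \<one> s \<otimes>\<^bsub>L\<^esub> fr r \<one>"
  using U_one by (simp add: frac_mult)

lemma frac_num_eq_mult: "r \<in> carrier R \<Longrightarrow> s \<in> U \<Longrightarrow> fr r \<one> = fr s \<one> \<otimes>\<^bsub>L\<^esub> fr r s"
  using U_one by (simp add: frac_mult) (rule frac_eqI, auto simp: m_ac)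

lemma frac_inverse: "s \<in> U \<Longrightarrow> t \<in> U \<Longrightarrow> fr s t \<otimes>\<^bsub>L\<^esub> fr t s = \<one>\<^bsub>L\<^esub>"
  using U_one U_mult by (simp add: frac_mult one_L) (rule frac_eqI, auto simp: m_ac)

lemma frac_eq_zero_iff:
  assumes "r \<in> carrier R" "s \<in> U"
  shows "fr r s = \<zero>\<^bsub>L\<^esub> \<longleftrightarrow> (\<exists>u\<in>U. u \<otimes> r = \<zero>)"
  unfolding zero_L using assms U_one by (simp add: frac_eq_iff)

text \<open>
  A denominator is a unit, so ideals of the ring of fractions are determined by their numerators,
  and hence by their contractions.
\<close>

lemma frac_mem_ideal_iff:
  assumes J: "ideal J L" and r: "r \<in> carrier R" "s \<in> U"
  shows "fr r s \<in> J \<longleftrightarrow> fr r \<one> \<in> J"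
proof
  show "fr r s \<in> J \<Longrightarrow> fr r \<one> \<in> J"
    unfolding frac_num_eq_mult[OF r] using r U_one by (intro ideal.I_l_closed[OF J]) auto
  show "fr r \<one> \<in> J \<Longrightarrow> fr r s \<in> J"
    unfolding frac_eq_mult[OF r] using r by (intro ideal.I_l_closed[OF J]) auto
qed

abbreviation contract where "contract J \<equiv> {r \<in> carrier R. fr r \<one> \<in> J}"

lemma contract_ideal: "ideal J L \<Longrightarrow> ideal (contract J) R"
  by (rule ring_hom_ring.ideal_vimage[OF frac_hom])

lemma contract_prime: "primeideal J L \<Longrightarrow> primeideal (contract J) R"
  by (rule ring_hom_ring.primeideal_vimage[OF frac_hom is_cring])

lemma ideal_eq_of_contract_subset:
  assumes I: "ideal I L" and J: "ideal J L" and sub: "contract I \<subseteq> contract J"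
  shows "I \<subseteq> J"
proof
  fix x assume x: "x \<in> I"
  then have "x \<in> carrier L" using I by (rule ideal.Icarr[rotated])
  then obtain r s where rs: "r \<in> carrier R" "s \<in> U" "x = fr r s" by (rule carrier_LE)
  with x have "r \<in> contract I" using frac_mem_ideal_iff[OF I] by blast
  with sub have "fr r \<one> \<in> J" by blast
  then show "x \<in> J" using rs frac_mem_ideal_iff[OF J] by blast
qed

lemma noetherian_L:
  assumes "noetherian_ring R"
  shows "noetherian_ring L"
proof (rule L.noetherian_ringI)
  fix J assume J: "ideal J L"
  obtain A where A: "A \<subseteq> carrier R" "finite A" "contract J = Idl A"
    using noetherian_ring.finetely_gen[OF assms contract_ideal[OF J]] by blast
  let ?B = "(\<lambda>r. fr r \<one>) ` A"
  have B: "?B \<subseteq> carrier L" using A U_one by auto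
  have "A \<subseteq> contract J" using A genideal_self by simp
  then have "?B \<subseteq> J" by auto
  then have "Idl\<^bsub>L\<^esub> ?B \<subseteq> J" by (rule L.genideal_minimal[OF J])
  moreover have "A \<subseteq> contract (Idl\<^bsub>L\<^esub> ?B)"
    using A L.genideal_self[OF B] by auto
  then have "Idl A \<subseteq> contract (Idl\<^bsub>L\<^esub> ?B)"
    by (rule genideal_minimal[OF contract_ideal[OF L.genideal_ideal[OF B]]])
  then have "J \<subseteq> Idl\<^bsub>L\<^esub> ?B"
    using A J by (intro ideal_eq_of_contract_subset L.genideal_ideal[OF B]) auto
  ultimately show "\<exists>A\<subseteq>carrier L. finite A \<and> J = Idl\<^bsub>L\<^esub> A"
    using A B by (intro exI[of _ ?B]) auto
qed

end


section \<open>Localization at a prime ideal\<close>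

locale prime_localization = P: primeideal P R for P and R (structure)

sublocale prime_localization \<subseteq> multiplicative_subset R "carrier R - P"
proof
  show "\<one> \<in> carrier R - P" using P.one_imp_carrier P.I_notcarr by auto
  show "s \<otimes> t \<in> carrier R - P" if "s \<in> carrier R - P" "t \<in> carrier R - P" for s t
    using that P.I_prime by auto
qed auto

context prime_localization
begin

definition extend :: "'a set \<Rightarrow> ('a \<times> 'a) set set" where
  "extend Q = {fr r s | r s. r \<in> Q \<and> s \<in> carrier R - P}"

lemma mem_extend_iff:
  assumes Q: "primeideal Q R" "Q \<subseteq> P" and r: "r \<in> carrier R" "s \<in> carrier R - P"
  shows "fr r s \<in> extend Q \<longleftrightarrow> r \<in> Q"
proof
  interpret Q: primeideal Q R by fact
  assume "fr r s \<in> extend Q"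
  then obtain r' s' where r': "r' \<in> Q" "s' \<in> carrier R - P" "fr r s = fr r' s'"
    unfolding extend_def by blast
  then obtain t where t: "t \<in> carrier R - P" "t \<otimes> (r \<otimes> s') = t \<otimes> (r' \<otimes> s)"
    using r Q.Icarr frac_eq_iff by auto
  have "t \<otimes> (r' \<otimes> s) \<in> Q" using r' r t by (simp add: Q.I_l_closed Q.I_r_closed)
  then have "t \<otimes> (r \<otimes> s') \<in> Q" using t by simp
  then have "r \<otimes> s' \<in> Q" using Q.I_prime[of t "r \<otimes> s'"] t r r' Q(2) by auto
  then show "r \<in> Q" using Q.I_prime[of r s'] r r' Q(2) by auto
next
  assume "r \<in> Q"
  then show "fr r s \<in> extend Q" using r unfolding extend_def by blast
qed

lemma extend_prime:
  assumes Q: "primeideal Q R" "Q \<subseteq> P"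
  shows "primeideal (extend Q) L"
proof -
  interpret Q: primeideal Q R by fact
  note [simp] = mem_extend_iff[OF Q]
  have sub: "extend Q \<subseteq> carrier L" unfolding extend_def by auto
  have elim: "\<exists>r s. r \<in> Q \<and> s \<in> carrier R - P \<and> x = fr r s" if "x \<in> extend Q" for x
    using that unfolding extend_def by blast
  show ?thesis
  proof (rule primeidealI[OF _ cring_L])
    show "ideal (extend Q) L"
    proof (rule L.ideal_cringI[OF sub])
      show "\<zero>\<^bsub>L\<^esub> \<in> extend Q" using U_one by (simp add: zero_L)
    next
      fix x y assume "x \<in> extend Q" "y \<in> extend Q"
      then obtain r s r' s' where xy: "x = fr r s" "r \<in> Q" "s \<in> carrier R - P"
        "y = fr r' s'" "r' \<in> Q" "s' \<in> carrier R - P" using elim by blast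
      have "r \<otimes> s' \<oplus> r' \<otimes> s \<in> Q" using xy by (auto intro: Q.I_r_closed)
      moreover have "s \<otimes> s' \<in> carrier R - P" using U_mult xy by blast
      ultimately show "x \<oplus>\<^bsub>L\<^esub> y \<in> extend Q"
        using xy by (simp add: frac_add)
    next
      fix x y assume "x \<in> carrier L" "y \<in> extend Q"
      then obtain r s r' s' where xy: "x = fr r s" "r \<in> carrier R" "s \<in> carrier R - P"
        "y = fr r' s'" "r' \<in> Q" "s' \<in> carrier R - P" using elim carrier_LE by metis
      have "r \<otimes> r' \<in> Q" using xy by (auto intro: Q.I_l_closed)
      moreover have "s \<otimes> s' \<in> carrier R - P" using U_mult xy by blast
      ultimately show "x \<otimes>\<^bsub>L\<^esub> y \<in> extend Q"
        using xy by (simp add: frac_mult)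
    qed
    have "\<one>\<^bsub>L\<^esub> \<notin> extend Q"
      unfolding one_L using U_one Q.one_imp_carrier Q.I_notcarr by auto
    then show "carrier L \<noteq> extend Q" using L.one_closed by blast
  next
    fix x y assume "x \<in> carrier L" "y \<in> carrier L" and xy: "x \<otimes>\<^bsub>L\<^esub> y \<in> extend Q"
    then obtain r s r' s' where x: "x = fr r s" "r \<in> carrier R" "s \<in> carrier R - P"
      "y = fr r' s'" "r' \<in> carrier R" "s' \<in> carrier R - P" using carrier_LE by metis
    moreover have "s \<otimes> s' \<in> carrier R - P" using U_mult x by blast
    ultimately have "r \<otimes> r' \<in> Q" using xy by (simp add: frac_mult)
    then show "x \<in> extend Q \<or> y \<in> extend Q" using x Q.I_prime by auto
  qed
qed

lemma frac_mem_extend_P_iff: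
  "r \<in> carrier R \<Longrightarrow> s \<in> carrier R - P \<Longrightarrow> fr r s \<in> extend P \<longleftrightarrow> r \<in> P"
  by (rule mem_extend_iff[OF P.primeideal_axioms subset_refl])

lemma extend_P_prime: "primeideal (extend P) L"
  by (rule extend_prime[OF P.primeideal_axioms subset_refl])

text \<open>
  A fraction whose numerator avoids \<^term>\<open>P\<close> is a unit.
\<close>

lemma proper_ideal_subset_extend_P:
  assumes J: "ideal J L" "J \<noteq> carrier L"
  shows "J \<subseteq> extend P"
proof
  fix x assume x: "x \<in> J"
  then have "x \<in> carrier L" using J(1) by (rule ideal.Icarr[rotated])
  then obtain r s where rs: "r \<in> carrier R" "s \<in> carrier R - P" "x = fr r s" by (rule carrier_LE)
  show "x \<in> extend P"
  proof (rule ccontr)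
    assume "x \<notin> extend P"
    then have r: "r \<in> carrier R - P" using rs frac_mem_extend_P_iff by auto
    have "x \<otimes>\<^bsub>L\<^esub> fr s r \<in> J" by (rule ideal.I_r_closed[OF J(1) x]) (use r rs in auto)
    then have "\<one>\<^bsub>L\<^esub> \<in> J" using frac_inverse[OF r rs(2)] rs by simp
    then show False using ideal.one_imp_carrier[OF J(1)] J(2) by blast
  qed
qed

lemma maximalideal_L_iff: "{M. maximalideal M L} = {extend P}"
proof -
  interpret M: primeideal "extend P" L by (rule extend_P_prime)
  have "maximalideal (extend P) L"
    using proper_ideal_subset_extend_P by (intro maximalidealI M.is_ideal M.I_notcarr) blast
  moreover have "M = extend P" if "maximalideal M L" for M
  proof -
    interpret M': maximalideal M L by fact
    show ?thesis
      using M'.I_maximal[OF M.is_ideal] proper_ideal_subset_extend_P[OF M'.is_ideal]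
        M'.I_notcarr M.I_notcarr M.a_subset by blast
  qed
  ultimately show ?thesis by blast
qed

end

text \<open>
  Krull's argument: an ideal that is maximal among those that contain \<^term>\<open>I\<close> and no power
  of \<^term>\<open>b\<close> is prime.
\<close>

lemma (in cring) prime_ideal_avoiding_powers:
  assumes I: "ideal I R" and b: "b \<in> carrier R" and disj: "\<And>k::nat. b [^] k \<notin> I"
  obtains Q where "primeideal Q R" "I \<subseteq> Q" "b \<notin> Q"
proof -
  define F where "F = {J. ideal J R \<and> I \<subseteq> J \<and> (\<forall>k::nat. b [^] k \<notin> J)}"
  have "\<exists>M\<in>F. \<forall>X\<in>F. M \<subseteq> X \<longrightarrow> X = M"
  proof (rule subset_Zorn_nonempty)
    show "F \<noteq> {}" using I disj unfolding F_def by blast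
  next
    fix C assume C: "C \<noteq> {}" "subset.chain F C"
    have "subset.chain {J. ideal J R} C"
      using C(2) unfolding F_def pred_on.chain_def by blast
    then have "ideal (\<Union>C) R" using chain_Union_is_ideal[of C] C(1) by simp
    moreover have CF: "J \<in> F" if "J \<in> C" for J
      using C(2) that unfolding pred_on.chain_def by blast
    obtain J where "J \<in> C" using C(1) by blast
    then have "I \<subseteq> \<Union>C" using CF[of J] by (auto simp: F_def)
    moreover have "b [^] k \<notin> \<Union>C" for k :: nat
      using CF by (auto simp: F_def)
    ultimately show "\<Union>C \<in> F" by (simp add: F_def)
  qed
  then obtain Q where QF: "Q \<in> F" and Qmax: "\<forall>X\<in>F. Q \<subseteq> X \<longrightarrow> X = Q"
    by (rule bexE)
  from QF have Q: "ideal Q R" "I \<subseteq> Q" "\<And>k::nat. b [^] k \<notin> Q"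
    by (simp_all add: F_def)
  have max: "X = Q" if "ideal X R" "Q \<subseteq> X" "\<And>k::nat. b [^] k \<notin> X" for X
  proof -
    have "X \<in> F" using that Q(2) by (simp add: F_def)
    then show ?thesis using Qmax that(2) by simp
  qed
  interpret Q: ideal Q R by fact
  \<comment> \<open>Enlarging \<open>Q\<close> by an element \<open>x\<close> outside it must capture a power of \<open>b\<close>.\<close>
  have step: "\<exists>k::nat. \<exists>y\<in>carrier R. \<exists>z\<in>Q. b [^] k = x \<otimes> y \<oplus> z"
    if x: "x \<in> carrier R" "x \<notin> Q" for x
  proof -
    let ?X = "{x \<otimes> y \<oplus> z | y z. y \<in> carrier R \<and> z \<in> Q}"
    have "ideal ?X R"
    proof (rule ideal_cringI)
      show "?X \<subseteq> carrier R" using x Q.Icarr by auto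
      show "\<zero> \<in> ?X" using x by (intro CollectI exI[of _ \<zero>]) auto
    next
      fix a c assume "a \<in> ?X" "c \<in> ?X"
      then obtain y z y' z' where a: "a = x \<otimes> y \<oplus> z" "c = x \<otimes> y' \<oplus> z'" "y \<in> carrier R" "z \<in> Q"
        "y' \<in> carrier R" "z' \<in> Q" by blast
      then have "a \<oplus> c = x \<otimes> (y \<oplus> y') \<oplus> (z \<oplus> z')"
        using x Q.Icarr by (simp add: r_distr a_ac)
      then show "a \<oplus> c \<in> ?X" using a by blast
    next
      fix w a assume w: "w \<in> carrier R" and "a \<in> ?X"
      then obtain y z where a: "a = x \<otimes> y \<oplus> z" "y \<in> carrier R" "z \<in> Q" by blast
      then have "w \<otimes> a = x \<otimes> (w \<otimes> y) \<oplus> w \<otimes> z"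
        using x w Q.Icarr by (simp add: r_distr m_ac)
      then show "w \<otimes> a \<in> ?X" using a w Q.I_l_closed by blast
    qed
    moreover have "Q \<subseteq> ?X"
    proof
      fix z assume "z \<in> Q"
      then have "z = x \<otimes> \<zero> \<oplus> z" using x Q.Icarr by simp
      then show "z \<in> ?X" using \<open>z \<in> Q\<close> by blast
    qed
    moreover have "x = x \<otimes> \<one> \<oplus> \<zero>" using x by simp
    then have "x \<in> ?X" using Q.zero_closed by blast
    ultimately have "\<exists>k::nat. b [^] k \<in> ?X" using max[of ?X] x by blast
    then show ?thesis by blast
  qed
  have "primeideal Q R"
  proof (rule primeidealI[OF Q(1) is_cring])
    show "carrier R \<noteq> Q" using Q(3)[of 0] by auto
  next
    fix x x' assume x: "x \<in> carrier R" "x' \<in> carrier R" and xx': "x \<otimes> x' \<in> Q"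
    show "x \<in> Q \<or> x' \<in> Q"
    proof (rule ccontr)
      assume "\<not> (x \<in> Q \<or> x' \<in> Q)"
      then obtain k k' :: nat and y y' z z' where
        k: "b [^] k = x \<otimes> y \<oplus> z" "y \<in> carrier R" "z \<in> Q" and
        k': "b [^] k' = x' \<otimes> y' \<oplus> z'" "y' \<in> carrier R" "z' \<in> Q"
        using step x by metis
      have "b [^] (k + k') = (x \<otimes> y \<oplus> z) \<otimes> (x' \<otimes> y' \<oplus> z')"
        using b k(1) k'(1) by (simp add: nat_pow_mult[symmetric])
      also have "\<dots> = (x \<otimes> x') \<otimes> (y \<otimes> y') \<oplus> (x \<otimes> y) \<otimes> z' \<oplus> (x' \<otimes> y' \<oplus> z') \<otimes> z"
        using x k k' Q.Icarr by (simp add: l_distr r_distr m_ac a_ac)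
      also have "\<dots> \<in> Q"
        using x k k' Q.Icarr
        by (intro Q.a_closed Q.I_r_closed[OF xx'] Q.I_l_closed[OF k'(3)] Q.I_l_closed[OF k(3)]) auto
      finally show False using Q(3) by blast
    qed
  qed
  moreover have "b \<notin> Q" using Q(3)[of 1] b by simp
  ultimately show thesis using Q(2) that by blast
qed

lemma (in primeideal) prime_pow_mem:
  assumes "x \<in> carrier R" "x [^] (k::nat) \<in> I"
  shows "x \<in> I"
  using assms(2)
proof (induction k)
  case 0
  then show ?case using one_imp_carrier I_notcarr by auto
next
  case (Suc k)
  then show ?case using I_prime[of "x [^] k" x] assms(1) by auto
qed


section \<open>Cohen-Macaulay rings of dimension one with nilpotent minimal prime\<close>

text \<open>
  The conditions say that the spectrum consists of one minimal prime, the nilradical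
  \<^term>\<open>N\<close>, and of maximal ideals above it. The Cohen-Macaulay property then is a
  question about single nonzerodivisors.
\<close>

locale one_dimensional_ring = cring R for R (structure) +
  fixes N :: "'a set"
  assumes noetherian: "noetherian_ring R"
    and N_prime: "primeideal N R" and N_not_maximal: "\<not> maximalideal N R"
    and N_nilpotent: "x \<in> N \<Longrightarrow> \<exists>k::nat. x [^] k = \<zero>"
    and prime_maximal: "primeideal Q R \<Longrightarrow> Q \<noteq> N \<Longrightarrow> maximalideal Q R"
begin

lemma N_subset_prime:
  assumes "primeideal Q R"
  shows "N \<subseteq> Q"
proof
  interpret Q: primeideal Q R by fact
  fix x assume x: "x \<in> N"
  then obtain k :: nat where "x [^] k = \<zero>" using N_nilpotent by blast
  then have "x [^] k \<in> Q" by simp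
  then show "x \<in> Q"
    using Q.prime_pow_mem x ideal.Icarr[OF primeideal.axioms(1)[OF N_prime]] by blast
qed

end

locale one_dimensional_localization = one_dimensional_ring R N for R (structure) and N +
  fixes P :: "'a set"
  assumes P_maximal: "maximalideal P R"

sublocale one_dimensional_localization \<subseteq> prime_localization P R
  using maximalideal_prime[OF P_maximal] by (simp add: prime_localization_def)

context one_dimensional_localization
begin

lemma L_eq: "localization R P = L"
  by (simp add: localization_def)

lemma N_psubset_P: "N \<subset> P"
  using N_subset_prime[OF P.primeideal_axioms] P_maximal N_not_maximal by blast

text \<open>
  Contraction identifies the primes of the localization with the primes below \<^term>\<open>P\<close>,
  and these are only \<^term>\<open>N\<close> and \<^term>\<open>P\<close> itself.
\<close>

lemma prime_L_cases:
  assumes Q: "primeideal Q L"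
  shows "Q = extend N \<or> Q = extend P"
proof -
  interpret Q: primeideal Q L by fact
  have sub: "Q \<subseteq> extend P"
    using proper_ideal_subset_extend_P[OF Q.is_ideal] Q.I_notcarr by blast
  have eq: "Q = extend (contract Q)"
  proof
    show "Q \<subseteq> extend (contract Q)"
    proof
      fix x assume x: "x \<in> Q"
      then obtain r s where "r \<in> carrier R" "s \<in> carrier R - P" "x = fr r s"
        using Q.Icarr carrier_LE by metis
      then show "x \<in> extend (contract Q)"
        using frac_mem_ideal_iff[OF Q.is_ideal] x unfolding extend_def by blast
    qed
    show "extend (contract Q) \<subseteq> Q"
      using frac_mem_ideal_iff[OF Q.is_ideal] unfolding extend_def by blast
  qed
  have c: "contract Q \<subseteq> P"
    using sub frac_mem_extend_P_iff U_one by blast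
  have "contract Q = P" if "contract Q \<noteq> N"
  proof -
    interpret C: maximalideal "contract Q" R
      using prime_maximal[OF contract_prime[OF Q] that] .
    show ?thesis using C.I_maximal[OF P.is_ideal c P.a_subset] P.I_notcarr by blast
  qed
  then show ?thesis using trans[OF eq arg_cong[of "contract Q" _ extend]] by blast
qed

lemma krull_dim_L: "krull_dim L = 1"
proof -
  let ?S = "{enat n |n. \<exists>Q. (\<forall>i\<le>n. primeideal (Q i) L) \<and> (\<forall>i<n. Q i \<subset> Q (Suc i))}"
  obtain x where x: "x \<in> P" "x \<notin> N" using N_psubset_P by blast
  have NP: "extend N \<subset> extend P"
  proof
    show "extend N \<subseteq> extend P" using N_psubset_P unfolding extend_def by blast
    have "fr x \<one> \<in> extend P" "fr x \<one> \<notin> extend N"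
      using x P.Icarr U_one mem_extend_iff[OF N_prime] N_psubset_P frac_mem_extend_P_iff by auto
    then show "extend N \<noteq> extend P" by blast
  qed
  have "\<exists>Q. (\<forall>i\<le>1. primeideal (Q i) L) \<and> (\<forall>i<1. Q i \<subset> Q (Suc i))"
    using NP extend_P_prime extend_prime[OF N_prime] N_psubset_P
    by (intro exI[of _ "\<lambda>i::nat. if i = 0 then extend N else extend P"]) auto
  then have "enat 1 \<in> ?S" by blast
  moreover have "y \<le> enat 1" if yS: "y \<in> ?S" for y
  proof -
    obtain n Q where y: "y = enat n" and "(\<forall>i\<le>n. primeideal (Q i) L) \<and> (\<forall>i<n. Q i \<subset> Q (Suc i))"
      using yS by blast
    then have Q: "\<And>i. i \<le> n \<Longrightarrow> primeideal (Q i) L" "\<And>i. i < n \<Longrightarrow> Q i \<subset> Q (Suc i)" by simp_all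
    have "n \<le> 1"
    proof (rule ccontr)
      assume "\<not> n \<le> 1"
      then have "Q 0 \<subset> Q 1" "Q 1 \<subset> Q 2" "primeideal (Q 0) L" "primeideal (Q 1) L" "primeideal (Q 2) L"
        using Q(2)[of 0] Q(2)[of 1] Q(1) by (auto simp: numeral_2_eq_2)
      then show False
        using prime_L_cases[of "Q 0"] prime_L_cases[of "Q 1"] prime_L_cases[of "Q 2"] NP by auto
    qed
    then show ?thesis using y by simp
  qed
  ultimately have "Sup ?S = enat 1" by (intro Sup_eqI) auto
  then show ?thesis unfolding krull_dim_def by (simp add: one_enat_def)
qed

text \<open>
  Depth is at most dimension. Let a regular sequence start with \<open>a, b\<close>. As a nonzerodivisor,
  \<open>a\<close> is not nilpotent, so the only prime that contains it is the maximal ideal, which also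
  contains \<open>b\<close>. Therefore some power of \<open>b\<close> lies in \<open>(a)\<close>, and cancelling \<open>b\<close>
  modulo \<open>a\<close> repeatedly puts \<open>1\<close> into \<open>(a)\<close>.
\<close>

lemma regular_sequence_L_length:
  assumes reg: "regular_sequence L xs" and sub: "set xs \<subseteq> extend P"
  shows "length xs \<le> 1"
proof (rule ccontr)
  assume len: "\<not> length xs \<le> 1"
  interpret M: primeideal "extend P" L by (rule extend_P_prime)
  let ?a = "xs ! 0" and ?b = "xs ! 1"
  have mem: "?a \<in> extend P" "?b \<in> extend P"
    by (rule subsetD[OF sub nth_mem], use len in linarith)+
  then have ab: "?a \<in> carrier L" "?b \<in> carrier L" using M.Icarr by auto
  have zero: "Idl\<^bsub>L\<^esub> {} = {\<zero>\<^bsub>L\<^esub>}"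
    using L.genideal_minimal[OF L.zeroideal] L.genideal_ideal[of "{}"]
      additive_subgroup.zero_closed[OF ideal.axioms(1)] by blast
  have a_reg: "r = \<zero>\<^bsub>L\<^esub>" if "r \<in> carrier L" "?a \<otimes>\<^bsub>L\<^esub> r = \<zero>\<^bsub>L\<^esub>" for r
  proof -
    have "0 < length xs" using len by (cases xs) auto
    then have "xs ! 0 \<otimes>\<^bsub>L\<^esub> r \<in> Idl\<^bsub>L\<^esub> (set (take 0 xs)) \<longrightarrow> r \<in> Idl\<^bsub>L\<^esub> (set (take 0 xs))"
      using reg that(1) unfolding regular_sequence_def by blast
    then show ?thesis using that(2) by (simp add: zero)
  qed
  have "take 1 xs = [?a]" using len by (cases xs) auto
  then have b_reg: "r \<in> Idl\<^bsub>L\<^esub> {?a}" if "r \<in> carrier L" "?b \<otimes>\<^bsub>L\<^esub> r \<in> Idl\<^bsub>L\<^esub> {?a}" for r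
  proof -
    have "1 < length xs" using len by simp
    then have "xs ! 1 \<otimes>\<^bsub>L\<^esub> r \<in> Idl\<^bsub>L\<^esub> (set (take 1 xs)) \<longrightarrow> r \<in> Idl\<^bsub>L\<^esub> (set (take 1 xs))"
      using reg that(1) unfolding regular_sequence_def by blast
    then show ?thesis using that(2) \<open>take 1 xs = [?a]\<close> by simp
  qed
  interpret A: ideal "Idl\<^bsub>L\<^esub> {?a}" L by (rule L.genideal_ideal) (use ab in auto)
  have a_mem: "?a \<in> Idl\<^bsub>L\<^esub> {?a}" by (rule L.genideal_self') (use ab in auto)
  have "Idl\<^bsub>L\<^esub> {?a} \<noteq> carrier L"
    using L.genideal_minimal[OF M.is_ideal, of "{?a}"] mem M.I_notcarr M.a_subset by blast
  then have one: "\<one>\<^bsub>L\<^esub> \<notin> Idl\<^bsub>L\<^esub> {?a}" using A.one_imp_carrier by blast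
  have "?b [^]\<^bsub>L\<^esub> k \<notin> Idl\<^bsub>L\<^esub> {?a}" for k :: nat
  proof (induction k)
    case 0
    then show ?case using one by simp
  next
    case (Suc k)
    then show ?case using b_reg[of "?b [^]\<^bsub>L\<^esub> k"] ab L.m_comm[of "?b [^]\<^bsub>L\<^esub> k" ?b] by auto
  qed
  then obtain Q where Q: "primeideal Q L" "Idl\<^bsub>L\<^esub> {?a} \<subseteq> Q" "?b \<notin> Q"
    using L.prime_ideal_avoiding_powers[OF A.is_ideal ab(2)] by blast
  then have "Q = extend N" using prime_L_cases mem by blast
  then have "?a \<in> extend N" using Q a_mem by blast
  then obtain r s where r: "?a = fr r s" "r \<in> N" "s \<in> carrier R - P"
    unfolding extend_def by blast
  obtain k :: nat where k: "r [^] k = \<zero>" using N_nilpotent r by blast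
  have rc: "r \<in> carrier R" using r N_psubset_P P.Icarr by blast
  have "?a [^]\<^bsub>L\<^esub> k = \<zero>\<^bsub>L\<^esub>" if "r [^] k = \<zero>" for k :: nat
  proof -
    have "\<exists>t\<in>carrier R - P. ?a [^]\<^bsub>L\<^esub> k = fr (r [^] k) t"
    proof (induction k)
      case 0
      then show ?case using U_one by (auto simp: one_L)
    next
      case (Suc k)
      then obtain t where "t \<in> carrier R - P" "?a [^]\<^bsub>L\<^esub> k = fr (r [^] k) t" by blast
      then have "?a [^]\<^bsub>L\<^esub> Suc k = fr (r [^] Suc k) (t \<otimes> s)" "t \<otimes> s \<in> carrier R - P"
        using r rc U_mult by (auto simp: frac_mult)
      then show ?case by blast
    qed
    then show ?thesis using that frac_eq_zero_iff[of \<zero>] U_one by auto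
  qed
  then have "?a [^]\<^bsub>L\<^esub> k = \<zero>\<^bsub>L\<^esub>" using k by blast
  then have "\<one>\<^bsub>L\<^esub> = \<zero>\<^bsub>L\<^esub>"
  proof (induction k)
    case (Suc k)
    then show ?case using a_reg[of "?a [^]\<^bsub>L\<^esub> k"] ab L.m_comm[of "?a [^]\<^bsub>L\<^esub> k" ?a] by auto
  qed simp
  then show False using one by simp
qed

text \<open>
  A fraction is \<open>0\<close> exactly if its numerator is killed by an element outside \<^term>\<open>P\<close>; this
  translates the condition that a fraction is a nonzerodivisor into a condition in \<^term>\<open>R\<close>.
\<close>

lemma regular_sequence_L_singleton_iff:
  assumes r: "r \<in> P" and s: "s \<in> carrier R - P"
  shows "regular_sequence L [fr r s] \<longleftrightarrow>
    (\<forall>x\<in>carrier R. (\<exists>u\<in>carrier R - P. u \<otimes> (r \<otimes> x) = \<zero>) \<longrightarrow> (\<exists>u\<in>carrier R - P. u \<otimes> x = \<zero>))"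
    (is "_ \<longleftrightarrow> ?nzd")
proof -
  interpret M: primeideal "extend P" L by (rule extend_P_prime)
  have rc: "r \<in> carrier R" using r P.Icarr by blast
  have zero: "Idl\<^bsub>L\<^esub> {} = {\<zero>\<^bsub>L\<^esub>}"
    using L.genideal_minimal[OF L.zeroideal] L.genideal_ideal[of "{}"]
      additive_subgroup.zero_closed[OF ideal.axioms(1)] by blast
  have "Idl\<^bsub>L\<^esub> {fr r s} \<noteq> carrier L"
    using L.genideal_minimal[OF M.is_ideal, of "{fr r s}"] r rc s frac_mem_extend_P_iff
      M.I_notcarr M.a_subset by blast
  then have "regular_sequence L [fr r s] \<longleftrightarrow>
      (\<forall>y\<in>carrier L. fr r s \<otimes>\<^bsub>L\<^esub> y = \<zero>\<^bsub>L\<^esub> \<longrightarrow> y = \<zero>\<^bsub>L\<^esub>)"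
    using rc s unfolding regular_sequence_def by (simp add: zero)
  also have "\<dots> \<longleftrightarrow> ?nzd"
  proof (intro iffI ballI impI)
    fix x
    assume A: "\<forall>y\<in>carrier L. fr r s \<otimes>\<^bsub>L\<^esub> y = \<zero>\<^bsub>L\<^esub> \<longrightarrow> y = \<zero>\<^bsub>L\<^esub>" and x: "x \<in> carrier R"
      and "\<exists>u\<in>carrier R - P. u \<otimes> (r \<otimes> x) = \<zero>"
    then obtain u where u: "u \<in> carrier R" "u \<notin> P" "u \<otimes> (r \<otimes> x) = \<zero>" by blast
    have "fr r s \<otimes>\<^bsub>L\<^esub> fr x \<one> = fr (r \<otimes> x) (s \<otimes> \<one>)" using rc s x U_one by (simp add: frac_mult)
    also have "\<dots> = \<zero>\<^bsub>L\<^esub>" using rc s x U_one U_mult u by (subst frac_eq_zero_iff) auto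
    finally have "fr x \<one> = \<zero>\<^bsub>L\<^esub>" using A x U_one by auto
    then show "\<exists>u\<in>carrier R - P. u \<otimes> x = \<zero>" using frac_eq_zero_iff x U_one by blast
  next
    fix y assume A: ?nzd and "y \<in> carrier L" and y0: "fr r s \<otimes>\<^bsub>L\<^esub> y = \<zero>\<^bsub>L\<^esub>"
    then obtain x t where y: "y = fr x t" "x \<in> carrier R" "t \<in> carrier R - P" using carrier_LE by metis
    have "fr (r \<otimes> x) (s \<otimes> t) = \<zero>\<^bsub>L\<^esub>" "s \<otimes> t \<in> carrier R - P"
      using y0 y rc s U_mult by (simp_all add: frac_mult)
    then have "\<exists>u\<in>carrier R - P. u \<otimes> (r \<otimes> x) = \<zero>" using frac_eq_zero_iff rc y by blast
    then have "\<exists>u\<in>carrier R - P. u \<otimes> x = \<zero>" using A y by blast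
    then show "y = \<zero>\<^bsub>L\<^esub>" using frac_eq_zero_iff y by blast
  qed
  finally show ?thesis .
qed

text \<open>
  The dimension is \<open>1\<close> and the depth is at most \<open>1\<close>, so equality means that the
  maximal ideal contains a regular sequence of length \<open>1\<close>.
\<close>

theorem cohen_macaulay_local_iff:
  "cohen_macaulay_local (localization R P) \<longleftrightarrow>
    (\<exists>r\<in>P. \<forall>x\<in>carrier R.
       (\<exists>u\<in>carrier R - P. u \<otimes> (r \<otimes> x) = \<zero>) \<longrightarrow> (\<exists>u\<in>carrier R - P. u \<otimes> x = \<zero>))"
    (is "_ \<longleftrightarrow> (\<exists>r\<in>P. ?nzd r)")
proof -
  let ?S = "{enat (length xs) |xs. regular_sequence L xs \<and> set xs \<subseteq> extend P}"
  interpret M: primeideal "extend P" L by (rule extend_P_prime)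
  have bound: "y \<le> 1" if "y \<in> ?S" for y
    using that regular_sequence_L_length by (auto simp: one_enat_def)
  have "cohen_macaulay_local (localization R P) \<longleftrightarrow> depth L (extend P) = 1"
    unfolding cohen_macaulay_local_def L_eq maximalideal_L_iff krull_dim_L
    using cring_L noetherian_L[OF noetherian] by auto
  also have "\<dots> \<longleftrightarrow> 1 \<in> ?S"
  proof
    assume d: "depth L (extend P) = 1"
    show "1 \<in> ?S"
    proof (rule ccontr)
      assume "1 \<notin> ?S"
      then have "y \<le> 0" if "y \<in> ?S" for y
        using bound[OF that] that by (auto simp: one_enat_def zero_enat_def le_Suc_eq)
      then have "Sup ?S \<le> 0" by (rule Sup_least)
      then show False using d unfolding depth_def by simp
    qed
  next
    assume "1 \<in> ?S"
    then show "depth L (extend P) = 1"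
      unfolding depth_def using bound by (intro Sup_eqI) auto
  qed
  also have "\<dots> \<longleftrightarrow> (\<exists>x\<in>extend P. regular_sequence L [x])"
  proof -
    have "1 \<in> ?S \<longleftrightarrow> (\<exists>xs. length xs = 1 \<and> regular_sequence L xs \<and> set xs \<subseteq> extend P)"
      unfolding one_enat_def mem_Collect_eq enat.inject by (simp only: eq_commute[of 1])
    also have "\<dots> \<longleftrightarrow> (\<exists>x\<in>extend P. regular_sequence L [x])"
    proof
      assume "\<exists>xs. length xs = 1 \<and> regular_sequence L xs \<and> set xs \<subseteq> extend P"
      then obtain xs where xs: "length xs = 1" "regular_sequence L xs" "set xs \<subseteq> extend P"
        by (elim exE conjE)
      then obtain x where "xs = [x]" by (cases xs) auto
      with xs show "\<exists>x\<in>extend P. regular_sequence L [x]" by (intro bexI[of _ x]) auto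
    next
      assume "\<exists>x\<in>extend P. regular_sequence L [x]"
      then obtain x where "x \<in> extend P" "regular_sequence L [x]" by (rule bexE)
      then show "\<exists>xs. length xs = 1 \<and> regular_sequence L xs \<and> set xs \<subseteq> extend P"
        by (intro exI[of _ "[x]"]) simp
    qed
    finally show ?thesis .
  qed
  also have "\<dots> \<longleftrightarrow> (\<exists>r\<in>P. ?nzd r)"
  proof
    assume "\<exists>x\<in>extend P. regular_sequence L [x]"
    then obtain x where "x \<in> extend P" and reg: "regular_sequence L [x]" by (rule bexE)
    then obtain r s where x: "x = fr r s" "r \<in> P" "s \<in> carrier R - P"
      unfolding extend_def by blast
    have "?nzd r" using reg unfolding x(1) regular_sequence_L_singleton_iff[OF x(2,3)] .
    with x(2) show "\<exists>r\<in>P. ?nzd r" by (rule bexI[rotated])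
  next
    assume "\<exists>r\<in>P. ?nzd r"
    then obtain r where r: "r \<in> P" "?nzd r" by (rule bexE)
    have "regular_sequence L [fr r \<one>]"
      using r(2) unfolding regular_sequence_L_singleton_iff[OF r(1) U_one] .
    moreover have "fr r \<one> \<in> extend P" using r(1) U_one unfolding extend_def by blast
    ultimately show "\<exists>x\<in>extend P. regular_sequence L [x]" by (rule bexI)
  qed
  finally show ?thesis .
qed

end

context one_dimensional_ring
begin

theorem cohen_macaulay_iff:
  "cohen_macaulay R \<longleftrightarrow> (\<forall>P. maximalideal P R \<longrightarrow>
    (\<exists>r\<in>P. \<forall>x\<in>carrier R.
       (\<exists>u\<in>carrier R - P. u \<otimes> (r \<otimes> x) = \<zero>) \<longrightarrow> (\<exists>u\<in>carrier R - P. u \<otimes> x = \<zero>)))"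
proof -
  have "cohen_macaulay_local (localization R P) \<longleftrightarrow>
    (\<exists>r\<in>P. \<forall>x\<in>carrier R.
       (\<exists>u\<in>carrier R - P. u \<otimes> (r \<otimes> x) = \<zero>) \<longrightarrow> (\<exists>u\<in>carrier R - P. u \<otimes> x = \<zero>))"
    if "maximalideal P R" for P
  proof -
    have "one_dimensional_localization R N P"
      by (intro one_dimensional_localization.intro one_dimensional_ring_axioms
          one_dimensional_localization_axioms.intro that)
    then show ?thesis by (rule one_dimensional_localization.cohen_macaulay_local_iff)
  qed
  then show ?thesis
    unfolding cohen_macaulay_def by (simp add: is_cring noetherian)
qed

end


section \<open>The defect of an element of a numerical semigroup\<close>

locale numsemi =
  fixes T :: "nat set"
  assumes numerical: "numerical_semigroup T"
begin

abbreviation (input) \<omega> where "\<omega> \<equiv> semigroup_ord T"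

abbreviation (input) e where "e \<equiv> least_pos T"

lemma submonoid: "nat_submonoid T"
  using numerical by (simp add: numerical_semigroup_def)

lemma zero_mem [simp]: "0 \<in> T" and add_mem: "s \<in> T \<Longrightarrow> t \<in> T \<Longrightarrow> s + t \<in> T"
  using submonoid by (auto simp: nat_submonoid_def)

lemmas e_mem = least_pos_mem(1)[OF numerical]

lemmas e_pos = least_pos_mem(2)[OF numerical]

lemmas ord_e = semigroup_ord_least_pos[OF numerical]

lemmas mult_mem = nat_submonoid_mult[OF submonoid]

lemmas ord_add = semigroup_ord_superadditive[OF submonoid]

lemmas e_ord_le = mult_least_pos_ord_le[OF submonoid]

lemma ord_0 [simp]: "\<omega> 0 = 0"
  using e_ord_le[of 0] e_pos by simp

lemma ord_mult_e: "\<omega> (j * e) = j"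
proof -
  have "e * \<omega> (j * e) \<le> e * j"
    using e_ord_le[OF mult_mem[OF e_mem], of j] by (simp add: mult.commute)
  then have "\<omega> (j * e) \<le> j" using e_pos by simp
  then show ?thesis using semigroup_ord_mult[OF submonoid e_mem, of j] by (simp add: ord_e)
qed

text \<open>
  The gap in the inequality \<^term>\<open>e * \<omega> s \<le> s\<close>. In the tangent cone it grades the
  nonzero products of monomials a second time, with \<open>x\<^sub>e\<close> in degree \<open>0\<close>.
\<close>

definition defect :: "nat \<Rightarrow> nat" where
  "defect s = s - e * \<omega> s"

lemma ord_defect: "s \<in> T \<Longrightarrow> e * \<omega> s + defect s = s"
  using e_ord_le[of s] by (simp add: defect_def)

lemma defect_eq_0_iff:
  assumes "s \<in> T"
  shows "defect s = 0 \<longleftrightarrow> e dvd s"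
proof
  assume "defect s = 0"
  then have "s = e * \<omega> s" using ord_defect[OF assms] by simp
  then show "e dvd s" by (metis dvd_triv_left)
next
  assume "e dvd s"
  then show "defect s = 0"
    using ord_mult_e[of "s div e"] by (simp add: defect_def)
qed

lemma defect_add:
  assumes "s \<in> T" "t \<in> T" "\<omega> s + \<omega> t = \<omega> (s + t)"
  shows "defect (s + t) = defect s + defect t"
proof -
  have "e * \<omega> (s + t) = e * \<omega> s + e * \<omega> t" using assms(3) by (metis distrib_left)
  then show ?thesis using ord_defect[of s] ord_defect[of t] ord_defect[OF add_mem[of s t]] assms
    by linarith
qed

lemma defect_add_e:
  assumes s: "s \<in> T"
  shows "defect (s + e) \<le> defect s"
    and "\<omega> (s + e) \<noteq> Suc (\<omega> s) \<Longrightarrow> defect (s + e) < defect s"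
proof -
  have "\<omega> s + 1 \<le> \<omega> (s + e)" using ord_add[OF s e_mem] by (simp add: ord_e)
  then have "e * \<omega> s + e \<le> e * \<omega> (s + e)"
    using mult_le_mono2[of "\<omega> s + 1" "\<omega> (s + e)" e] by (simp add: add.commute)
  moreover have "e * \<omega> s + e \<noteq> e * \<omega> (s + e)" if "\<omega> (s + e) \<noteq> Suc (\<omega> s)"
    using that e_pos by (metis mult_Suc_right add.commute mult_cancel1 less_numeral_extra(3))
  ultimately show "defect (s + e) \<le> defect s"
    "\<omega> (s + e) \<noteq> Suc (\<omega> s) \<Longrightarrow> defect (s + e) < defect s"
    using ord_defect[OF s] ord_defect[OF add_mem[OF s e_mem]] by linarith+
qed

lemma defect_add_mult_e:
  assumes s: "s \<in> T"
  shows "defect (s + j * e) \<le> defect s"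
proof (induction j)
  case (Suc j)
  have "defect (s + j * e + e) \<le> defect (s + j * e)"
    by (rule defect_add_e(1)) (intro add_mem s mult_mem e_mem)
  then show ?case using Suc by (simp add: algebra_simps)
qed simp

lemma mod_e_eq_iff: "s \<le> t \<Longrightarrow> s mod e = t mod e \<Longrightarrow> \<exists>j. t = s + j * e"
  by (metis mod_eq_dvd_iff_nat dvd_def le_add_diff_inverse mult.commute)

text \<open>
  Within a residue class modulo \<^term>\<open>e\<close> the defect never increases, so it is bounded by its
  values at the least elements of the classes.
\<close>

lemma defect_bounded: "\<exists>D. \<forall>s\<in>T. defect s \<le> D"
proof -
  define lst where "lst i = (LEAST s. s \<in> T \<and> s mod e = i)" for i
  have "defect s \<le> Max ((\<lambda>i. defect (lst i)) ` {..<e})" if s: "s \<in> T" for s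
  proof -
    let ?s = "lst (s mod e)"
    have l: "?s \<in> T \<and> ?s mod e = s mod e" unfolding lst_def by (rule LeastI[of _ s]) (simp add: s)
    have "?s \<le> s" unfolding lst_def by (rule Least_le) (simp add: s)
    then obtain j where "s = ?s + j * e" using mod_e_eq_iff l by metis
    then have "defect s \<le> defect ?s" using defect_add_mult_e[of ?s j] l by simp
    also have "\<dots> \<le> Max ((\<lambda>i. defect (lst i)) ` {..<e})"
      using e_pos by (intro Max_ge) auto
    finally show ?thesis .
  qed
  then show ?thesis by blast
qed

text \<open>
  At each exceptional element the defect drops strictly, so it separates the exceptional elements
  of one residue class; and it takes finitely many values.
\<close>

lemma finite_ord_jumps: "finite {s \<in> T. \<omega> (s + e) \<noteq> Suc (\<omega> s)}" (is "finite ?B")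
proof -
  obtain D where D: "\<And>s. s \<in> T \<Longrightarrow> defect s \<le> D" using defect_bounded by blast
  have less: "defect t < defect s" if st: "s \<in> ?B" "t \<in> ?B" "s < t" "s mod e = t mod e" for s t
  proof -
    obtain j where j: "t = s + j * e" using mod_e_eq_iff[of s t] st by auto
    then obtain i where "j = Suc i" using st(3) by (cases j) auto
    then have "t = (s + e) + i * e" using j by simp
    then have "defect t \<le> defect (s + e)"
      using defect_add_mult_e[of "s + e" i] st e_mem add_mem by auto
    also have "\<dots> < defect s" using defect_add_e(2) st by auto
    finally show ?thesis .
  qed
  have "inj_on (\<lambda>s. (s mod e, defect s)) ?B"
  proof (rule inj_onI)
    fix s t assume "s \<in> ?B" "t \<in> ?B" "(s mod e, defect s) = (t mod e, defect t)"
    then show "s = t" using less[of s t] less[of t s] by (cases s t rule: linorder_cases) auto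
  qed
  moreover have "(\<lambda>s. (s mod e, defect s)) ` ?B \<subseteq> {..<e} \<times> {..D}"
    using e_pos D by auto
  ultimately show ?thesis by (meson finite_SigmaI finite_atMost finite_lessThan inj_on_finite)
qed

end


section \<open>Rings with coordinates indexed by a numerical semigroup\<close>

text \<open>
  A ring with basis \<open>x\<^sub>s\<close>, \<^term>\<open>s \<in> T\<close>, where \<open>x\<^sub>u x\<^sub>v\<close> is
  \<open>x\<^sub>u\<^sub>+\<^sub>v\<close> or \<open>0\<close> depending on whether the order is additive on
  \<open>(u, v)\<close>. The function \<^term>\<open>cf x\<close> lists the coordinates of \<^term>\<open>x\<close>.
  The ring axioms are consequences of these rules.
\<close>

locale cone_coordinates = numsemi T for T +
  fixes R :: "('a, 'b) ring_scheme" (structure) and cf :: "'a \<Rightarrow> nat \<Rightarrow> 'k::field"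
  assumes cf_inj: "inj_on cf (carrier R)"
    and cf_range: "cf ` carrier R = {c. finite {s. c s \<noteq> 0} \<and> (\<forall>s. c s \<noteq> 0 \<longrightarrow> s \<in> T)}"
    and closed: "x \<in> carrier R \<Longrightarrow> y \<in> carrier R \<Longrightarrow> x \<oplus> y \<in> carrier R"
      "x \<in> carrier R \<Longrightarrow> y \<in> carrier R \<Longrightarrow> x \<otimes> y \<in> carrier R" "\<zero> \<in> carrier R" "\<one> \<in> carrier R"
    and cf_add: "x \<in> carrier R \<Longrightarrow> y \<in> carrier R \<Longrightarrow> cf (x \<oplus> y) s = cf x s + cf y s"
    and cf_mult: "x \<in> carrier R \<Longrightarrow> y \<in> carrier R \<Longrightarrow> cf (x \<otimes> y) s =
      (\<Sum>u=0..s. if \<omega> u + \<omega> (s - u) = \<omega> s then cf x u * cf y (s - u) else 0)"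
    and cf_zero: "cf \<zero> s = 0"
    and cf_one: "cf \<one> s = (if s = 0 then 1 else 0)"
begin

lemma cf_eqI: "x \<in> carrier R \<Longrightarrow> y \<in> carrier R \<Longrightarrow> (\<And>s. cf x s = cf y s) \<Longrightarrow> x = y"
  using inj_onD[OF cf_inj] by blast

lemma cf_mem_T: "x \<in> carrier R \<Longrightarrow> cf x s \<noteq> 0 \<Longrightarrow> s \<in> T"
  using cf_range by blast

lemma cf_finite: "x \<in> carrier R \<Longrightarrow> finite {s. cf x s \<noteq> 0}"
  using cf_range by blast

definition el :: "(nat \<Rightarrow> 'k) \<Rightarrow> 'a" where
  "el c = inv_into (carrier R) cf c"

lemma el:
  assumes "finite {s. c s \<noteq> 0}" "\<And>s. c s \<noteq> 0 \<Longrightarrow> s \<in> T"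
  shows el_closed: "el c \<in> carrier R" and cf_el: "cf (el c) s = c s"
proof -
  have "c \<in> cf ` carrier R" unfolding cf_range using assms by blast
  then show "el c \<in> carrier R" "cf (el c) s = c s"
    unfolding el_def using f_inv_into_f[of c cf "carrier R"] by (auto intro: inv_into_into)
qed

text \<open>
  By superadditivity of the order, the order is additive on \<open>(a, b)\<close> and on
  \<open>(a + b, c)\<close> if and only if it is additive on the triple, and the latter condition is
  symmetric in the two ways of bracketing.
\<close>

lemma mult_assoc_aux:
  assumes "x \<in> carrier R" "y \<in> carrier R" "z \<in> carrier R"
  shows "(x \<otimes> y) \<otimes> z = x \<otimes> (y \<otimes> z)"
proof (rule cf_eqI)
  define F where "F a b c = (if \<omega> a + \<omega> b + \<omega> c = \<omega> (a + b + c) then cf x a * cf y b * cf z c else 0)"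
    for a b c
  have F1: "(if \<omega> (a + b) + \<omega> c = \<omega> (a + b + c)
      then (if \<omega> a + \<omega> b = \<omega> (a + b) then cf x a * cf y b else 0) * cf z c else 0) = F a b c" for a b c
  proof (cases "cf x a \<noteq> 0 \<and> cf y b \<noteq> 0 \<and> cf z c \<noteq> 0")
    case True
    then have "a \<in> T" "b \<in> T" "c \<in> T" using cf_mem_T assms by auto
    then show ?thesis
      using ord_add[of a b] ord_add[of "a + b" c] add_mem[of a b] by (auto simp: F_def)
  qed (auto simp: F_def)
  have F2: "(if \<omega> a + \<omega> (b + c) = \<omega> (a + (b + c))
      then cf x a * (if \<omega> b + \<omega> c = \<omega> (b + c) then cf y b * cf z c else 0) else 0) = F a b c" for a b c
  proof (cases "cf x a \<noteq> 0 \<and> cf y b \<noteq> 0 \<and> cf z c \<noteq> 0")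
    case True
    then have "a \<in> T" "b \<in> T" "c \<in> T" using cf_mem_T assms by auto
    then show ?thesis
      using ord_add[of b c] ord_add[of a "b + c"] add_mem[of b c] by (auto simp: F_def add.assoc)
  qed (auto simp: F_def)
  fix s
  have "cf ((x \<otimes> y) \<otimes> z) s = (\<Sum>j=0..s. \<Sum>i=0..j. F i (j - i) (s - j))"
    unfolding cf_mult[OF closed(2)[OF assms(1,2)] assms(3)]
  proof (rule sum.cong[OF refl])
    fix j assume j: "j \<in> {0..s}"
    have "(\<Sum>i=0..j. F i (j - i) (s - j)) = (\<Sum>i=0..j. if \<omega> j + \<omega> (s - j) = \<omega> s
      then (if \<omega> i + \<omega> (j - i) = \<omega> j then cf x i * cf y (j - i) else 0) * cf z (s - j) else 0)"
      by (rule sum.cong[OF refl], subst F1[symmetric]) (use j in auto)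
    then show "(if \<omega> j + \<omega> (s - j) = \<omega> s then cf (x \<otimes> y) j * cf z (s - j) else 0) =
        (\<Sum>i=0..j. F i (j - i) (s - j))"
      by (simp add: cf_mult assms sum_distrib_right)
  qed
  also have "\<dots> = (\<Sum>j=0..s. \<Sum>i=0..s - j. F j i (s - j - i))"
    by (rule fps_mult_assoc_lemma)
  also have "\<dots> = cf (x \<otimes> (y \<otimes> z)) s"
    unfolding cf_mult[OF assms(1) closed(2)[OF assms(2,3)]]
  proof (rule sum.cong[OF refl])
    fix j assume j: "j \<in> {0..s}"
    have "(\<Sum>i=0..s - j. F j i (s - j - i)) = (\<Sum>i=0..s - j. if \<omega> j + \<omega> (s - j) = \<omega> s
      then cf x j * (if \<omega> i + \<omega> (s - j - i) = \<omega> (s - j) then cf y i * cf z (s - j - i) else 0) else 0)"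
      by (rule sum.cong[OF refl], subst F2[symmetric]) (use j in auto)
    then show "(\<Sum>i=0..s - j. F j i (s - j - i)) =
        (if \<omega> j + \<omega> (s - j) = \<omega> s then cf x j * cf (y \<otimes> z) (s - j) else 0)"
      by (simp add: cf_mult assms sum_distrib_left)
  qed
  finally show "cf ((x \<otimes> y) \<otimes> z) s = cf (x \<otimes> (y \<otimes> z)) s" .
qed (use assms closed in auto)

lemma mult_comm_aux:
  assumes "x \<in> carrier R" "y \<in> carrier R"
  shows "x \<otimes> y = y \<otimes> x"
proof (rule cf_eqI)
  fix s
  have "cf (x \<otimes> y) s = (\<Sum>u=0..s. if \<omega> u + \<omega> (s - u) = \<omega> s then cf x u * cf y (s - u) else 0)"
    using assms by (rule cf_mult)
  also have "\<dots> = (\<Sum>u=0..s. if \<omega> (s - u) + \<omega> u = \<omega> s then cf x (s - u) * cf y u else 0)"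
    by (rule fps_mult_commute_lemma)
  also have "\<dots> = cf (y \<otimes> x) s"
    unfolding cf_mult[OF assms(2,1)] by (intro sum.cong refl) (simp add: ac_simps)
  finally show "cf (x \<otimes> y) s = cf (y \<otimes> x) s" .
qed (use assms closed in auto)

lemma cring_R: "cring R"
proof (rule cringI)
  show "abelian_group R"
  proof (rule abelian_groupI)
    fix x assume x: "x \<in> carrier R"
    have fin: "finite {s. - cf x s \<noteq> 0}" using cf_finite[OF x] by simp
    have T: "s \<in> T" if "- cf x s \<noteq> 0" for s using that cf_mem_T[OF x] by simp
    have "el (\<lambda>s. - cf x s) \<oplus> x = \<zero>"
    proof (rule cf_eqI)
      have c: "el (\<lambda>s. - cf x s) \<in> carrier R" by (rule el_closed[OF fin T])
      show "el (\<lambda>s. - cf x s) \<oplus> x \<in> carrier R" using c x by (rule closed(1))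
      show "cf (el (\<lambda>s. - cf x s) \<oplus> x) s = cf \<zero> s" for s
        using cf_el[OF fin T, of s] by (simp add: cf_add[OF c x] cf_zero)
    qed (rule closed(3))
    then show "\<exists>y\<in>carrier R. y \<oplus> x = \<zero>"
      using el_closed[OF fin T] by (intro bexI[of _ "el (\<lambda>s. - cf x s)"]) auto
  qed (auto intro!: cf_eqI simp: closed cf_add cf_zero ac_simps)
  show "comm_monoid R"
  proof (rule comm_monoidI)
    fix x assume x: "x \<in> carrier R"
    show "\<one> \<otimes> x = x"
    proof (rule cf_eqI)
      fix s
      have "cf (\<one> \<otimes> x) s = (\<Sum>u=0..s. if u = 0 then cf x s else 0)"
        unfolding cf_mult[OF closed(4) x] by (intro sum.cong refl) (auto simp: cf_one)
      then show "cf (\<one> \<otimes> x) s = cf x s" by simp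
    qed (use x closed in auto)
  qed (use closed mult_assoc_aux mult_comm_aux in auto)
  fix x y z assume c: "x \<in> carrier R" "y \<in> carrier R" "z \<in> carrier R"
  have "cf ((x \<oplus> y) \<otimes> z) s = cf (x \<otimes> z \<oplus> y \<otimes> z) s" for s
    unfolding cf_add[OF closed(2)[OF c(1,3)] closed(2)[OF c(2,3)]] cf_mult[OF closed(1)[OF c(1,2)] c(3)]
      cf_mult[OF c(1,3)] cf_mult[OF c(2,3)] sum.distrib[symmetric]
    by (intro sum.cong refl) (simp add: cf_add c distrib_right)
  then show "(x \<oplus> y) \<otimes> z = x \<otimes> z \<oplus> y \<otimes> z"
    by (intro cf_eqI) (auto simp: c closed)
qed

end

sublocale cone_coordinates \<subseteq> cring R by (rule cring_R)

context cone_coordinates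
begin

lemma cf_minus:
  assumes "x \<in> carrier R" "y \<in> carrier R"
  shows "cf (x \<ominus> y) s = cf x s - cf y s"
proof -
  have "cf (\<ominus> y \<oplus> y) s = 0" using assms by (simp add: l_neg cf_zero)
  then have "cf (\<ominus> y) s = - cf y s" using assms by (simp add: cf_add eq_neg_iff_add_eq_0)
  then show ?thesis using assms by (simp add: a_minus_def cf_add)
qed

text \<open>
  The multiple \<^term>\<open>k\<close> of the basis element \<open>x\<^sub>v\<close>. In particular
  \<^term>\<open>X 0 k\<close> is the scalar \<^term>\<open>k\<close>.
\<close>

definition X :: "nat \<Rightarrow> 'k \<Rightarrow> 'a" where
  "X v k = el (\<lambda>u. if u = v then k else 0)"

lemma X_closed [simp]: "v \<in> T \<Longrightarrow> X v k \<in> carrier R"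
  and cf_X: "v \<in> T \<Longrightarrow> cf (X v k) s = (if s = v then k else 0)"
proof -
  have fin: "finite {s. (if s = v then k else 0) \<noteq> 0}"
    by (rule finite_subset[of _ "{v}"]) auto
  show "v \<in> T \<Longrightarrow> X v k \<in> carrier R" unfolding X_def by (rule el_closed[OF fin]) (auto split: if_splits)
  show "v \<in> T \<Longrightarrow> cf (X v k) s = (if s = v then k else 0)"
    unfolding X_def by (rule cf_el[OF fin]) (auto split: if_splits)
qed

lemma cf_X_mult:
  assumes v: "v \<in> T" and x: "x \<in> carrier R"
  shows "cf (X v k \<otimes> x) s = (if v \<le> s \<and> \<omega> v + \<omega> (s - v) = \<omega> s then k * cf x (s - v) else 0)"
proof -
  have "cf (X v k \<otimes> x) s = (\<Sum>u=0..s. if u = v then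
      (if \<omega> v + \<omega> (s - v) = \<omega> s then k * cf x (s - v) else 0) else 0)"
    unfolding cf_mult[OF X_closed[OF v] x] by (intro sum.cong refl) (auto simp: cf_X v)
  then show ?thesis by simp
qed

lemma cf_X0_mult: "x \<in> carrier R \<Longrightarrow> cf (X 0 k \<otimes> x) s = k * cf x s"
  by (simp add: cf_X_mult)


subsection \<open>The ring is noetherian\<close>

definition lead :: "'a \<Rightarrow> nat" where
  "lead x = Max {s. cf x s \<noteq> 0}"

lemma nonzero_support: "x \<in> carrier R \<Longrightarrow> x \<noteq> \<zero> \<Longrightarrow> {s. cf x s \<noteq> 0} \<noteq> {}"
  using cf_eqI[of x \<zero>] by (auto simp: cf_zero)

lemma cf_lead: "x \<in> carrier R \<Longrightarrow> x \<noteq> \<zero> \<Longrightarrow> cf x (lead x) \<noteq> 0"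
  using Max_in[OF cf_finite nonzero_support] unfolding lead_def by blast

lemma le_lead: "x \<in> carrier R \<Longrightarrow> cf x s \<noteq> 0 \<Longrightarrow> s \<le> lead x"
  unfolding lead_def by (rule Max_ge[OF cf_finite]) auto

lemma lead_eqI:
  assumes "x \<in> carrier R" "cf x s \<noteq> 0" "\<And>t. cf x t \<noteq> 0 \<Longrightarrow> t \<le> s"
  shows "lead x = s"
  unfolding lead_def by (rule Max_eqI[OF cf_finite]) (use assms in auto)

lemma lead_mem_T: "x \<in> carrier R \<Longrightarrow> x \<noteq> \<zero> \<Longrightarrow> lead x \<in> T"
  using cf_mem_T cf_lead by blast

text \<open>
  Multiplication by \<open>x\<^sub>e\<close> shifts the exponents of the surviving terms by
  \<^term>\<open>e\<close>; it only matters that the leading term survives.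
\<close>

lemma lead_shift:
  assumes x: "x \<in> carrier R" "x \<noteq> \<zero>" and jump: "\<omega> (lead x + e) = Suc (\<omega> (lead x))"
  shows "X e 1 \<otimes> x \<noteq> \<zero>" "lead (X e 1 \<otimes> x) = lead x + e"
proof -
  have nz: "cf (X e 1 \<otimes> x) (lead x + e) \<noteq> 0"
    using cf_lead[OF x] jump by (simp add: cf_X_mult[OF e_mem x(1)] ord_e)
  then show "X e 1 \<otimes> x \<noteq> \<zero>" by (auto simp: cf_zero)
  show "lead (X e 1 \<otimes> x) = lead x + e"
  proof (rule lead_eqI[OF _ nz])
    show "X e 1 \<otimes> x \<in> carrier R" using x e_mem by simp
    fix t assume "cf (X e 1 \<otimes> x) t \<noteq> 0"
    then have "e \<le> t" "cf x (t - e) \<noteq> 0"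
      by (auto simp: cf_X_mult[OF e_mem x(1)] split: if_splits)
    then show "t \<le> lead x + e" using le_lead[OF x(1), of "t - e"] by linarith
  qed
qed

text \<open>
  The argument is that of leading terms. By finiteness of the set \<^term>\<open>B\<close> of exceptional
  exponents, the set \<^term>\<open>Ld\<close> of leading exponents of an ideal is closed under adding
  \<^term>\<open>e\<close> from some point on. So all but finitely many leading exponents come from smaller
  ones by multiplication with \<open>x\<^sub>e\<close>. One element of the ideal for each of the finitely many
  remaining exponents in \<^term>\<open>G\<close> suffices, as leading terms can be cancelled one after another.
\<close>

lemma noetherian_R: "noetherian_ring R"
proof (rule noetherian_ringI)
  fix I assume I: "ideal I R"
  interpret I: ideal I R by fact
  define B where "B = {s \<in> T. \<omega> (s + e) \<noteq> Suc (\<omega> s)}"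
  define Ld where "Ld = lead ` (I - {\<zero>})"
  define f where "f s = (SOME x. x \<in> I \<and> x \<noteq> \<zero> \<and> lead x = s)" for s
  have f: "f s \<in> I" "f s \<noteq> \<zero>" "lead (f s) = s" if "s \<in> Ld" for s
  proof -
    have "\<exists>x. x \<in> I \<and> x \<noteq> \<zero> \<and> lead x = s" using that unfolding Ld_def by blast
    then have "f s \<in> I \<and> f s \<noteq> \<zero> \<and> lead (f s) = s" unfolding f_def by (rule someI_ex)
    then show "f s \<in> I" "f s \<noteq> \<zero>" "lead (f s) = s" by auto
  qed
  have Ld_T: "s \<in> T" if "s \<in> Ld" for s
    using that lead_mem_T I.Icarr unfolding Ld_def by blast
  have Ld_shift: "s + e \<in> Ld" if "s \<in> Ld" "s \<notin> B" for s
  proof -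
    have fc: "f s \<in> carrier R" using f(1)[OF that(1)] I.Icarr by blast
    have jump: "\<omega> (lead (f s) + e) = Suc (\<omega> (lead (f s)))"
      using that Ld_T[OF that(1)] f(3)[OF that(1)] by (simp add: B_def)
    have "X e 1 \<otimes> f s \<in> I - {\<zero>}"
      using lead_shift(1)[OF fc f(2)[OF that(1)] jump] I.I_l_closed[OF f(1)[OF that(1)]] e_mem by simp
    moreover have "lead (X e 1 \<otimes> f s) = s + e"
      using lead_shift(2)[OF fc f(2)[OF that(1)] jump] f(3)[OF that(1)] by simp
    ultimately show ?thesis unfolding Ld_def by (metis imageI)
  qed
  define G where "G = {s \<in> Ld. \<not> (\<exists>t\<in>Ld - B. s = t + e)}"
  have "finite B" unfolding B_def by (rule finite_ord_jumps)
  then obtain b where "\<forall>s\<in>B. s < b" unfolding finite_nat_set_iff_bounded by (rule exE)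
  then have b: "\<And>s. s \<in> B \<Longrightarrow> s < b" by simp
  have "finite (G \<inter> {b..})"
  proof (rule inj_on_finite)
    show "(\<lambda>s. s mod e) ` (G \<inter> {b..}) \<subseteq> {..<e}" using e_pos by auto
    have no: "\<not> s < t" if s: "s \<in> G" "b \<le> s" and t: "t \<in> G" "s mod e = t mod e" for s t
    proof
      assume lt: "s < t"
      then obtain j where j: "t = s + j * e" using mod_e_eq_iff[of s t] t by auto
      have mem: "s + i * e \<in> Ld - B" for i
      proof (induction i)
        case 0
        then show ?case using s b[of s] unfolding G_def by auto
      next
        case (Suc i)
        then have "s + i * e + e \<in> Ld" using Ld_shift by blast
        moreover have "s + i * e + e \<notin> B" using b[of "s + i * e + e"] s by auto
        ultimately show ?case by (simp add: algebra_simps)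
      qed
      obtain i where "j = Suc i" using lt j by (cases j) auto
      then have "t = (s + i * e) + e" using j by simp
      then show False using t mem unfolding G_def by blast
    qed
    show "inj_on (\<lambda>s. s mod e) (G \<inter> {b..})"
    proof (rule inj_onI)
      fix s t assume st: "s \<in> G \<inter> {b..}" "t \<in> G \<inter> {b..}" "s mod e = t mod e"
      then show "s = t" using no[of s t] no[of t s] by (cases s t rule: linorder_cases) auto
    qed
  qed simp
  moreover have "G \<subseteq> (G \<inter> {b..}) \<union> {..<b}" by auto
  ultimately have finG: "finite G" by (meson finite_UnI finite_lessThan finite_subset)
  let ?F = "f ` G"
  have F: "?F \<subseteq> I" using f unfolding G_def by auto
  then have Fc: "?F \<subseteq> carrier R" using I.a_subset by blast
  interpret J: ideal "Idl ?F" R by (rule genideal_ideal[OF Fc])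
  have J_lead: "\<exists>h\<in>Idl ?F. h \<noteq> \<zero> \<and> lead h = s" if "s \<in> Ld" for s
    using that
  proof (induction s rule: less_induct)
    case (less s)
    show ?case
    proof (cases "s \<in> G")
      case True
      then show ?thesis using f[OF less.prems] genideal_self[OF Fc] by blast
    next
      case False
      then obtain t where t: "t \<in> Ld" "t \<notin> B" "s = t + e" using less.prems unfolding G_def by blast
      then have "t < s" using e_pos by simp
      then obtain h where h: "h \<in> Idl ?F" "h \<noteq> \<zero>" "lead h = t" using less.IH t by blast
      have hc: "h \<in> carrier R" using h J.Icarr by blast
      have jump: "\<omega> (lead h + e) = Suc (\<omega> (lead h))" using t Ld_T h by (simp add: B_def)
      have "X e 1 \<otimes> h \<in> Idl ?F" using J.I_l_closed[OF h(1)] e_mem by simp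
      then show ?thesis using lead_shift[OF hc h(2) jump] h(3) t by blast
    qed
  qed
  have "x \<in> Idl ?F" if "x \<in> I" for x
    using that
  proof (induction "lead x" arbitrary: x rule: less_induct)
    case less
    show ?case
    proof (cases "x = \<zero>")
      case False
      have xc: "x \<in> carrier R" using less.prems I.Icarr by blast
      have "lead x \<in> Ld" using less.prems False unfolding Ld_def by blast
      then obtain h where h: "h \<in> Idl ?F" "h \<noteq> \<zero>" "lead h = lead x" using J_lead by blast
      have hc: "h \<in> carrier R" using h J.Icarr by blast
      have hI: "h \<in> I" using genideal_minimal[OF I F] h by blast
      \<comment> \<open>The scalar that cancels the leading term of \<open>x\<close> against that of \<open>h\<close>.\<close>
      define k where "k = cf x (lead x) / cf h (lead x)"
      define y where "y = x \<ominus> X 0 k \<otimes> h"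
      have Xh: "X 0 k \<otimes> h \<in> carrier R" using hc by simp
      have cf_y: "cf y s = cf x s - k * cf h s" for s
        unfolding y_def by (simp add: cf_minus xc Xh cf_X0_mult hc)
      have yc: "y \<in> carrier R" unfolding y_def using xc Xh by simp
      have yI: "y \<in> I"
        unfolding y_def a_minus_def using less.prems I.I_l_closed[OF hI, of "X 0 k"] by simp
      have "y \<in> Idl ?F"
      proof (cases "y = \<zero>")
        case False
        have "cf h (lead x) \<noteq> 0" using cf_lead[OF hc h(2)] h(3) by simp
        then have "cf y (lead x) = 0" by (simp add: cf_y k_def)
        then have "lead y \<noteq> lead x" using cf_lead[OF yc False] by metis
        moreover have "lead y \<le> lead x"
        proof -
          have "cf x (lead y) \<noteq> 0 \<or> cf h (lead y) \<noteq> 0" using cf_lead[OF yc False] by (auto simp: cf_y)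
          then show ?thesis using le_lead[OF xc] le_lead[OF hc] h(3) by metis
        qed
        ultimately show ?thesis using less.hyps yI by simp
      qed simp
      moreover have "X 0 k \<otimes> h \<in> Idl ?F" using J.I_l_closed[OF h(1)] by simp
      moreover have "x = y \<oplus> X 0 k \<otimes> h"
        unfolding y_def using xc Xh by (simp add: a_minus_def a_assoc l_neg)
      ultimately show ?thesis by simp
    qed simp
  qed
  then have "I = Idl ?F" using genideal_minimal[OF I F] by blast
  then show "\<exists>A\<subseteq>carrier R. finite A \<and> I = Idl A" using Fc finG by blast
qed


subsection \<open>The minimal prime\<close>

text \<open>
  The projection onto the polynomial ring in \<open>x\<^sub>e\<close>: it keeps the coordinates at the
  multiples of \<^term>\<open>e\<close>.
\<close>

definition \<pi> :: "'a \<Rightarrow> 'k poly" where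
  "\<pi> x = Abs_poly (\<lambda>j. cf x (j * e))"

lemma coeff_\<pi>:
  assumes "x \<in> carrier R"
  shows "coeff (\<pi> x) j = cf x (j * e)"
proof -
  have n: "s \<le> Max {s. cf x s \<noteq> 0}" if "cf x s \<noteq> 0" for s
    by (rule Max_ge[OF cf_finite[OF assms]]) (simp add: that)
  have "cf x (i * e) = 0" if "i > Max {s. cf x s \<noteq> 0}" for i
  proof -
    have "i \<le> i * e" using e_pos by simp
    then show ?thesis using n[of "i * e"] that by (meson leD le_trans)
  qed
  then show ?thesis unfolding \<pi>_def by (subst coeff_Abs_poly[of "Max {s. cf x s \<noteq> 0}"]) auto
qed

lemma \<pi>_add: "x \<in> carrier R \<Longrightarrow> y \<in> carrier R \<Longrightarrow> \<pi> (x \<oplus> y) = \<pi> x + \<pi> y"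
  by (rule poly_eqI) (simp add: coeff_\<pi> cf_add)

lemma \<pi>_minus: "x \<in> carrier R \<Longrightarrow> y \<in> carrier R \<Longrightarrow> \<pi> (x \<ominus> y) = \<pi> x - \<pi> y"
  by (rule poly_eqI) (simp add: coeff_\<pi> cf_minus)

lemma \<pi>_zero: "\<pi> \<zero> = 0"
  by (rule poly_eqI) (simp add: coeff_\<pi> cf_zero)

lemma \<pi>_one: "\<pi> \<one> = 1"
  by (rule poly_eqI) (use e_pos in \<open>auto simp: coeff_\<pi> cf_one coeff_1\<close>)

text \<open>
  If the order is additive on \<open>(u, v)\<close>, then so is the defect. As \<^term>\<open>u + v\<close> is a
  multiple of \<^term>\<open>e\<close> precisely if its defect is \<open>0\<close>, only multiples of
  \<^term>\<open>e\<close> contribute to such a coordinate of a product.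
\<close>

lemma \<pi>_mult:
  assumes c: "x \<in> carrier R" "y \<in> carrier R"
  shows "\<pi> (x \<otimes> y) = \<pi> x * \<pi> y"
proof (rule poly_eqI)
  fix j
  let ?h = "\<lambda>u. if \<omega> u + \<omega> (j * e - u) = \<omega> (j * e) then cf x u * cf y (j * e - u) else 0"
  have "coeff (\<pi> (x \<otimes> y)) j = sum ?h {0..j * e}"
    using c by (simp add: coeff_\<pi> cf_mult)
  also have "\<dots> = sum ?h ((\<lambda>i. i * e) ` {..j})"
  proof (rule sum.mono_neutral_right)
    show "(\<lambda>i. i * e) ` {..j} \<subseteq> {0..j * e}" by auto
    show "\<forall>u\<in>{0..j * e} - (\<lambda>i. i * e) ` {..j}. ?h u = 0"
    proof
      fix u assume u: "u \<in> {0..j * e} - (\<lambda>i. i * e) ` {..j}"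
      show "?h u = 0"
      proof (rule ccontr)
        assume "?h u \<noteq> 0"
        then have h: "\<omega> u + \<omega> (j * e - u) = \<omega> (j * e)" "cf x u \<noteq> 0" "cf y (j * e - u) \<noteq> 0"
          by (auto split: if_splits)
        then have T: "u \<in> T" "j * e - u \<in> T" using c cf_mem_T by blast+
        have sum: "u + (j * e - u) = j * e" using u by simp
        have "defect u + defect (j * e - u) = defect (j * e)"
          using defect_add[OF T] h(1) unfolding sum by simp
        also have "\<dots> = 0" using defect_eq_0_iff[of "j * e"] mult_mem[OF e_mem] by simp
        finally have "e dvd u" using defect_eq_0_iff[OF T(1)] by simp
        then obtain i where "u = i * e" by (metis dvd_def mult.commute)
        moreover from this have "i \<le> j" using u e_pos by simp
        ultimately show False using u by blast
      qed
    qed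
  qed simp
  also have "\<dots> = (\<Sum>i\<le>j. ?h (i * e))"
    using e_pos by (subst sum.reindex) (auto simp: inj_on_def)
  also have "\<dots> = (\<Sum>i\<le>j. cf x (i * e) * cf y ((j - i) * e))"
    by (intro sum.cong refl) (auto simp: ord_mult_e diff_mult_distrib[symmetric])
  also have "\<dots> = coeff (\<pi> x * \<pi> y) j"
    using c by (simp add: coeff_mult coeff_\<pi>)
  finally show "coeff (\<pi> (x \<otimes> y)) j = coeff (\<pi> x * \<pi> y) j" .
qed

text \<open>
  A section of \<^term>\<open>\<pi>\<close>: the polynomial evaluated at \<open>x\<^sub>e\<close>.
\<close>

definition lift :: "'k poly \<Rightarrow> 'a" where
  "lift f = el (\<lambda>s. if e dvd s then coeff f (s div e) else 0)"

lemma lift_closed [simp]: "lift f \<in> carrier R"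
  and cf_lift: "cf (lift f) s = (if e dvd s then coeff f (s div e) else 0)"
proof -
  let ?c = "\<lambda>s. if e dvd s then coeff f (s div e) else 0"
  have "{s. ?c s \<noteq> 0} \<subseteq> {..degree f * e}"
  proof
    fix s assume "s \<in> {s. ?c s \<noteq> 0}"
    then have "e dvd s" "s div e \<le> degree f" by (auto split: if_splits intro: le_degree)
    then show "s \<in> {..degree f * e}" by (metis atMost_iff dvd_div_mult_self mult_le_mono1)
  qed
  then have fin: "finite {s. ?c s \<noteq> 0}" by (rule finite_subset) simp
  have T: "s \<in> T" if "?c s \<noteq> 0" for s
    using that mult_mem[OF e_mem, of "s div e"] by (auto split: if_splits)
  show "lift f \<in> carrier R" "cf (lift f) s = ?c s"
    unfolding lift_def using el_closed[OF fin T] cf_el[OF fin T] by auto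
qed

lemma \<pi>_lift: "\<pi> (lift f) = f"
  by (rule poly_eqI) (use e_pos in \<open>auto simp: coeff_\<pi> cf_lift\<close>)

definition N :: "'a set" where
  "N = {x \<in> carrier R. \<pi> x = 0}"

lemma N_prime: "primeideal N R"
proof (rule primeidealI[OF _ is_cring])
  show "ideal N R"
    by (rule ideal_cringI) (auto simp: N_def \<pi>_zero \<pi>_add \<pi>_mult)
  have "\<one> \<notin> N" by (simp add: N_def \<pi>_one)
  then show "carrier R \<noteq> N" using one_closed by blast
  show "a \<in> N \<or> b \<in> N" if "a \<in> carrier R" "b \<in> carrier R" "a \<otimes> b \<in> N" for a b
    using that by (auto simp: N_def \<pi>_mult)
qed

text \<open>
  Each factor from \<^term>\<open>N\<close> contributes at least \<open>1\<close> to the defect, which is bounded.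
  This makes \<^term>\<open>N\<close> nilpotent.
\<close>

lemma N_pow_support:
  assumes "x \<in> N" "cf (x [^] (k::nat)) s \<noteq> 0"
  shows "k \<le> defect s"
  using assms(2)
proof (induction k arbitrary: s)
  case (Suc k)
  have xc: "x \<in> carrier R" using assms(1) by (simp add: N_def)
  have "cf (x [^] k \<otimes> x) s \<noteq> 0" using Suc.prems by simp
  then obtain u where u: "u \<in> {0..s}"
    "(if \<omega> u + \<omega> (s - u) = \<omega> s then cf (x [^] k) u * cf x (s - u) else 0) \<noteq> 0"
    unfolding cf_mult[OF nat_pow_closed[OF xc] xc] by (rule sum.not_neutral_contains_not_neutral)
  then have h: "\<omega> u + \<omega> (s - u) = \<omega> s" "cf (x [^] k) u \<noteq> 0" "cf x (s - u) \<noteq> 0"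
    by (auto split: if_splits)
  have T: "u \<in> T" "s - u \<in> T" using h cf_mem_T xc nat_pow_closed by blast+
  have "\<not> e dvd s - u"
  proof
    assume "e dvd s - u"
    then obtain i where "s - u = i * e" by (metis dvd_def mult.commute)
    then have "cf x (s - u) = coeff (\<pi> x) i" by (simp add: coeff_\<pi> xc)
    then show False using h assms(1) by (simp add: N_def)
  qed
  then have "defect (s - u) > 0" using defect_eq_0_iff[OF T(2)] by simp
  moreover have "u + (s - u) = s" using u by simp
  then have "defect s = defect u + defect (s - u)" using defect_add[OF T] h(1) by simp
  ultimately show ?case using Suc.IH[OF h(2)] by simp
qed simp

lemma N_nilpotent:
  assumes "x \<in> N"
  shows "\<exists>k::nat. x [^] k = \<zero>"
proof -
  have xc: "x \<in> carrier R" using assms by (simp add: N_def)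
  obtain D where D: "\<And>s. s \<in> T \<Longrightarrow> defect s \<le> D" using defect_bounded by blast
  have "x [^] Suc D = \<zero>"
  proof (rule cf_eqI)
    fix s
    show "cf (x [^] Suc D) s = cf \<zero> s"
    proof (rule ccontr)
      assume "cf (x [^] Suc D) s \<noteq> cf \<zero> s"
      then have nz: "cf (x [^] Suc D) s \<noteq> 0" by (simp add: cf_zero)
      then have "s \<in> T" using cf_mem_T xc nat_pow_closed by blast
      then show False using N_pow_support[OF assms nz] D[of s] by simp
    qed
  qed (use xc in auto)
  then show ?thesis by blast
qed

text \<open>
  The homogeneous maximal ideal: the order vanishes at \<open>0\<close> only, so the component of degree
  \<open>0\<close> consists of the scalars.
\<close>

definition irrelevant :: "'a set" where
  "irrelevant = {x \<in> carrier R. cf x 0 = 0}"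

lemma irrelevant_ideal: "ideal irrelevant R"
  by (rule ideal_cringI) (auto simp: irrelevant_def cf_zero cf_add cf_mult)

lemma one_not_irrelevant: "\<one> \<notin> irrelevant"
  by (simp add: irrelevant_def cf_one)

lemma irrelevant_maximal: "maximalideal irrelevant R"
proof (rule maximalidealI[OF irrelevant_ideal])
  show "carrier R \<noteq> irrelevant" using one_not_irrelevant by auto
  fix J assume J: "ideal J R" "irrelevant \<subseteq> J" "J \<subseteq> carrier R"
  interpret J: ideal J R by fact
  show "J = irrelevant \<or> J = carrier R"
  proof (cases "J \<subseteq> irrelevant")
    case False
    then obtain y where y: "y \<in> J" "y \<in> carrier R" "cf y 0 \<noteq> 0"
      using J.Icarr unfolding irrelevant_def by blast
    define w where "w = X 0 (inverse (cf y 0)) \<otimes> y"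
    have w: "w \<in> J" "w \<in> carrier R" unfolding w_def using y J.I_l_closed by auto
    have "cf (\<one> \<ominus> w) 0 = 0" using w(2) y by (simp add: cf_minus cf_one w_def cf_X0_mult)
    then have "\<one> \<ominus> w \<in> J" using w J(2) unfolding irrelevant_def by blast
    then have "(\<one> \<ominus> w) \<oplus> w \<in> J" using w by simp
    moreover have "(\<one> \<ominus> w) \<oplus> w = \<one>" using w by (simp add: a_minus_def a_assoc l_neg)
    ultimately show ?thesis using J.one_imp_carrier by simp
  qed (use J in blast)
qed

text \<open>
  The irrelevant ideal lies strictly between \<^term>\<open>N\<close> and the ring, since it contains
  \<open>x\<^sub>e\<close>.
\<close>

lemma N_not_maximal: "\<not> maximalideal N R"
proof
  assume max: "maximalideal N R"
  have "N \<subseteq> irrelevant"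
  proof
    fix x assume "x \<in> N"
    then have "x \<in> carrier R" "\<pi> x = 0" by (simp_all add: N_def)
    then show "x \<in> irrelevant" using coeff_\<pi>[of x 0] by (simp add: irrelevant_def)
  qed
  moreover have "irrelevant \<subseteq> carrier R" by (auto simp: irrelevant_def)
  ultimately have "irrelevant = N \<or> irrelevant = carrier R"
    by (rule maximalideal.I_maximal[OF max irrelevant_ideal])
  then have "irrelevant = N" using one_not_irrelevant by auto
  moreover have "X e 1 \<in> irrelevant" using e_mem e_pos by (simp add: irrelevant_def cf_X)
  ultimately have "coeff (\<pi> (X e 1)) 1 = 0" by (simp add: N_def)
  then show False using e_mem by (simp add: coeff_\<pi> cf_X)
qed

lemma ideal_\<pi>_cong:
  assumes I: "ideal I R" "N \<subseteq> I" and xy: "x \<in> carrier R" "y \<in> I" "\<pi> x = \<pi> y"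
  shows "x \<in> I"
proof -
  interpret I: ideal I R by fact
  have yc: "y \<in> carrier R" using xy I.Icarr by blast
  have "x \<ominus> y \<in> N" using xy yc by (simp add: N_def \<pi>_minus)
  then have "(x \<ominus> y) \<oplus> y \<in> I" using I xy by auto
  moreover have "(x \<ominus> y) \<oplus> y = x" using xy yc by (simp add: a_minus_def a_assoc l_neg)
  ultimately show ?thesis by simp
qed

text \<open>
  The image of an ideal under \<^term>\<open>\<pi>\<close> is a principal ideal, generated by any nonzero
  element of least degree.
\<close>

lemma ideal_\<pi>_min_degree:
  assumes I: "ideal I R" "\<not> I \<subseteq> N"
  obtains d where "d \<in> I" "d \<in> carrier R" "\<pi> d \<noteq> 0"
    "\<forall>x\<in>I. \<pi> x \<noteq> 0 \<longrightarrow> degree (\<pi> d) \<le> degree (\<pi> x)"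
    "\<forall>x\<in>I. \<pi> d dvd \<pi> x"
proof -
  interpret I: ideal I R by (rule I(1))
  obtain g where "g \<in> I" "\<pi> g \<noteq> 0" using I(2) I.Icarr unfolding N_def by blast
  then obtain d where d: "d \<in> I" "\<pi> d \<noteq> 0"
    and min: "\<And>x. x \<in> I \<Longrightarrow> \<pi> x \<noteq> 0 \<Longrightarrow> degree (\<pi> d) \<le> degree (\<pi> x)"
    using ex_has_least_nat[of "\<lambda>x. x \<in> I \<and> \<pi> x \<noteq> 0" g "\<lambda>x. degree (\<pi> x)"] by blast
  have dc: "d \<in> carrier R" using d I.Icarr by blast
  have "\<pi> d dvd \<pi> x" if x: "x \<in> I" for x
  proof -
    have xc: "x \<in> carrier R" using x I.Icarr by blast
    define r where "r = x \<ominus> lift (\<pi> x div \<pi> d) \<otimes> d"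
    have "r \<in> I" unfolding r_def a_minus_def using x I.I_l_closed[OF d(1)] by simp
    moreover have "\<pi> r = \<pi> x mod \<pi> d"
      unfolding r_def using xc dc by (simp add: \<pi>_minus \<pi>_mult \<pi>_lift minus_div_mult_eq_mod)
    ultimately have "\<pi> x mod \<pi> d = 0"
      using min[of r] degree_mod_less[OF d(2), of "\<pi> x"] by (metis leD)
    then show ?thesis by (simp add: mod_eq_0_iff_dvd)
  qed
  then show thesis using that d dc min by blast
qed

text \<open>
  Nonzero primes of a polynomial ring over a field are maximal. The proof works with the images under
  \<^term>\<open>\<pi>\<close>: let \<^term>\<open>g\<close> generate the image of \<^term>\<open>Q\<close> and
  \<^term>\<open>d\<close> that of a larger ideal \<^term>\<open>J\<close>. In a factorization of \<^term>\<open>g\<close>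
  as \<^term>\<open>d\<close> times \<^term>\<open>w\<close>, the factor \<^term>\<open>d\<close> is not in \<^term>\<open>Q\<close>,
  so \<^term>\<open>w\<close> is, and minimality of the degree of \<^term>\<open>g\<close> makes \<^term>\<open>d\<close> constant.
\<close>

lemma prime_maximal:
  assumes Q: "primeideal Q R" "Q \<noteq> N"
  shows "maximalideal Q R"
proof -
  interpret Q: primeideal Q R by (rule Q(1))
  have NQ: "N \<subseteq> Q"
  proof
    fix x assume x: "x \<in> N"
    then obtain k :: nat where "x [^] k = \<zero>" using N_nilpotent by blast
    then have "x [^] k \<in> Q" by simp
    moreover have "x \<in> carrier R" using x by (simp add: N_def)
    ultimately show "x \<in> Q" by (intro Q.prime_pow_mem[of x k])
  qed
  have nQ: "\<not> Q \<subseteq> N" using NQ Q(2) by blast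
  obtain g where g: "g \<in> Q" "g \<in> carrier R" "\<pi> g \<noteq> 0"
    and gmin: "\<forall>x\<in>Q. \<pi> x \<noteq> 0 \<longrightarrow> degree (\<pi> g) \<le> degree (\<pi> x)"
    and "\<forall>x\<in>Q. \<pi> g dvd \<pi> x"
    by (rule ideal_\<pi>_min_degree[OF Q.is_ideal nQ])
  show ?thesis
  proof (rule maximalidealI[OF Q.is_ideal Q.I_notcarr])
    fix J assume J: "ideal J R" "Q \<subseteq> J" "J \<subseteq> carrier R"
    interpret J: ideal J R by fact
    show "J = Q \<or> J = carrier R"
    proof (cases "J \<subseteq> Q")
      case False
      then obtain h where h: "h \<in> J" "h \<notin> Q" by blast
      have nJ: "\<not> J \<subseteq> N" using J(2) nQ by blast
      obtain d where d: "d \<in> J" "d \<in> carrier R" "\<pi> d \<noteq> 0"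
        and "\<forall>x\<in>J. \<pi> x \<noteq> 0 \<longrightarrow> degree (\<pi> d) \<le> degree (\<pi> x)"
        and dvd: "\<forall>x\<in>J. \<pi> d dvd \<pi> x"
        by (rule ideal_\<pi>_min_degree[OF J(1) nJ])
      obtain w where w: "\<pi> g = \<pi> d * w" using bspec[OF dvd, of g] g(1) J(2) by blast
      obtain v where v: "\<pi> h = \<pi> d * v" using bspec[OF dvd h(1)] by blast
      have "d \<otimes> lift w \<in> Q"
        by (rule ideal_\<pi>_cong[OF Q.is_ideal NQ _ g(1)]) (use d w in \<open>auto simp: \<pi>_mult \<pi>_lift\<close>)
      then have "d \<in> Q \<or> lift w \<in> Q" using Q.I_prime d by simp
      moreover have "d \<notin> Q"
      proof
        assume "d \<in> Q"
        then have "d \<otimes> lift v \<in> Q" using Q.I_r_closed by simp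
        then have "h \<in> Q"
          by (intro ideal_\<pi>_cong[OF Q.is_ideal NQ, of h "d \<otimes> lift v"])
            (use d v h J(3) in \<open>auto simp: \<pi>_mult \<pi>_lift\<close>)
        then show False using h by blast
      qed
      ultimately have "lift w \<in> Q" by blast
      moreover have "w \<noteq> 0" using w g(3) by auto
      ultimately have "degree (\<pi> g) \<le> degree w" using bspec[OF gmin, of "lift w"] by (simp add: \<pi>_lift)
      then have "degree (\<pi> d) = 0" unfolding w using d(3) \<open>w \<noteq> 0\<close> by (simp add: degree_mult_eq)
      then obtain c where c: "\<pi> d = [:c:]" by (metis degree_eq_zeroE)
      then have "c \<noteq> 0" using d(3) by auto
      have "\<one> \<in> J"
      proof (rule ideal_\<pi>_cong[OF J(1)])
        show "N \<subseteq> J" using NQ J(2) by blast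
        show "lift [:inverse c:] \<otimes> d \<in> J" using J.I_l_closed[OF d(1)] by simp
        show "\<pi> \<one> = \<pi> (lift [:inverse c:] \<otimes> d)"
          using d(2) c \<open>c \<noteq> 0\<close> by (simp add: \<pi>_one \<pi>_mult \<pi>_lift one_pCons)
      qed simp
      then show ?thesis using J.one_imp_carrier by simp
    qed (use J in blast)
  qed
qed

sublocale one_dim: one_dimensional_ring R N
  by (rule one_dimensional_ring.intro[OF is_cring one_dimensional_ring_axioms.intro[OF
        noetherian_R N_prime N_not_maximal N_nilpotent prime_maximal]])


subsection \<open>The Cohen-Macaulay property\<close>

lemma ord_add_mult_e:
  assumes "ord_shift_additive T" "s \<in> T"
  shows "\<omega> (s + j * e) = \<omega> s + j"
proof (induction j)
  case (Suc j)
  have "s + j * e \<in> T" using assms(2) add_mem mult_mem[OF e_mem] by blast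
  then have "\<omega> (s + j * e + e) = Suc (\<omega> (s + j * e))"
    using assms(1) unfolding ord_shift_additive_def by blast
  then show ?case using Suc by (simp add: algebra_simps)
qed simp

text \<open>
  The product of the two leading terms does not vanish, because multiplication by powers of
  \<open>x\<^sub>e\<close> is injective.
\<close>

lemma lift_nonzerodivisor:
  assumes A: "ord_shift_additive T" and f: "f \<noteq> 0" and y: "y \<in> carrier R" and 0: "lift f \<otimes> y = \<zero>"
  shows "y = \<zero>"
proof (rule ccontr)
  assume nz: "y \<noteq> \<zero>"
  let ?d = "degree f" and ?s = "lead y"
  have "cf (lift f \<otimes> y) (?s + ?d * e) = (\<Sum>u=0..?s + ?d * e. if u = ?d * e then coeff f ?d * cf y ?s else 0)"
    unfolding cf_mult[OF lift_closed y]
  proof (intro sum.cong refl)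
    fix u assume u: "u \<in> {0..?s + ?d * e}"
    have *: "u = ?d * e" if nz: "cf (lift f) u \<noteq> 0" "cf y (?s + ?d * e - u) \<noteq> 0"
    proof -
      have "e dvd u" "coeff f (u div e) \<noteq> 0" using nz(1) by (auto simp: cf_lift split: if_splits)
      then have "u = u div e * e" "u div e \<le> ?d" by (auto intro: le_degree)
      then have "u \<le> ?d * e" using mult_le_mono1[of "u div e" ?d e] by simp
      moreover have "?s + ?d * e - u \<le> ?s" using le_lead[OF y nz(2)] .
      ultimately show ?thesis by linarith
    qed
    have ord: "\<omega> (?d * e) + \<omega> ?s = \<omega> (?s + ?d * e)"
      using ord_add_mult_e[OF A lead_mem_T[OF y nz]] by (simp add: ord_mult_e)
    show "(if \<omega> u + \<omega> (?s + ?d * e - u) = \<omega> (?s + ?d * e)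
        then cf (lift f) u * cf y (?s + ?d * e - u) else 0) = (if u = ?d * e then coeff f ?d * cf y ?s else 0)"
    proof (cases "u = ?d * e")
      case True
      then show ?thesis using ord e_pos by (simp add: cf_lift)
    next
      case False
      then have "cf (lift f) u * cf y (?s + ?d * e - u) = 0" using * by (metis mult_eq_0_iff)
      then show ?thesis using False by simp
    qed
  qed
  then have "coeff f ?d * cf y ?s = 0" using 0 by (simp add: cf_zero)
  then show False using f cf_lead[OF y nz] by simp
qed

text \<open>
  If \<open>x\<^sub>e\<close> kills \<open>x\<^sub>s\<close>, then so does each polynomial in \<open>x\<^sub>e\<close> without
  constant term.
\<close>

lemma lift_annihilates:
  assumes s: "s \<in> T" "\<omega> (s + e) \<noteq> Suc (\<omega> s)" and f: "coeff f 0 = 0"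
  shows "X s 1 \<otimes> lift f = \<zero>"
proof (rule cf_eqI)
  fix t
  have False if nz: "cf (X s 1 \<otimes> lift f) t \<noteq> 0"
  proof -
    have t: "s \<le> t" "\<omega> s + \<omega> (t - s) = \<omega> t" "cf (lift f) (t - s) \<noteq> 0"
      using nz by (auto simp: cf_X_mult[OF s(1) lift_closed] split: if_splits)
    then obtain i where i: "t - s = i * e" "coeff f i \<noteq> 0"
      using e_pos by (auto simp: cf_lift dvd_def split: if_splits)
    then obtain j where j: "i = Suc j" using f by (cases i) auto
    have "t = (s + e) + j * e" using i(1) j t(1) by simp
    then have "\<omega> (s + e) + j \<le> \<omega> t"
      using ord_add[of "s + e" "j * e"] add_mem[OF s(1) e_mem] mult_mem[OF e_mem] by (simp add: ord_mult_e)
    moreover have "Suc (\<omega> s) \<le> \<omega> (s + e)" using ord_add[OF s(1) e_mem] by (simp add: ord_e)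
    ultimately show False using t(2) i(1) j s(2) ord_mult_e[of i] by simp
  qed
  then show "cf (X s 1 \<otimes> lift f) t = cf \<zero> t" by (auto simp: cf_zero)
qed (use s in auto)

text \<open>
  An element outside the irrelevant ideal has a nonzero constant coordinate, which keeps the lowest
  term of \<^term>\<open>y\<close>. Hence nothing is lost by localizing there.
\<close>

lemma irrelevant_torsion_free:
  assumes u: "u \<in> carrier R - irrelevant" and y: "y \<in> carrier R" and uy: "u \<otimes> y = \<zero>"
  shows "y = \<zero>"
proof (rule ccontr)
  assume nz: "y \<noteq> \<zero>"
  have uc: "u \<in> carrier R" using u by blast
  define s where "s = Min {s. cf y s \<noteq> 0}"
  have s: "cf y s \<noteq> 0" "\<And>t. cf y t \<noteq> 0 \<Longrightarrow> s \<le> t"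
    using Min_in[OF cf_finite nonzero_support, OF y y nz] Min_le[OF cf_finite[OF y]]
    unfolding s_def by auto
  have "cf (u \<otimes> y) s = (\<Sum>v=0..s. if v = 0 then cf u 0 * cf y s else 0)"
    unfolding cf_mult[OF uc y]
  proof (intro sum.cong refl)
    fix v assume "v \<in> {0..s}"
    then have "cf y (s - v) = 0" if "v \<noteq> 0"
      using s(2)[of "s - v"] that by fastforce
    then show "(if \<omega> v + \<omega> (s - v) = \<omega> s then cf u v * cf y (s - v) else 0) =
        (if v = 0 then cf u 0 * cf y s else 0)" by auto
  qed
  then have "cf u 0 * cf y s = 0" using uy by (simp add: cf_zero)
  then show False using s(1) u by (simp add: irrelevant_def)
qed

text \<open>
  Each maximal ideal properly contains \<^term>\<open>N\<close>, and so it contains \<^term>\<open>lift f\<close> for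
  some nonzero \<^term>\<open>f\<close>. If the order is additive under shifts by \<^term>\<open>e\<close>, this
  is a nonzerodivisor. For the converse, take
  a regular element \<^term>\<open>r\<close> of the localization at the irrelevant ideal; up to a nilpotent
  \<open>\<nu>\<close> it is a polynomial in \<open>x\<^sub>e\<close> without constant term. If \<open>x\<^sub>e\<close> killed
  \<open>x\<^sub>s\<close>, then \<^term>\<open>r\<close> would act on the elements \<open>x\<^sub>s \<nu>\<^sup>k\<close> as
  multiplication by \<open>\<nu>\<close>, so none of them could be \<open>0\<close>, although \<open>\<nu>\<close> is nilpotent.
\<close>

theorem cohen_macaulay_R_iff: "cohen_macaulay R \<longleftrightarrow> ord_shift_additive T"
proof
  assume A: "ord_shift_additive T"
  show "cohen_macaulay R"
    unfolding one_dim.cohen_macaulay_iff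
  proof (intro allI impI)
    fix P assume P: "maximalideal P R"
    interpret P: primeideal P R by (rule maximalideal_prime[OF P])
    have NP: "N \<subseteq> P" by (rule one_dim.N_subset_prime[OF P.primeideal_axioms])
    have "P \<noteq> N" using P N_not_maximal by auto
    then obtain g where gP: "g \<in> P" "g \<notin> N" using NP by auto
    then have g: "g \<in> P" "g \<in> carrier R" "\<pi> g \<noteq> 0"
      using P.Icarr[OF gP(1)] by (auto simp: N_def)
    have r: "lift (\<pi> g) \<in> P"
      by (rule ideal_\<pi>_cong[OF P.is_ideal NP _ g(1)]) (auto simp: \<pi>_lift)
    have "u \<otimes> x = \<zero>" if c: "x \<in> carrier R" "u \<in> carrier R" and 0: "u \<otimes> (lift (\<pi> g) \<otimes> x) = \<zero>" for x u
    proof (rule lift_nonzerodivisor[OF A g(3)])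
      show "lift (\<pi> g) \<otimes> (u \<otimes> x) = \<zero>" using c 0 by (simp add: m_lcomm)
    qed (use c in simp)
    note torsion = this
    show "\<exists>r\<in>P. \<forall>x\<in>carrier R.
       (\<exists>u\<in>carrier R - P. u \<otimes> (r \<otimes> x) = \<zero>) \<longrightarrow> (\<exists>u\<in>carrier R - P. u \<otimes> x = \<zero>)"
    proof (intro bexI[OF _ r] ballI impI)
      fix x assume x: "x \<in> carrier R" and "\<exists>u\<in>carrier R - P. u \<otimes> (lift (\<pi> g) \<otimes> x) = \<zero>"
      then obtain u where u: "u \<in> carrier R - P" "u \<otimes> (lift (\<pi> g) \<otimes> x) = \<zero>" by (elim bexE)
      have "u \<in> carrier R" using u(1) by simp
      then have "u \<otimes> x = \<zero>" by (rule torsion[OF x _ u(2)])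
      then show "\<exists>u\<in>carrier R - P. u \<otimes> x = \<zero>" using u(1) by (rule bexI)
    qed
  qed
next
  assume CM: "cohen_macaulay R"
  have "\<exists>r\<in>irrelevant. \<forall>x\<in>carrier R. (\<exists>u\<in>carrier R - irrelevant. u \<otimes> (r \<otimes> x) = \<zero>) \<longrightarrow>
      (\<exists>u\<in>carrier R - irrelevant. u \<otimes> x = \<zero>)"
    using CM irrelevant_maximal unfolding one_dim.cohen_macaulay_iff by (elim allE impE)
  then obtain r where r: "r \<in> irrelevant" and reg: "\<forall>x\<in>carrier R.
      (\<exists>u\<in>carrier R - irrelevant. u \<otimes> (r \<otimes> x) = \<zero>) \<longrightarrow> (\<exists>u\<in>carrier R - irrelevant. u \<otimes> x = \<zero>)"
    by (rule bexE)
  have rc: "r \<in> carrier R" using r by (simp add: irrelevant_def)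
  have reg': "x = \<zero>" if "x \<in> carrier R" "r \<otimes> x = \<zero>" for x
  proof -
    have "\<one> \<otimes> (r \<otimes> x) = \<zero>" "\<one> \<in> carrier R - irrelevant" using that one_not_irrelevant by auto
    then have "\<exists>u\<in>carrier R - irrelevant. u \<otimes> (r \<otimes> x) = \<zero>" by (rule bexI)
    then have "\<exists>u\<in>carrier R - irrelevant. u \<otimes> x = \<zero>"
      by (rule mp[OF bspec[OF reg that(1)]])
    then obtain u where u: "u \<in> carrier R - irrelevant" "u \<otimes> x = \<zero>" by (rule bexE)
    show ?thesis by (rule irrelevant_torsion_free[OF u(1) that(1) u(2)])
  qed
  define \<nu> where "\<nu> = r \<ominus> lift (\<pi> r)"
  have \<nu>N: "\<nu> \<in> N" using rc by (simp add: \<nu>_def N_def \<pi>_minus \<pi>_lift)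
  then have \<nu>c: "\<nu> \<in> carrier R" by (simp add: N_def)
  have r_eq: "r = lift (\<pi> r) \<oplus> \<nu>" unfolding \<nu>_def using rc by (simp add: a_minus_def a_lcomm r_neg)
  have f0: "coeff (\<pi> r) 0 = 0" using r by (simp add: coeff_\<pi> irrelevant_def)
  show "ord_shift_additive T"
    unfolding ord_shift_additive_def
  proof (rule ballI, rule ccontr)
    fix s assume s: "s \<in> T" and jump: "\<omega> (s + e) \<noteq> Suc (\<omega> s)"
    \<comment> \<open>In the induction step \<open>r\<close> times the old element is the new one, because \<open>x\<^sub>s\<close> kills the polynomial part of \<open>r\<close>.\<close>
    have nz: "X s 1 \<otimes> \<nu> [^] k \<noteq> \<zero>" for k :: nat
    proof (induction k)
      case 0
      have "cf (X s 1) s \<noteq> 0" using s by (simp add: cf_X)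
      then have "X s 1 \<noteq> \<zero>" by (auto simp: cf_zero)
      then show ?case using s by simp
    next
      case (Suc k)
      let ?y = "X s 1 \<otimes> \<nu> [^] k"
      have yc: "?y \<in> carrier R" using s \<nu>c by simp
      have "r \<otimes> ?y = lift (\<pi> r) \<otimes> ?y \<oplus> \<nu> \<otimes> ?y"
        using yc \<nu>c by (subst r_eq) (simp add: l_distr)
      also have "lift (\<pi> r) \<otimes> ?y = (X s 1 \<otimes> lift (\<pi> r)) \<otimes> \<nu> [^] k"
        using s \<nu>c by (simp add: m_ac)
      also have "\<dots> = \<zero>" using lift_annihilates[OF s jump f0] \<nu>c by simp
      also have "\<nu> \<otimes> ?y = X s 1 \<otimes> \<nu> [^] Suc k" using s \<nu>c by (simp add: m_ac)
      finally have "r \<otimes> ?y = X s 1 \<otimes> \<nu> [^] Suc k" using s \<nu>c by simp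
      then show ?case using reg'[OF yc] Suc by auto
    qed
    obtain k :: nat where "\<nu> [^] k = \<zero>" using N_nilpotent[OF \<nu>N] by blast
    then show False using nz[of k] s by simp
  qed
qed

end


section \<open>Powers of the maximal ideal of a numerical semigroup ring\<close>

context numsemi
begin

abbreviation SR :: "'k::field fps ring" where
  "SR \<equiv> semigroup_ring T"

text \<open>
  This is going to be the power with exponent \<^term>\<open>n\<close> of the maximal ideal of the
  semigroup ring (\<open>ideal_power_eq\<close>).
\<close>

definition F :: "nat \<Rightarrow> 'k::field fps set" where
  "F n = {f. \<forall>s. fps_nth f s \<noteq> 0 \<longrightarrow> s \<in> fold_sums T n}"

lemma F_I: "(\<And>s. fps_nth f s \<noteq> 0 \<Longrightarrow> s \<in> fold_sums T n) \<Longrightarrow> f \<in> F n"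
  by (auto simp: F_def)

lemma F_D: "f \<in> F n \<Longrightarrow> fps_nth f s \<noteq> 0 \<Longrightarrow> s \<in> fold_sums T n"
  by (auto simp: F_def)

lemma SR_simps [simp]:
  "carrier SR = F 0" "mult SR = (*)" "one SR = 1" "zero SR = 0" "add SR = (+)"
  by (auto simp: semigroup_ring_def F_def fun_eq_iff)

lemma F_antimono: "n \<le> m \<Longrightarrow> F m \<subseteq> F n"
  using fold_sums_antimono[OF submonoid] by (auto simp: F_def)

lemma F_0 [simp]: "0 \<in> F n" and F_1: "1 \<in> F 0"
  by (auto simp: F_def fps_one_nth split: if_splits)

lemma F_add: "f \<in> F n \<Longrightarrow> g \<in> F n \<Longrightarrow> f + g \<in> F n"
  by (rule F_I) (metis F_D add.right_neutral fps_add_nth add_cancel_right_left)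

lemma F_uminus: "f \<in> F n \<Longrightarrow> - f \<in> F n"
  by (auto simp: F_def)

lemma F_diff: "f \<in> F n \<Longrightarrow> g \<in> F n \<Longrightarrow> f - g \<in> F n"
  using F_add[of f n "- g"] F_uminus[of g n] by simp

lemma F_mult:
  assumes "f \<in> F n" "g \<in> F m"
  shows "f * g \<in> F (n + m)"
proof (rule F_I)
  fix s assume "fps_nth (f * g) s \<noteq> 0"
  then obtain i where i: "i \<in> {0..s}" "fps_nth f i * fps_nth g (s - i) \<noteq> 0"
    unfolding fps_mult_nth by (rule sum.not_neutral_contains_not_neutral)
  then have "i \<in> fold_sums T n" "s - i \<in> fold_sums T m" using assms F_D by auto
  then show "s \<in> fold_sums T (n + m)" using fold_sums_add[OF submonoid] i(1) by fastforce
qed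

lemma F_sum: "(\<And>i. i \<in> A \<Longrightarrow> f i \<in> F n) \<Longrightarrow> sum f A \<in> F n"
  by (induction A rule: infinite_finite_induct) (auto intro: F_add)

lemma cring_SR: "cring (SR :: 'k::field fps ring)"
proof (rule cringI)
  show "abelian_group (SR :: 'k fps ring)"
  proof (rule abelian_groupI)
    fix x :: "'k fps" assume "x \<in> carrier SR"
    then show "\<exists>y\<in>carrier SR. y \<oplus>\<^bsub>SR\<^esub> x = \<zero>\<^bsub>SR\<^esub>"
      by (intro bexI[of _ "- x"]) (auto intro: F_uminus)
  qed (auto intro: F_add)
  show "comm_monoid (SR :: 'k fps ring)"
    by (rule comm_monoidI) (use F_mult[of _ 0 _ 0] F_1 in \<open>auto simp: mult.assoc mult.commute\<close>)
qed (auto simp: distrib_right)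

lemma F_ideal: "ideal (F n) SR"
  by (rule cring.ideal_cringI[OF cring_SR])
    (use F_antimono[of 0 n] F_mult[of _ 0 _ n] in \<open>auto intro: F_add\<close>)

text \<open>
  Beyond the conductor one can subtract \<^term>\<open>e\<close>, so the positive elements of \<^term>\<open>T\<close>
  up to a bound do the job.
\<close>

lemma finite_generators:
  obtains A where "finite A" "A \<subseteq> T - {0}"
    "\<And>n s. s \<in> fold_sums T (Suc n) \<Longrightarrow> \<exists>g\<in>A. g \<le> s \<and> s - g \<in> fold_sums T n"
proof -
  have "finite (- T)" using numerical by (simp add: numerical_semigroup_def)
  then obtain c where "\<forall>s\<in>-T. s < c" unfolding finite_nat_set_iff_bounded by (rule exE)
  then have c: "s \<in> T" if "c \<le> s" for s using that by (meson ComplI leD)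
  let ?A = "T \<inter> {1..c + e}"
  show thesis
  proof (rule that[of ?A])
    fix n s assume "s \<in> fold_sums T (Suc n)"
    then obtain x y where xy: "s = x + y" "x \<in> fold_sums T n" "y \<in> T - {0}"
      unfolding fold_sums_Suc[OF submonoid] by blast
    have "\<exists>g\<in>?A. g \<le> y \<and> y - g \<in> T"
    proof (cases "y \<le> c + e")
      case True
      then show ?thesis using xy(3) by (intro bexI[of _ y]) auto
    next
      case False
      then show ?thesis using e_mem e_pos c[of "y - e"] by (intro bexI[of _ e]) auto
    qed
    then obtain g where g: "g \<in> ?A" "g \<le> y" "y - g \<in> T" by blast
    have "x + (y - g) \<in> fold_sums T (n + 0)"
      by (rule fold_sums_add[OF submonoid xy(2)]) (use g in simp)
    moreover have "s - g = x + (y - g)" "g \<le> s" using xy g by auto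
    ultimately show "\<exists>g\<in>?A. g \<le> s \<and> s - g \<in> fold_sums T n" using g(1) by auto
  qed auto
qed

text \<open>
  A power series has infinitely many terms, but ideals are only closed under finite sums. The terms
  are therefore grouped by the finitely many generators of \<^term>\<open>T\<close>: the function
  \<open>\<gamma>\<close> assigns to each exponent one generator that can be split off.
\<close>

lemma F_Suc_decomp:
  fixes f :: "'k::field fps"
  assumes f: "f \<in> F (Suc n)"
  obtains A h where "finite A" "A \<subseteq> T - {0}" "\<forall>g. h g \<in> F n" "f = (\<Sum>g\<in>A. fps_X ^ g * h g)"
proof -
  obtain A where A: "finite A" "A \<subseteq> T - {0}"
    and gen: "\<And>n s. s \<in> fold_sums T (Suc n) \<Longrightarrow> \<exists>g\<in>A. g \<le> s \<and> s - g \<in> fold_sums T n"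
    using finite_generators by blast
  define \<gamma> where "\<gamma> s = (SOME g. g \<in> A \<and> g \<le> s \<and> s - g \<in> fold_sums T n)" for s
  have \<gamma>: "\<gamma> s \<in> A \<and> \<gamma> s \<le> s \<and> s - \<gamma> s \<in> fold_sums T n" if "fps_nth f s \<noteq> 0" for s
  proof -
    have "\<exists>g. g \<in> A \<and> g \<le> s \<and> s - g \<in> fold_sums T n" using gen[OF F_D[OF f that]] by blast
    then show ?thesis unfolding \<gamma>_def by (rule someI_ex)
  qed
  define h where "h g = Abs_fps (\<lambda>u. if \<gamma> (u + g) = g then fps_nth f (u + g) else 0)" for g
  have "\<forall>g. h g \<in> F n"
  proof (intro allI F_I)
    fix g u assume "fps_nth (h g) u \<noteq> 0"
    then have "\<gamma> (u + g) = g" "fps_nth f (u + g) \<noteq> 0" by (auto simp: h_def split: if_splits)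
    then show "u \<in> fold_sums T n" using \<gamma>[of "u + g"] by simp
  qed
  moreover have "f = (\<Sum>g\<in>A. fps_X ^ g * h g)"
  proof (rule fps_ext)
    fix s
    have "fps_nth (\<Sum>g\<in>A. fps_X ^ g * h g) s = (\<Sum>g\<in>A. if g = \<gamma> s then fps_nth f s else 0)"
      unfolding fps_sum_nth
    proof (rule sum.cong[OF refl])
      fix g
      show "fps_nth (fps_X ^ g * h g) s = (if g = \<gamma> s then fps_nth f s else 0)"
        using \<gamma>[of s] by (cases "fps_nth f s = 0") (auto simp: fps_X_power_mult_nth h_def)
    qed
    also have "\<dots> = fps_nth f s"
      using A(1) \<gamma>[of s] by (cases "fps_nth f s = 0") simp_all
    finally show "fps_nth f s = fps_nth (\<Sum>g\<in>A. fps_X ^ g * h g) s" by simp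
  qed
  ultimately show thesis by (rule that[OF A])
qed

lemma X_power_mem:
  assumes "g \<in> T - {0}"
  shows "fps_X ^ g \<in> F (Suc 0)"
proof (rule F_I)
  fix s assume "fps_nth (fps_X ^ g) s \<noteq> 0"
  then have "s = 0 + g" by (auto simp: fps_X_power_nth split: if_splits)
  then show "s \<in> fold_sums T (Suc 0)"
    using assms unfolding fold_sums_Suc[OF submonoid] by fastforce
qed

lemma semigroup_max_ideal_eq: "semigroup_max_ideal T = (F (Suc 0) :: 'k::field fps set)"
proof -
  let ?G = "{fps_X ^ s |s. s \<in> T - {0}} :: 'k fps set"
  interpret SR: cring "SR :: 'k fps ring" by (rule cring_SR)
  have G: "?G \<subseteq> F (Suc 0)" using X_power_mem by blast
  then have G0: "?G \<subseteq> carrier SR" using F_antimono[of 0 "Suc 0"] by auto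
  interpret I: ideal "Idl\<^bsub>SR\<^esub> ?G" "SR :: 'k fps ring" by (rule SR.genideal_ideal[OF G0])
  have "Idl\<^bsub>SR\<^esub> ?G \<subseteq> F (Suc 0)" by (rule SR.genideal_minimal[OF F_ideal G])
  moreover have "f \<in> Idl\<^bsub>SR\<^esub> ?G" if f: "f \<in> F (Suc 0)" for f
  proof -
    obtain A h where A: "finite A" "A \<subseteq> T - {0}" "\<forall>g. h g \<in> F 0" "f = (\<Sum>g\<in>A. fps_X ^ g * h g)"
      by (rule F_Suc_decomp[OF f])
    have "(\<Sum>g\<in>A. fps_X ^ g * h g) \<in> Idl\<^bsub>SR\<^esub> ?G"
      using A(1,2)
    proof (induction A)
      case empty
      then show ?case using I.zero_closed by simp
    next
      case (insert g A)
      have "fps_X ^ g \<in> Idl\<^bsub>SR\<^esub> ?G" using SR.genideal_self[OF G0] insert.prems by blast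
      then have "fps_X ^ g * h g \<in> Idl\<^bsub>SR\<^esub> ?G" using I.I_r_closed[of "fps_X ^ g" "h g"] A(3) by simp
      then show ?case
        using insert I.a_closed[of "fps_X ^ g * h g" "\<Sum>g\<in>A. fps_X ^ g * h g"] by simp
    qed
    then show ?thesis using A(4) by simp
  qed
  ultimately show ?thesis unfolding semigroup_max_ideal_def by blast
qed

lemma ideal_prod_F: "ideal_prod SR (F n) (F (Suc 0)) = (F (Suc n) :: 'k::field fps set)"
proof
  show "ideal_prod SR (F n) (F (Suc 0)) \<subseteq> (F (Suc n) :: 'k fps set)"
  proof
    fix f :: "'k fps" assume "f \<in> ideal_prod SR (F n) (F (Suc 0))"
    then show "f \<in> F (Suc n)"
    proof induction
      case (prod i j)
      then show ?case using F_mult[of i n j "Suc 0"] by simp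
    qed (auto intro: F_add)
  qed
  show "(F (Suc n) :: 'k fps set) \<subseteq> ideal_prod SR (F n) (F (Suc 0))"
  proof
    fix f :: "'k fps" assume f: "f \<in> F (Suc n)"
    obtain A h where A: "finite A" "A \<subseteq> T - {0}" "\<forall>g. h g \<in> F n" "f = (\<Sum>g\<in>A. fps_X ^ g * h g)"
      by (rule F_Suc_decomp[OF f])
    have "(\<Sum>g\<in>A. fps_X ^ g * h g) \<in> ideal_prod SR (F n) (F (Suc 0))"
      using A(1,2)
    proof (induction A)
      case empty
      then show ?case using ideal_prod.prod[of 0 "F n" 0 "F (Suc 0)" SR] by simp
    next
      case (insert g A)
      have "fps_X ^ g \<in> F (Suc 0)" using X_power_mem insert.prems by blast
      then have "h g \<otimes>\<^bsub>SR\<^esub> fps_X ^ g \<in> ideal_prod SR (F n) (F (Suc 0))"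
        by (rule ideal_prod.prod[OF spec[OF A(3)]])
      then show ?case
        using insert ideal_prod.sum[of "h g * fps_X ^ g" SR "F n" "F (Suc 0)" "\<Sum>g\<in>A. fps_X ^ g * h g"]
        by (simp add: mult.commute)
    qed
    then show "f \<in> ideal_prod SR (F n) (F (Suc 0))" using A(4) by simp
  qed
qed

lemma ideal_power_eq: "ideal_power SR (semigroup_max_ideal T) n = (F n :: 'k::field fps set)"
proof (induction n)
  case 0
  show ?case by (simp add: nat_pow_def ideals_set_def)
next
  case (Suc n)
  have "ideal_power SR (semigroup_max_ideal T) (Suc n) =
      ideal_prod SR (ideal_power SR (semigroup_max_ideal T) n) (semigroup_max_ideal T :: 'k fps set)"
    by (simp add: nat_pow_def ideals_set_def)
  then show ?case unfolding Suc unfolding semigroup_max_ideal_eq by (simp add: ideal_prod_F)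
qed


section \<open>Coordinates on the tangent cone\<close>

text \<open>
  The coset of \<^term>\<open>a\<close> in the component of degree \<^term>\<open>n\<close> of the tangent cone.
\<close>

definition cls :: "nat \<Rightarrow> 'k::field fps \<Rightarrow> 'k fps set" where
  "cls n a = F (Suc n) +>\<^bsub>SR\<^esub> a"

lemma cls_eq: "cls n a = {f. f - a \<in> F (Suc n)}"
proof -
  have "f \<in> (\<Union>h\<in>F (Suc n). {h + a}) \<longleftrightarrow> f - a \<in> F (Suc n)" for f
  proof
    show "f - a \<in> F (Suc n) \<Longrightarrow> f \<in> (\<Union>h\<in>F (Suc n). {h + a})"
      by (rule UN_I[of "f - a"]) auto
  qed auto
  then show ?thesis unfolding cls_def a_r_coset_def' by auto
qed

lemma cls_eq_iff: "cls n a = cls n b \<longleftrightarrow> a - b \<in> F (Suc n)"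
proof
  assume "cls n a = cls n b"
  moreover have "a \<in> cls n a" by (simp add: cls_eq)
  ultimately show "a - b \<in> F (Suc n)" by (simp add: cls_eq)
next
  assume ab: "a - b \<in> F (Suc n)"
  have "f - a \<in> F (Suc n) \<longleftrightarrow> f - b \<in> F (Suc n)" for f
    using F_add[OF _ ab, of "f - a"] F_diff[OF _ ab, of "f - b"] by auto
  then show "cls n a = cls n b" by (simp add: cls_eq)
qed

lemma zero_Quot: "\<zero>\<^bsub>SR Quot F (Suc n)\<^esub> = cls n 0"
  by (auto simp: FactRing_def cls_eq)

lemma one_Quot: "\<one>\<^bsub>SR Quot F (Suc n)\<^esub> = cls n 1"
  by (simp add: FactRing_def cls_def)

lemma add_Quot:
  assumes "a \<in> F 0" "b \<in> F 0"
  shows "cls n a \<oplus>\<^bsub>SR Quot F (Suc n)\<^esub> cls n b = cls n (a + b)"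
  using ideal.a_rcos_sum[OF F_ideal, of a b "Suc n"] assms by (simp add: FactRing_def cls_def)

text \<open>
  The factors are cosets of different ideals. Changing \<^term>\<open>a\<close> or \<^term>\<open>b\<close> within its
  coset changes the product by an element of \<^term>\<open>F (Suc n)\<close>.
\<close>

lemma rcoset_mult_cls:
  assumes a: "a \<in> F i" and b: "b \<in> F j" and n: "i + j = n"
  shows "rcoset_mult SR (F (Suc n)) (cls i a) (cls j b) = cls n (a * b)"
proof -
  have "F (Suc n) +>\<^bsub>SR\<^esub> (\<alpha> \<otimes>\<^bsub>SR\<^esub> \<beta>) = cls n (a * b)" if \<alpha>: "\<alpha> \<in> cls i a" and \<beta>: "\<beta> \<in> cls j b" for \<alpha> \<beta>
  proof -
    have ab: "\<alpha> - a \<in> F (Suc i)" "\<beta> - b \<in> F (Suc j)" using \<alpha> \<beta> by (auto simp: cls_eq)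
    have "(\<beta> - b) + b \<in> F j" using ab(2) b F_antimono[of j "Suc j"] by (intro F_add) auto
    then have "(\<alpha> - a) * \<beta> \<in> F (Suc i + j)" using F_mult[OF ab(1), of \<beta> j] by simp
    moreover have "a * (\<beta> - b) \<in> F (i + Suc j)" by (rule F_mult[OF a ab(2)])
    ultimately have "(\<alpha> - a) * \<beta> + a * (\<beta> - b) \<in> F (Suc n)" using n by (intro F_add) auto
    moreover have "(\<alpha> - a) * \<beta> + a * (\<beta> - b) = \<alpha> * \<beta> - a * b" by (simp add: algebra_simps)
    ultimately have "cls n (\<alpha> * \<beta>) = cls n (a * b)" by (simp add: cls_eq_iff)
    then show ?thesis by (simp add: cls_def)
  qed
  moreover have "a \<in> cls i a" "b \<in> cls j b" by (simp_all add: cls_eq)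
  ultimately show ?thesis unfolding rcoset_mult_def by blast
qed

lemma cls_Quot_closed: "a \<in> F 0 \<Longrightarrow> cls n a \<in> carrier (SR Quot F (Suc n))"
  unfolding FactRing_simps cls_def by auto

lemma finsum_cls:
  assumes "finite A" "\<And>i. i \<in> A \<Longrightarrow> c i \<in> F 0"
  shows "finsum (SR Quot F (Suc n)) (\<lambda>i. cls n (c i)) A = cls n (\<Sum>i\<in>A. c i)"
  using assms
proof (induction A)
  case empty
  interpret Q: ring "SR Quot F (Suc n)" by (rule ideal.quotient_is_ring[OF F_ideal])
  show ?case by (simp add: zero_Quot)
next
  case (insert i A)
  interpret Q: ring "SR Quot F (Suc n)" by (rule ideal.quotient_is_ring[OF F_ideal])
  have "finsum (SR Quot F (Suc n)) (\<lambda>i. cls n (c i)) (insert i A) =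
      cls n (c i) \<oplus>\<^bsub>SR Quot F (Suc n)\<^esub> finsum (SR Quot F (Suc n)) (\<lambda>i. cls n (c i)) A"
    using insert.prems by (intro Q.finsum_insert insert.hyps) (auto intro: cls_Quot_closed)
  also have "\<dots> = cls n (c i) \<oplus>\<^bsub>SR Quot F (Suc n)\<^esub> cls n (\<Sum>i\<in>A. c i)"
    using insert.IH insert.prems by simp
  also have "\<dots> = cls n (c i + (\<Sum>i\<in>A. c i))"
    using insert.prems by (intro add_Quot F_sum) auto
  finally show ?case using insert.hyps by simp
qed

abbreviation TC :: "(nat \<Rightarrow> 'k::field fps set) ring" where
  "TC \<equiv> tangent_cone TYPE('k) T"

lemma TC_carrier: "g \<in> carrier (TC :: (nat \<Rightarrow> 'k::field fps set) ring) \<longleftrightarrow>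
    (\<forall>n. \<exists>a\<in>F n. g n = cls n a) \<and> finite {n. g n \<noteq> cls n 0}"
  and TC_zero: "\<zero>\<^bsub>TC\<^esub> = (\<lambda>n. cls n (0 :: 'k fps))"
  and TC_one: "\<one>\<^bsub>TC\<^esub> = (\<lambda>n. cls n (if n = 0 then 1 else 0 :: 'k fps))"
  and TC_add: "g \<oplus>\<^bsub>TC\<^esub> h = (\<lambda>n. g n \<oplus>\<^bsub>SR Quot F (Suc n)\<^esub> (h n :: 'k fps set))"
  and TC_mult: "g \<otimes>\<^bsub>TC\<^esub> h = (\<lambda>n. finsum (SR Quot F (Suc n))
      (\<lambda>i. rcoset_mult SR (F (Suc n)) (g i) (h (n - i) :: 'k fps set)) {..n})"
  unfolding tangent_cone_def assoc_graded_def ideal_power_eq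
  by (auto simp: zero_Quot one_Quot cls_def[symmetric] fun_eq_iff)

text \<open>
  A coset in degree \<^term>\<open>n\<close> has exactly one representative whose support consists of
  elements of order \<^term>\<open>n\<close>, and \<^term>\<open>rep\<close> builds it from the coordinates.
\<close>

definition rep :: "nat \<Rightarrow> (nat \<Rightarrow> 'k) \<Rightarrow> 'k::field fps" where
  "rep n c = Abs_fps (\<lambda>s. if s \<in> T \<and> \<omega> s = n then c s else 0)"

text \<open>
  All members of a coset in degree \<^term>\<open>\<omega> s\<close> have the same coefficient at
  \<^term>\<open>s\<close> (see \<open>coord_eq\<close>), so the choice does not matter.
\<close>

definition coord :: "(nat \<Rightarrow> 'k fps set) \<Rightarrow> nat \<Rightarrow> 'k::field" where
  "coord g s = (if s \<in> T then fps_nth (SOME f. f \<in> g (\<omega> s)) s else 0)"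

lemma rep_mem: "rep n c \<in> F n"
  using mem_fold_sums_iff[OF submonoid] by (auto simp: F_def rep_def split: if_splits)

lemma coord_eq:
  assumes "s \<in> T" "g (\<omega> s) = cls (\<omega> s) a"
  shows "coord g s = fps_nth a s"
proof -
  define f where "f = (SOME f. f \<in> g (\<omega> s))"
  have "a \<in> g (\<omega> s)" by (simp add: assms cls_eq)
  then have "f \<in> g (\<omega> s)" unfolding f_def by (rule someI)
  then have "f - a \<in> F (Suc (\<omega> s))" by (simp add: assms cls_eq)
  moreover have "s \<notin> fold_sums T (Suc (\<omega> s))" using mem_fold_sums_iff[OF submonoid assms(1)] by simp
  ultimately have "fps_nth (f - a) s = 0" using F_D by blast
  then show ?thesis using assms(1) by (simp add: coord_def f_def)
qed

lemma coord_outside: "s \<notin> T \<Longrightarrow> coord g s = 0"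
  by (simp add: coord_def)

lemma component_eq:
  fixes g :: "nat \<Rightarrow> 'k::field fps set"
  assumes "g \<in> carrier TC"
  shows "g n = cls n (rep n (coord g))"
proof -
  obtain a where a: "a \<in> F n" "g n = cls n a" using assms TC_carrier by blast
  have "a - rep n (coord g) \<in> F (Suc n)"
  proof (rule F_I)
    fix s assume nz: "fps_nth (a - rep n (coord g)) s \<noteq> 0"
    show "s \<in> fold_sums T (Suc n)"
    proof (cases "s \<in> T \<and> \<omega> s = n")
      case True
      then show ?thesis using nz coord_eq[of s g a] a(2) by (auto simp: rep_def)
    next
      case False
      then have "fps_nth a s \<noteq> 0" using nz by (auto simp: rep_def)
      then have "s \<in> fold_sums T n" using F_D[OF a(1)] by blast
      moreover from this have "s \<in> T" using fold_sums_subset[OF submonoid] by blast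
      ultimately show ?thesis using False mem_fold_sums_iff[OF submonoid \<open>s \<in> T\<close>] by auto
    qed
  qed
  then show ?thesis unfolding a(2) cls_eq_iff .
qed

lemma rep_0: "(\<And>s. s \<in> T \<Longrightarrow> \<omega> s = n \<Longrightarrow> c s = 0) \<Longrightarrow> rep n c = 0"
  by (rule fps_ext) (simp add: rep_def)

lemma finite_ord_level: "finite {s \<in> T. \<omega> s = n}"
proof -
  obtain D where D: "\<And>s. s \<in> T \<Longrightarrow> defect s \<le> D" using defect_bounded by blast
  have "{s \<in> T. \<omega> s = n} \<subseteq> {..e * n + D}"
  proof
    fix s assume "s \<in> {s \<in> T. \<omega> s = n}"
    then show "s \<in> {..e * n + D}" using ord_defect[of s] D[of s] by auto
  qed
  then show ?thesis by (rule finite_subset) simp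
qed

lemma coord_finite:
  fixes g :: "nat \<Rightarrow> 'k::field fps set"
  assumes "g \<in> carrier TC"
  shows "finite {s. coord g s \<noteq> 0}"
proof -
  have "{s. coord g s \<noteq> 0} \<subseteq> (\<Union>n\<in>{n. g n \<noteq> cls n 0}. {s \<in> T. \<omega> s = n})"
  proof
    fix s assume "s \<in> {s. coord g s \<noteq> 0}"
    then have s: "s \<in> T" "coord g s \<noteq> 0" using coord_outside by auto
    then have "g (\<omega> s) \<noteq> cls (\<omega> s) 0" using coord_eq[of s g 0] by auto
    then show "s \<in> (\<Union>n\<in>{n. g n \<noteq> cls n 0}. {s \<in> T. \<omega> s = n})" using s by blast
  qed
  moreover have "finite {n. g n \<noteq> cls n 0}" using assms TC_carrier by blast
  ultimately show ?thesis using finite_ord_level by (meson finite_UN_I finite_subset)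
qed

lemma TC_mult_component:
  fixes g h :: "nat \<Rightarrow> 'k::field fps set"
  assumes "g \<in> carrier TC" "h \<in> carrier TC"
  shows "(g \<otimes>\<^bsub>TC\<^esub> h) n = cls n (\<Sum>i\<le>n. rep i (coord g) * rep (n - i) (coord h))"
proof -
  have F0: "rep i c * rep j c' \<in> F 0" for i j and c c' :: "nat \<Rightarrow> 'k"
    using F_mult[OF rep_mem rep_mem] F_antimono by blast
  have "(g \<otimes>\<^bsub>TC\<^esub> h) n = finsum (SR Quot F (Suc n))
      (\<lambda>i. cls n (rep i (coord g) * rep (n - i) (coord h))) {..n}"
    unfolding TC_mult
  proof (rule abelian_monoid.finsum_cong')
    interpret Q: ring "SR Quot F (Suc n) :: 'k fps set ring" by (rule ideal.quotient_is_ring[OF F_ideal])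
    show "abelian_monoid (SR Quot F (Suc n) :: 'k fps set ring)" by (rule Q.abelian_monoid_axioms)
    fix i assume "i \<in> {..n}"
    then show "rcoset_mult SR (F (Suc n)) (g i) (h (n - i)) =
        cls n (rep i (coord g) * rep (n - i) (coord h))"
      unfolding component_eq[OF assms(1), of i] component_eq[OF assms(2), of "n - i"]
      by (intro rcoset_mult_cls rep_mem) simp
  qed (auto intro: cls_Quot_closed F0)
  also have "\<dots> = cls n (\<Sum>i\<le>n. rep i (coord g) * rep (n - i) (coord h))"
    by (rule finsum_cls) (auto intro: F0)
  finally show ?thesis .
qed

lemma TC_add_component:
  fixes g h :: "nat \<Rightarrow> 'k::field fps set"
  assumes "g \<in> carrier TC" "h \<in> carrier TC"
  shows "(g \<oplus>\<^bsub>TC\<^esub> h) n = cls n (rep n (coord g) + rep n (coord h))"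
  unfolding TC_add component_eq[OF assms(1), of n] component_eq[OF assms(2), of n]
  by (intro add_Quot subsetD[OF F_antimono rep_mem]) simp_all

lemma component_zero:
  fixes g :: "nat \<Rightarrow> 'k::field fps set"
  assumes "g \<in> carrier TC" "n \<notin> \<omega> ` {s. coord g s \<noteq> 0}"
  shows "rep n (coord g) = 0"
  by (rule rep_0) (use assms(2) in blast)

lemma TC_add_closed:
  fixes g h :: "nat \<Rightarrow> 'k::field fps set"
  assumes "g \<in> carrier TC" "h \<in> carrier TC"
  shows "g \<oplus>\<^bsub>TC\<^esub> h \<in> carrier TC"
  unfolding TC_carrier
proof (intro conjI allI)
  show "\<exists>a\<in>F n. (g \<oplus>\<^bsub>TC\<^esub> h) n = cls n a" for n
    using TC_add_component[OF assms] F_add[OF rep_mem rep_mem] by blast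
  have "{n. (g \<oplus>\<^bsub>TC\<^esub> h) n \<noteq> cls n 0} \<subseteq>
      \<omega> ` {s. coord g s \<noteq> 0} \<union> \<omega> ` {s. coord h s \<noteq> 0}"
    using component_zero[OF assms(1)] component_zero[OF assms(2)] TC_add_component[OF assms]
    by fastforce
  then show "finite {n. (g \<oplus>\<^bsub>TC\<^esub> h) n \<noteq> cls n 0}"
    by (rule finite_subset) (use coord_finite assms in auto)
qed

lemma TC_mult_closed:
  fixes g h :: "nat \<Rightarrow> 'k::field fps set"
  assumes "g \<in> carrier TC" "h \<in> carrier TC"
  shows "g \<otimes>\<^bsub>TC\<^esub> h \<in> carrier TC"
  unfolding TC_carrier
proof (intro conjI allI)
  show "\<exists>a\<in>F n. (g \<otimes>\<^bsub>TC\<^esub> h) n = cls n a" for n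
  proof -
    have "(\<Sum>i\<le>n. rep i (coord g) * rep (n - i) (coord h)) \<in> F n"
    proof (rule F_sum)
      fix i assume "i \<in> {..n}"
      then show "rep i (coord g) * rep (n - i) (coord h) \<in> F n"
        using F_mult[OF rep_mem rep_mem, of i "coord g" "n - i" "coord h"] by simp
    qed
    then show ?thesis using TC_mult_component[OF assms] by blast
  qed
  let ?A = "\<omega> ` {s. coord g s \<noteq> 0}" and ?B = "\<omega> ` {s. coord h s \<noteq> 0}"
  have "{n. (g \<otimes>\<^bsub>TC\<^esub> h) n \<noteq> cls n 0} \<subseteq> (\<lambda>(i, j). i + j) ` (?A \<times> ?B)"
  proof
    fix n assume n: "n \<in> {n. (g \<otimes>\<^bsub>TC\<^esub> h) n \<noteq> cls n 0}"
    have "(\<Sum>i\<le>n. rep i (coord g) * rep (n - i) (coord h)) \<noteq> 0"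
    proof
      assume "(\<Sum>i\<le>n. rep i (coord g) * rep (n - i) (coord h)) = 0"
      then have "(g \<otimes>\<^bsub>TC\<^esub> h) n = cls n 0" by (simp only: TC_mult_component[OF assms])
      then show False using n by (simp only: mem_Collect_eq)
    qed
    then obtain i where i: "i \<in> {..n}" "rep i (coord g) * rep (n - i) (coord h) \<noteq> 0"
      by (rule sum.not_neutral_contains_not_neutral)
    then have "i \<in> ?A" "n - i \<in> ?B"
      using component_zero[OF assms(1), of i] component_zero[OF assms(2), of "n - i"] by auto
    moreover have "n = (\<lambda>(i, j). i + j) (i, n - i)" using i(1) by simp
    ultimately show "n \<in> (\<lambda>(i, j). i + j) ` (?A \<times> ?B)" by blast
  qed
  then show "finite {n. (g \<otimes>\<^bsub>TC\<^esub> h) n \<noteq> cls n 0}"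
    by (rule finite_subset) (use coord_finite assms in auto)
qed

lemma TC_zero_closed: "\<zero>\<^bsub>TC\<^esub> \<in> carrier (TC :: (nat \<Rightarrow> 'k::field fps set) ring)"
  unfolding TC_carrier TC_zero by auto

lemma TC_one_closed: "\<one>\<^bsub>TC\<^esub> \<in> carrier (TC :: (nat \<Rightarrow> 'k::field fps set) ring)"
proof -
  have "{n. cls n (if n = 0 then 1 else 0 :: 'k fps) \<noteq> cls n 0} \<subseteq> {0}" by auto
  then have "finite {n. cls n (if n = 0 then 1 else 0 :: 'k fps) \<noteq> cls n 0}"
    by (rule finite_subset) simp
  then show ?thesis unfolding TC_carrier TC_one by (auto intro: F_1)
qed

text \<open>
  A pair of exponents \<open>(u, s - u)\<close> occurs in the product of the components of degrees
  \<open>i\<close> and \<open>\<omega> s - i\<close> for exactly one \<open>i\<close>, namely the order of \<open>u\<close>,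
  and for no \<open>i\<close> at all unless the orders add up to \<open>\<omega> s\<close>.
\<close>

lemma coord_mult:
  fixes g h :: "nat \<Rightarrow> 'k::field fps set"
  assumes "g \<in> carrier TC" "h \<in> carrier TC"
  shows "coord (g \<otimes>\<^bsub>TC\<^esub> h) s =
    (\<Sum>u=0..s. if \<omega> u + \<omega> (s - u) = \<omega> s then coord g u * coord h (s - u) else 0)"
proof (cases "s \<in> T")
  case True
  let ?n = "\<omega> s"
  have "coord (g \<otimes>\<^bsub>TC\<^esub> h) s = fps_nth (\<Sum>i\<le>?n. rep i (coord g) * rep (?n - i) (coord h)) s"
    by (rule coord_eq[where g = "g \<otimes>\<^bsub>TC\<^esub> h", OF True TC_mult_component[OF assms]])
  also have "\<dots> = (\<Sum>i\<le>?n. \<Sum>u=0..s. fps_nth (rep i (coord g)) u * fps_nth (rep (?n - i) (coord h)) (s - u))"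
    by (simp add: fps_sum_nth fps_mult_nth)
  also have "\<dots> = (\<Sum>u=0..s. \<Sum>i\<le>?n. fps_nth (rep i (coord g)) u * fps_nth (rep (?n - i) (coord h)) (s - u))"
    by (rule sum.swap)
  also have "\<dots> = (\<Sum>u=0..s. if \<omega> u + \<omega> (s - u) = ?n then coord g u * coord h (s - u) else 0)"
  proof (rule sum.cong[OF refl])
    fix u
    have "(\<Sum>i\<le>?n. fps_nth (rep i (coord g)) u * fps_nth (rep (?n - i) (coord h)) (s - u)) =
        (\<Sum>i\<le>?n. if i = \<omega> u then (if \<omega> u + \<omega> (s - u) = ?n then coord g u * coord h (s - u) else 0) else 0)"
    proof (rule sum.cong[OF refl])
      fix i assume "i \<in> {..?n}"
      then show "fps_nth (rep i (coord g)) u * fps_nth (rep (?n - i) (coord h)) (s - u) =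
          (if i = \<omega> u then (if \<omega> u + \<omega> (s - u) = ?n then coord g u * coord h (s - u) else 0) else 0)"
        using coord_outside[of u g] coord_outside[of "s - u" h] by (auto simp: rep_def)
    qed
    also have "\<dots> = (if \<omega> u + \<omega> (s - u) = ?n then coord g u * coord h (s - u) else 0)"
      by auto
    finally show "(\<Sum>i\<le>?n. fps_nth (rep i (coord g)) u * fps_nth (rep (?n - i) (coord h)) (s - u)) =
        (if \<omega> u + \<omega> (s - u) = ?n then coord g u * coord h (s - u) else 0)" .
  qed
  finally show ?thesis .
next
  case False
  have "coord g u * coord h (s - u) = 0" if "u \<in> {0..s}" for u
    using that False add_mem[of u "s - u"] coord_outside[of u g] coord_outside[of "s - u" h] by fastforce
  then have "(\<Sum>u=0..s. if \<omega> u + \<omega> (s - u) = \<omega> s then coord g u * coord h (s - u) else 0) = 0"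
    by (intro sum.neutral) simp
  then show ?thesis using coord_outside[OF False] by simp
qed

lemma coord_range:
  "coord ` carrier (TC :: (nat \<Rightarrow> 'k::field fps set) ring) =
    {c. finite {s. c s \<noteq> 0} \<and> (\<forall>s. c s \<noteq> 0 \<longrightarrow> s \<in> T)}"
proof (intro equalityI subsetI)
  fix c :: "nat \<Rightarrow> 'k" assume "c \<in> coord ` carrier TC"
  then show "c \<in> {c. finite {s. c s \<noteq> 0} \<and> (\<forall>s. c s \<noteq> 0 \<longrightarrow> s \<in> T)}"
    using coord_finite coord_outside by auto
next
  fix c :: "nat \<Rightarrow> 'k" assume "c \<in> {c. finite {s. c s \<noteq> 0} \<and> (\<forall>s. c s \<noteq> 0 \<longrightarrow> s \<in> T)}"
  then have fin: "finite {s. c s \<noteq> 0}" and T: "\<And>s. c s \<noteq> 0 \<Longrightarrow> s \<in> T" by auto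
  let ?g = "\<lambda>n. cls n (rep n c)"
  have "{n. ?g n \<noteq> cls n 0} \<subseteq> \<omega> ` {s. c s \<noteq> 0}"
  proof
    fix n assume n: "n \<in> {n. ?g n \<noteq> cls n 0}"
    show "n \<in> \<omega> ` {s. c s \<noteq> 0}"
    proof (rule ccontr)
      assume "n \<notin> \<omega> ` {s. c s \<noteq> 0}"
      then have "rep n c = 0" by (intro rep_0) blast
      then show False using n by simp
    qed
  qed
  then have "finite {n. ?g n \<noteq> cls n 0}" by (rule finite_subset) (simp add: fin)
  then have g: "?g \<in> carrier TC" unfolding TC_carrier using rep_mem by blast
  have "coord ?g s = c s" for s
  proof (cases "s \<in> T")
    case True
    then show ?thesis using coord_eq[OF True, of ?g "rep (\<omega> s) c"] by (simp add: rep_def)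
  next
    case False
    then show ?thesis using T coord_outside by metis
  qed
  then have "c = coord ?g" by auto
  then show "c \<in> coord ` carrier TC" using g by (rule image_eqI)
qed

theorem tangent_cone_coordinates:
  "cone_coordinates T (TC :: (nat \<Rightarrow> 'k::field fps set) ring) coord"
proof (intro cone_coordinates.intro numsemi_axioms cone_coordinates_axioms.intro)
  show "inj_on coord (carrier (TC :: (nat \<Rightarrow> 'k fps set) ring))"
  proof (rule inj_onI)
    fix g h :: "nat \<Rightarrow> 'k fps set" assume gh: "g \<in> carrier TC" "h \<in> carrier TC" "coord g = coord h"
    show "g = h"
    proof
      show "g n = h n" for n using component_eq[OF gh(1), of n] component_eq[OF gh(2), of n] gh(3) by simp
    qed
  qed
  show "coord (g \<oplus>\<^bsub>TC\<^esub> h) s = coord g s + coord h s"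
    if gh: "g \<in> carrier TC" "h \<in> carrier TC" for g h :: "nat \<Rightarrow> 'k fps set" and s
  proof (cases "s \<in> T")
    case True
    then show ?thesis
      using coord_eq[where g = "g \<oplus>\<^bsub>TC\<^esub> h", OF True TC_add_component[OF gh]] by (simp add: rep_def)
  qed (simp add: coord_outside)
  show "coord \<zero>\<^bsub>TC\<^esub> s = (0 :: 'k)" for s
    using coord_eq[of s "\<zero>\<^bsub>TC\<^esub>" "0 :: 'k fps"] coord_outside[of s "\<zero>\<^bsub>TC\<^esub>"]
    by (cases "s \<in> T") (auto simp: TC_zero)
  show "coord \<one>\<^bsub>TC\<^esub> s = (if s = 0 then 1 else 0 :: 'k)" for s
  proof (cases "s \<in> T")
    case True
    have "coord \<one>\<^bsub>TC\<^esub> s = fps_nth (if \<omega> s = 0 then 1 else 0 :: 'k fps) s"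
      by (rule coord_eq[OF True]) (simp add: TC_one)
    then show ?thesis using semigroup_ord_pos[OF submonoid True] by (auto simp: fps_one_nth)
  next
    case False
    then have "s \<noteq> 0" using zero_mem by metis
    then show ?thesis using False by (simp add: coord_outside)
  qed
qed (rule coord_range TC_add_closed TC_mult_closed TC_zero_closed TC_one_closed coord_mult; assumption)+

end

text \<open>
  Garcia's criterion: the tangent cone is Cohen-Macaulay if and only if the class of the monomial of
  least positive degree is a nonzerodivisor on it.
\<close>

theorem cohen_macaulay_tangent_cone_iff:
  assumes "numerical_semigroup T"
  shows "cohen_macaulay (tangent_cone TYPE('k::field) T) \<longleftrightarrow> ord_shift_additive T"
proof -
  have "numsemi T" using assms by (rule numsemi.intro)
  from numsemi.tangent_cone_coordinates[OF this]
  show ?thesis by (rule cone_coordinates.cohen_macaulay_R_iff)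
qed

theorem corollary3p17:
  fixes S1 S2 S :: "nat set" and m n :: "nat \<Rightarrow> nat" and d k p q :: nat
  assumes "numerical_semigroup S1" and "numerical_semigroup S2"
    and "minimally_generated S1 m d" and "minimally_generated S2 n k"
    and "nice_gluing m d n k p q S"
    and "cohen_macaulay (tangent_cone TYPE('k::field) S2)"
  shows "cohen_macaulay (tangent_cone TYPE('k) S) \<longleftrightarrow>
         cohen_macaulay (tangent_cone TYPE('k) S1)"
proof -
  have "ord_shift_additive S2"
    using assms(6) cohen_macaulay_tangent_cone_iff[OF assms(2), where ?'k = 'k] by simp
  note gluing = nice_gluing_ord_shift_additive[OF assms(1-5) this]
  show ?thesis
    unfolding cohen_macaulay_tangent_cone_iff[OF gluing(1)] cohen_macaulay_tangent_cone_iff[OF assms(1)]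
    by (rule gluing(2))
qed

end
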